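(* Let $d\in\mathbb{N}$, $s>1/2$, $0<\delta<1/3$, $\square\in\{\ast,\#\}$, and let $n\in\mathbb{N}$ be such that $$m:=\left\lfloor\frac{n}{48(\sqrt2\log(2n)-\log\delta)}\right\rfloor+1$$ is at least $2$. Draw the $n$ nodes of $\mathbf{X}=(\mathbf{x}^1,\dots,\mathbf{x}^n)$ uniformly i.i.d. at random from $\mathbb{T}^d$, let the cubature weight vector $\boldsymbol{q}=(q_1,\dots,q_n)^\top$ be the first column of $\overline{\mathbf{L}_m}\,\overline{(\mathbf{L}_m^*\mathbf{L}_m)^{-1}}$, and put $\mathrm{Q}^m_{\mathbf{X}}f:=\sum_{j=1}^nq_jf(\mathbf{x}^j)$ and $I(f):=\int_{\mathbb{T}^d}f(\mathbf{x})\,\mathrm{d}\mathbf{x}$. Then, with probability at least $1-3\delta$, $$\sup_{\|f\|_{\square}\le1}|I(f)-\mathrm{Q}^m_{\mathbf{X}}f|\le\sqrt{\frac{29}{\delta}}\,\max\Bigg\{\sigma_m^{\square},\sqrt{\frac{\log(8n)}{n}\sum_{k=m}^\infty(\sigma_k^{\square})^2}\Bigg\}.$$ In particular, there is a constant $C_d^{\square}>0$ depending on $d$ (and on $s$, but not on $n$ or $\delta$) such that for $0<\delta<1/3$ it holds with probability at least $1-3\delta$ $$\sup_{\|f\|_{\square}\le1}|I(f)-\mathrm{Q}^m_{\mathbf{X}}f|\le\frac{C_d^{\square}}{\sqrt\delta}\,n^{-s}(\log n)^{sd}.$$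
   Context: $\log$ is the natural logarithm. $\mathbb{T}^d\simeq[0,1)^d$ is the torus with Lebesgue (probability) measure and $\hat f_{\mathbf{k}}=\int_{\mathbb{T}^d}f(\mathbf{x})\exp(-2\pi\mathrm{i}\,\mathbf{k}\cdot\mathbf{x})\,\mathrm{d}\mathbf{x}$. For $k\in\mathbb{Z}$ let $w_{s,\ast}(k)=(1+(2\pi|k|)^{2s})^{1/2}$ and $w_{s,\#}(k)=(1+2\pi|k|)^s$. For $\square\in\{\ast,\#\}$ the space $H^s_{\mathrm{mix}}(\mathbb{T}^d)$ is normed by $\|f\|_{\square}:=\big(\sum_{\mathbf{k}\in\mathbb{Z}^d}|\hat f_{\mathbf{k}}|^2\prod_{j=1}^dw_{s,\square}(k_j)^2\big)^{1/2}$ and consists of the (continuous) functions with finite norm. $(\sigma_j^{\square})_{j\in\mathbb{N}}$ is the non-increasing rearrangement of the numbers $\prod_{i=1}^dw_{s,\square}(k_i)^{-1}$, $\mathbf{k}\in\mathbb{Z}^d$ (the singular numbers of the embedding into $L_2(\mathbb{T}^d)$), and $(\eta_j^{\square})_{j\in\mathbb{N}}$ are the Fourier functions $\exp(2\pi\mathrm{i}\,\mathbf{k}\cdot\mathbf{x})$ enumerated correspondingly (in particular $\eta_1^{\square}\equiv1$). $\mathbf{L}_m:=(\eta_k^{\square}(\mathbf{x}^j))_{j=1,\dots,n;\,k=1,\dots,m-1}\in\mathbb{C}^{n\times(m-1)}$; the weights are defined if $\mathbf{L}_m$ has full column rank, and the events are understood to include this. *)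

theory Defs
  imports
    "HOL-Probability.Probability"
    "Jordan_Normal_Form.DL_Rank"
    "Jordan_Normal_Form.Schur_Decomposition"
    "Jordan_Normal_Form.Gauss_Jordan_Elimination"
begin

(* "$" denotes components of vectors of type "_ ^ 'd" throughout; matrices of varying size
   (Jordan_Normal_Form) are accessed by name. *)
no_notation Matrix.vec_index (infixl \<open>$\<close> 100)

(* The torus is [0,1)^d with Lebesgue measure, d = CARD('d). *)
definition torus :: "(real ^ 'd) measure" where
  "torus = restrict_space lborel {x. \<forall>i. 0 \<le> x $ i \<and> x $ i < 1}"

(* Continuous functions on the torus are 1-periodic continuous functions on R^d. *)
definition torus_continuous :: "(real ^ 'd \<Rightarrow> complex) \<Rightarrow> bool" where
  "torus_continuous f \<longleftrightarrow> continuous_on UNIV f \<and>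
     (\<forall>x. \<forall>k :: int ^ 'd. f (x + (\<chi> i. of_int (k $ i))) = f x)"

definition fourier_fun :: "int ^ 'd \<Rightarrow> real ^ 'd \<Rightarrow> complex" where
  "fourier_fun k x = exp (2 * of_real pi * \<i> * of_real (\<Sum>i\<in>UNIV. of_int (k $ i) * x $ i))"

definition fourier_coeff :: "(real ^ 'd \<Rightarrow> complex) \<Rightarrow> int ^ 'd \<Rightarrow> complex" where
  "fourier_coeff f k =
     (LINT x|torus. f x * exp (- 2 * of_real pi * \<i> * of_real (\<Sum>i\<in>UNIV. of_int (k $ i) * x $ i)))"

datatype weight_kind = Star | Sharp

fun weight :: "weight_kind \<Rightarrow> real \<Rightarrow> int \<Rightarrow> real" where
  "weight Star s k = sqrt (1 + (2 * pi * \<bar>of_int k\<bar>) powr (2 * s))"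
| "weight Sharp s k = (1 + 2 * pi * \<bar>of_int k\<bar>) powr s"

definition mix_weight :: "weight_kind \<Rightarrow> real \<Rightarrow> int ^ 'd \<Rightarrow> real" where
  "mix_weight w s k = (\<Prod>i\<in>UNIV. weight w s (k $ i))"

definition Hmix :: "weight_kind \<Rightarrow> real \<Rightarrow> (real ^ 'd \<Rightarrow> complex) set" where
  "Hmix w s = {f. torus_continuous f \<and>
     (\<lambda>k. (cmod (fourier_coeff f k))\<^sup>2 * (mix_weight w s k)\<^sup>2) summable_on UNIV}"

definition Hmix_norm :: "weight_kind \<Rightarrow> real \<Rightarrow> (real ^ 'd \<Rightarrow> complex) \<Rightarrow> real" where
  "Hmix_norm w s f =
     sqrt (\<Sum>\<^sub>\<infinity>k\<in>UNIV. (cmod (fourier_coeff f k))\<^sup>2 * (mix_weight w s k)\<^sup>2)"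

(* A choice of the non-increasing rearrangement, indexed from 1. Ties make the enumeration of
   the frequencies non-unique; the singular numbers do not depend on the choice. *)
definition mix_enumeration :: "weight_kind \<Rightarrow> real \<Rightarrow> (nat \<Rightarrow> int ^ 'd) \<Rightarrow> bool" where
  "mix_enumeration w s e \<longleftrightarrow> bij_betw e {1..} UNIV \<and>
     (\<forall>i j. 1 \<le> i \<and> i \<le> j \<longrightarrow> inverse (mix_weight w s (e j)) \<le> inverse (mix_weight w s (e i)))"

definition sing_num :: "weight_kind \<Rightarrow> real \<Rightarrow> (nat \<Rightarrow> int ^ 'd) \<Rightarrow> nat \<Rightarrow> real" where
  "sing_num w s e j = inverse (mix_weight w s (e j))"

definition num_freq :: "nat \<Rightarrow> real \<Rightarrow> nat" where
  "num_freq n \<delta> = nat \<lfloor>real n / (48 * (sqrt 2 * ln (2 * real n) - ln \<delta>))\<rfloor> + 1"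

(* Nodes and matrix entries are indexed from 0, the functions fourier_fun (e k) from 1. *)
definition L_mat :: "(nat \<Rightarrow> int ^ 'd) \<Rightarrow> nat \<Rightarrow> nat \<Rightarrow> (nat \<Rightarrow> real ^ 'd) \<Rightarrow> complex mat" where
  "L_mat e n m X = mat n (m - 1) (\<lambda>(j, k). fourier_fun (e (k + 1)) (X j))"

definition full_column_rank :: "complex mat \<Rightarrow> bool" where
  "full_column_rank A \<longleftrightarrow> vec_space.rank (dim_row A) A = dim_col A"

(* mat_inverse returns None for singular matrices; full column rank of L excludes this. *)
definition cub_weights :: "(nat \<Rightarrow> int ^ 'd) \<Rightarrow> nat \<Rightarrow> nat \<Rightarrow> (nat \<Rightarrow> real ^ 'd) \<Rightarrow> complex vec" where
  "cub_weights e n m X =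
     (let L = L_mat e n m X
      in col (map_mat cnj L * map_mat cnj (the (mat_inverse (mat_adjoint L * L)))) 0)"

definition cubature ::
  "(nat \<Rightarrow> int ^ 'd) \<Rightarrow> nat \<Rightarrow> nat \<Rightarrow> (nat \<Rightarrow> real ^ 'd) \<Rightarrow> (real ^ 'd \<Rightarrow> complex) \<Rightarrow> complex" where
  "cubature e n m X f = (\<Sum>j<n. Matrix.vec_index (cub_weights e n m X) j * f (X j))"

(* The supremum is taken in ereal, so that it is meaningful even if unbounded. *)
definition worst_case_error ::
  "weight_kind \<Rightarrow> real \<Rightarrow> (nat \<Rightarrow> int ^ 'd) \<Rightarrow> nat \<Rightarrow> nat \<Rightarrow> (nat \<Rightarrow> real ^ 'd) \<Rightarrow> ereal" where
  "worst_case_error w s e n m X =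
     (SUP f\<in>{f \<in> Hmix w s. Hmix_norm w s f \<le> 1}.
        ereal (cmod ((LINT x|torus. f x) - cubature e n m X f)))"

definition random_nodes :: "nat \<Rightarrow> (nat \<Rightarrow> real ^ 'd) measure" where
  "random_nodes n = PiM {..<n} (\<lambda>_. torus)"

end

theory Submission
  imports Defs
begin

text \<open>
Write \<open>\<eta>\<^sub>k\<close> for the exponential with frequency \<open>e k\<close> and \<open>\<sigma>\<^sub>k\<close> for its singular number. Once the
\<open>n \<times> (m - 1)\<close> matrix \<open>L\<close> has full column rank, the weights \<open>q\<close> integrate \<open>\<eta>\<^sub>1, \<dots>, \<eta>\<^sub>m\<^sub>-\<^sub>1\<close> exactly.
Functions in the unit ball are the pointwise sums of their Fourier series, so duality turns the
squared worst-case error into the sum of \<open>\<sigma>\<^sub>k\<^sup>2 \<bar>\<Sum>\<^sub>j q\<^sub>j \<eta>\<^sub>k(x\<^sub>j)\<bar>\<^sup>2\<close> over \<open>k \<ge> m\<close>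
(\<open>worst_case_error_le_iff\<close>, \<open>worst_case_error_le_tail\<close>). The formula also makes the event
measurable, because by Cramer's rule the weights are rational expressions in the entries of \<open>L\<close>.

Two properties of the random nodes control this sum. First, with probability at least \<open>1 - \<delta>\<close> the
Gram matrix \<open>L\<^sup>* L / n\<close> differs from the identity by at most \<open>1/2\<close>; then \<open>L\<close> has full column rank
and \<open>\<Sum>\<^sub>j \<bar>q\<^sub>j\<bar>\<^sup>2 \<le> 2 / n\<close> (\<open>stable_nodes_event\<close>). Secondly, the tail is cut into blocks of
\<open>b \<approx> n / ln (8 n)\<close> consecutive indices. On one block \<open>\<sigma>\<^sub>k\<close> is at most its value at the start of
the block, and the sum of \<open>\<bar>\<Sum>\<^sub>j q\<^sub>j \<eta>\<^sub>k(x\<^sub>j)\<bar>\<^sup>2\<close> is at most \<open>n \<Sum>\<^sub>j \<bar>q\<^sub>j\<bar>\<^sup>2\<close> times the norm of the Gram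
matrix of the block, which is at most 9 on average. The squares of the leading singular numbers of
all blocks add up to at most \<open>\<sigma>\<^sub>m\<^sup>2 + (1 / b) \<Sum>\<^sub>k\<^sub>\<ge>\<^sub>m \<sigma>\<^sub>k\<^sup>2\<close>, which is at most three times the square of
the maximum in the claim. By Markov's inequality the resulting bound fails with probability at most
\<open>(54 / 29) \<delta>\<close>, and the two exceptional probabilities together stay below \<open>3 \<delta>\<close>.

Both statements about Gram matrices follow from one estimate of the trace of even powers of
\<open>Z = L\<^sup>* L / n - 1\<close> (\<open>moment_even_le\<close>). It is proved by exchanging one node for an independent copy:
the change of \<open>Z\<^sup>N\<close> is controlled by a trace inequality for Hermitian matrices (\<open>ktr_diff_kpow_le\<close>),
and since the squared deviation of a single node is again an affine function of this deviation
(\<open>dev_square\<close>), the moments satisfy a closed recursion. The trace inequality needs nothing but the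
nonnegativity of Hilbert-Schmidt norms.

For the rate, counting lattice points in hyperbolic crosses gives
\<open>\<sigma>\<^sub>j \<le> (2\<^sup>d (1 + ln j)\<^sup>d\<^sup>-\<^sup>1 / j)\<^sup>s\<close>. As long as \<open>\<delta> \<ge> n\<^sup>-\<^sup>2\<^sup>s\<close>, the number \<open>m\<close> is at least a multiple of
\<open>n / ln n\<close>, and inserting this in the first bound yields the claim. For smaller \<open>\<delta>\<close> the factor
\<open>1 / sqrt \<delta>\<close> exceeds \<open>n\<^sup>s\<close>, and the bound \<open>2 \<Sum>\<^sub>k \<sigma>\<^sub>k\<^sup>2\<close> for the squared error, which follows
from the first property alone, is good enough.
\<close>

section \<open>Matrices indexed by a finite set of frequencies\<close>

text \<open>Square matrices with index set \<open>S\<close> are functions that vanish outside \<open>S \<times> S\<close> (\<open>ksupp\<close>). The set of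
frequencies changes from block to block, so it is an argument of the operations; on matrices with this
support \<open>kid S\<close> is a true identity, and equalities of matrices are equalities of functions.\<close>
definition kmul :: "'k set \<Rightarrow> ('k \<Rightarrow> 'k \<Rightarrow> complex) \<Rightarrow> ('k \<Rightarrow> 'k \<Rightarrow> complex) \<Rightarrow> 'k \<Rightarrow> 'k \<Rightarrow> complex" where
  "kmul S A B = (\<lambda>k l. \<Sum>i\<in>S. A k i * B i l)"

definition kid :: "'k set \<Rightarrow> 'k \<Rightarrow> 'k \<Rightarrow> complex" where
  "kid S = (\<lambda>k l. of_bool (k = l \<and> k \<in> S))"

primrec kpow :: "'k set \<Rightarrow> ('k \<Rightarrow> 'k \<Rightarrow> complex) \<Rightarrow> nat \<Rightarrow> 'k \<Rightarrow> 'k \<Rightarrow> complex" where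
  "kpow S A 0 = kid S"
| "kpow S A (Suc n) = kmul S A (kpow S A n)"

definition ktr :: "'k set \<Rightarrow> ('k \<Rightarrow> 'k \<Rightarrow> complex) \<Rightarrow> complex" where
  "ktr S A = (\<Sum>k\<in>S. A k k)"

definition kadj :: "('k \<Rightarrow> 'k \<Rightarrow> complex) \<Rightarrow> 'k \<Rightarrow> 'k \<Rightarrow> complex" where
  "kadj A = (\<lambda>k l. cnj (A l k))"

definition ksupp :: "'k set \<Rightarrow> ('k \<Rightarrow> 'k \<Rightarrow> complex) \<Rightarrow> bool" where
  "ksupp S A \<longleftrightarrow> (\<forall>k l. k \<notin> S \<or> l \<notin> S \<longrightarrow> A k l = 0)"

text \<open>Convexity makes the increments of \<open>h\<close> nondecreasing; compare the first \<open>i\<close> of them with the last \<open>i\<close>.\<close>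
lemma convex_seq_ends:
  fixes h :: "nat \<Rightarrow> real"
  assumes "\<And>i. i + 2 \<le> P \<Longrightarrow> 2 * h (i + 1) \<le> h i + h (i + 2)" "i \<le> P"
  shows "h i + h (P - i) \<le> h 0 + h P"
proof -
  have inc: "h (Suc a) - h a \<le> h (Suc (a + t)) - h (a + t)" if "Suc (a + t) \<le> P" for a t
    using that
  proof (induction t)
    case (Suc t)
    then show ?case using assms(1)[of "a + t"] by simp
  qed simp
  have "h i - h 0 = (\<Sum>t<i. h (Suc t) - h t)"
    by (simp add: sum_lessThan_telescope)
  also have "\<dots> \<le> (\<Sum>t<i. h (Suc (t + (P - i))) - h (t + (P - i)))"
    using \<open>i \<le> P\<close> by (intro sum_mono inc) auto
  also have "\<dots> = h P - h (P - i)"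
    using sum_lessThan_telescope[of "\<lambda>t. h (t + (P - i))" i] \<open>i \<le> P\<close> by simp
  finally show ?thesis by simp
qed

context
  fixes S :: "'k set"
  assumes fin: "finite S"
begin

abbreviation (input) kmul_infix (infixl \<open>\<diamondop>\<close> 70) where "A \<diamondop> B \<equiv> kmul S A B"

lemma kmul_assoc: "(A \<diamondop> B) \<diamondop> C = A \<diamondop> (B \<diamondop> C)"
proof (intro ext)
  fix k l
  have "((A \<diamondop> B) \<diamondop> C) k l = (\<Sum>i\<in>S. \<Sum>j\<in>S. A k j * B j i * C i l)"
    by (simp add: kmul_def sum_distrib_right)
  also have "\<dots> = (\<Sum>j\<in>S. \<Sum>i\<in>S. A k j * B j i * C i l)"
    by (rule sum.swap)
  also have "\<dots> = (A \<diamondop> (B \<diamondop> C)) k l"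
    by (simp add: kmul_def sum_distrib_left mult.assoc)
  finally show "((A \<diamondop> B) \<diamondop> C) k l = (A \<diamondop> (B \<diamondop> C)) k l" .
qed

lemma kmul_kid_left: "ksupp S A \<Longrightarrow> kid S \<diamondop> A = A"
proof (intro ext)
  fix k l assume A: "ksupp S A"
  have "(kid S \<diamondop> A) k l = (\<Sum>i\<in>S. if k = i then A i l else 0)"
    unfolding kmul_def kid_def by (intro sum.cong) auto
  also have "\<dots> = A k l"
    using fin A by (simp add: ksupp_def)
  finally show "(kid S \<diamondop> A) k l = A k l" .
qed

lemma kmul_kid_right: "ksupp S A \<Longrightarrow> A \<diamondop> kid S = A"
proof (intro ext)
  fix k l assume A: "ksupp S A"
  have "(A \<diamondop> kid S) k l = (\<Sum>i\<in>S. if l = i then A k i else 0)"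
    unfolding kmul_def kid_def by (intro sum.cong) auto
  also have "\<dots> = A k l"
    using fin A by (simp add: ksupp_def)
  finally show "(A \<diamondop> kid S) k l = A k l" .
qed

lemma ksupp_kid: "ksupp S (kid S)"
  by (auto simp: ksupp_def kid_def)

lemma ksupp_kmul: "ksupp S A \<Longrightarrow> ksupp S B \<Longrightarrow> ksupp S (A \<diamondop> B)"
  by (auto simp: ksupp_def kmul_def)

lemma ksupp_kpow: "ksupp S A \<Longrightarrow> ksupp S (kpow S A n)"
  by (induction n) (auto intro: ksupp_kid ksupp_kmul)

lemma kpow_add: "ksupp S A \<Longrightarrow> kpow S A (i + j) = kpow S A i \<diamondop> kpow S A j"
  by (induction i) (auto simp: kmul_kid_left ksupp_kpow kmul_assoc)

lemma ktr_comm: "ktr S (A \<diamondop> B) = ktr S (B \<diamondop> A)"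
proof -
  have "ktr S (A \<diamondop> B) = (\<Sum>k\<in>S. \<Sum>i\<in>S. A k i * B i k)"
    by (simp add: ktr_def kmul_def)
  also have "\<dots> = (\<Sum>i\<in>S. \<Sum>k\<in>S. A k i * B i k)" by (rule sum.swap)
  also have "\<dots> = ktr S (B \<diamondop> A)"
    by (simp add: ktr_def kmul_def mult.commute)
  finally show ?thesis .
qed

lemma kadj_kmul: "kadj (A \<diamondop> B) = kadj B \<diamondop> kadj A"
  by (simp add: kadj_def kmul_def mult.commute)

lemma kadj_kpow:
  assumes "ksupp S A" "kadj A = A"
  shows "kadj (kpow S A n) = kpow S A n"
proof (induction n)
  case 0
  show ?case by (auto simp: kadj_def kid_def fun_eq_iff)
next
  case (Suc n)
  have "kpow S A (Suc n) = kpow S A n \<diamondop> A"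
    using kpow_add[OF assms(1), of n 1] by (simp add: kmul_kid_right assms(1))
  then show ?case using assms Suc by (simp add: kadj_kmul)
qed

lemma Re_ktr_kadj: "Re (ktr S (A \<diamondop> kadj B)) = (\<Sum>k\<in>S. \<Sum>l\<in>S. Re (A k l * cnj (B k l)))"
  by (simp add: ktr_def kmul_def kadj_def)

lemma Re_ktr_kadj_self: "Re (ktr S (A \<diamondop> kadj A)) = (\<Sum>k\<in>S. \<Sum>l\<in>S. (cmod (A k l))\<^sup>2)"
  unfolding Re_ktr_kadj by (simp add: complex_mult_cnj cmod_def)

text \<open>This is \<open>2 \<bar>Re \<langle>A, B\<rangle>\<bar> \<le> \<parallel>A\<parallel>\<^sup>2 + \<parallel>B\<parallel>\<^sup>2\<close> for the Hilbert-Schmidt inner product. It is the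
only source of inequalities between traces below.\<close>
lemma Re_ktr_kadj_le:
  "2 * \<bar>Re (ktr S (A \<diamondop> kadj B))\<bar> \<le> Re (ktr S (A \<diamondop> kadj A)) + Re (ktr S (B \<diamondop> kadj B))"
proof -
  have *: "2 * \<bar>Re (a * cnj b)\<bar> \<le> (cmod a)\<^sup>2 + (cmod b)\<^sup>2" for a b :: complex
  proof -
    have "2 * \<bar>Re (a * cnj b)\<bar> \<le> 2 * (cmod a * cmod b)"
      using abs_Re_le_cmod[of "a * cnj b"] by (simp add: norm_mult)
    also have "\<dots> \<le> (cmod a)\<^sup>2 + (cmod b)\<^sup>2"
      using sum_squares_bound[of "cmod a" "cmod b"] by simp
    finally show ?thesis .
  qed
  have "2 * \<bar>\<Sum>k\<in>S. \<Sum>l\<in>S. Re (A k l * cnj (B k l))\<bar>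
      \<le> (\<Sum>k\<in>S. \<Sum>l\<in>S. 2 * \<bar>Re (A k l * cnj (B k l))\<bar>)"
    unfolding sum_distrib_left[symmetric]
    by (intro mult_left_mono order_trans[OF sum_abs] sum_mono) auto
  also have "\<dots> \<le> (\<Sum>k\<in>S. \<Sum>l\<in>S. (cmod (A k l))\<^sup>2 + (cmod (B k l))\<^sup>2)"
    by (intro sum_mono *)
  finally show ?thesis
    unfolding Re_ktr_kadj_self Re_ktr_kadj by (simp add: sum.distrib)
qed

lemma ktr_kmul_sum: "ktr S (A \<diamondop> (\<lambda>k l. \<Sum>q\<in>Q. B q k l)) = (\<Sum>q\<in>Q. ktr S (A \<diamondop> B q))"
proof -
  have "(A \<diamondop> (\<lambda>k l. \<Sum>q\<in>Q. B q k l)) k l = (\<Sum>q\<in>Q. (A \<diamondop> B q) k l)" for k l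
    unfolding kmul_def sum_distrib_left by (rule sum.swap)
  then show ?thesis unfolding ktr_def by (simp only:) (rule sum.swap)
qed

lemma ktr_kmul_add: "ktr S (A \<diamondop> (\<lambda>k l. B k l + C k l)) = ktr S (A \<diamondop> B) + ktr S (A \<diamondop> C)"
  by (simp add: ktr_def kmul_def algebra_simps sum.distrib)

section \<open>A trace inequality for Hermitian matrices\<close>

lemma kpow_diff:
  "kpow S X N k l - kpow S W N k l =
     (\<Sum>q<N. (kpow S X q \<diamondop> ((\<lambda>k l. X k l - W k l) \<diamondop> kpow S W (N - Suc q))) k l)"
  if "ksupp S X" "ksupp S W"
proof (induction N arbitrary: k l)
  case 0
  show ?case by simp
next
  case (Suc N)
  let ?D = "\<lambda>k l. X k l - W k l"
  have D: "ksupp S ?D" using that by (auto simp: ksupp_def)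
  have "kpow S X (Suc N) k l - kpow S W (Suc N) k l
      = (\<Sum>i\<in>S. X k i * (kpow S X N i l - kpow S W N i l)) + (?D \<diamondop> kpow S W N) k l"
    by (simp add: kmul_def algebra_simps sum.distrib sum_subtractf)
  also have "(\<Sum>i\<in>S. X k i * (kpow S X N i l - kpow S W N i l))
      = (\<Sum>i\<in>S. \<Sum>q<N. X k i * (kpow S X q \<diamondop> (?D \<diamondop> kpow S W (N - Suc q))) i l)"
    by (simp add: Suc sum_distrib_left)
  also have "\<dots> = (\<Sum>q<N. (X \<diamondop> (kpow S X q \<diamondop> (?D \<diamondop> kpow S W (N - Suc q)))) k l)"
    by (subst sum.swap) (simp add: kmul_def)
  also have "(?D \<diamondop> kpow S W N) k l = (kpow S X 0 \<diamondop> (?D \<diamondop> kpow S W (Suc N - Suc 0))) k l"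
    using that D by (simp add: kmul_kid_left ksupp_kmul ksupp_kpow)
  finally show ?case
    unfolding sum.lessThan_Suc_shift
    by (simp add: kmul_assoc)
qed

text \<open>With spectral decompositions this is \<open>\<lambda>\<^sup>q \<mu>\<^sup>r + \<lambda>\<^sup>r \<mu>\<^sup>q \<le> \<lambda>\<^sup>2\<^sup>P + \<mu>\<^sup>2\<^sup>P\<close> for \<open>q + r = 2 P\<close>. The
decompositions can be avoided: the Hilbert-Schmidt inequality, applied to the matrices \<open>X\<^sup>i D W\<^sup>P\<^sup>-\<^sup>i\<close>,
shows that \<open>g\<close> is convex along the even arguments and that an odd argument contributes at most the
mean of its two even neighbours.\<close>
lemma ktr_sandwich_le:
  assumes D: "ksupp S D" "kadj D = D" and X: "ksupp S X" "kadj X = X" and W: "ksupp S W" "kadj W = W"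
    and q: "q \<le> 2 * P"
  defines "g \<equiv> \<lambda>q. Re (ktr S (D \<diamondop> (kpow S X q \<diamondop> (D \<diamondop> kpow S W (2 * P - q)))))"
  shows "g q + g (2 * P - q) \<le> g 0 + g (2 * P)"
proof -
  have mid: "2 * g (i + k) \<le> g (2 * i) + g (2 * k)" if "i \<le> P" "k \<le> P" for i k
  proof -
    define T where "T = (\<lambda>i. kpow S X i \<diamondop> (D \<diamondop> kpow S W (P - i)))"
    have *: "Re (ktr S (T i \<diamondop> kadj (T k))) = g (i + k)" if "i \<le> P" "k \<le> P" for i k
    proof -
      have "T i \<diamondop> kadj (T k) = kpow S X i \<diamondop> ((D \<diamondop> (kpow S W (P - i) \<diamondop> (kpow S W (P - k) \<diamondop> D))) \<diamondop> kpow S X k)"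
        unfolding T_def by (simp add: kadj_kmul kadj_kpow D X W kmul_assoc)
      then have "ktr S (T i \<diamondop> kadj (T k)) =
           ktr S ((D \<diamondop> (kpow S W (P - i) \<diamondop> (kpow S W (P - k) \<diamondop> D))) \<diamondop> (kpow S X k \<diamondop> kpow S X i))"
        by (simp only: ktr_comm[of "kpow S X i"] kmul_assoc)
      also have "\<dots> = ktr S ((D \<diamondop> kpow S W (2 * P - (i + k))) \<diamondop> (D \<diamondop> kpow S X (i + k)))"
        using that kpow_add[OF W(1), of "P - i" "P - k"] kpow_add[OF X(1), of k i]
        by (simp add: kmul_assoc add.commute mult_2)
      also have "\<dots> = ktr S (D \<diamondop> (kpow S X (i + k) \<diamondop> (D \<diamondop> kpow S W (2 * P - (i + k)))))"
        by (subst ktr_comm) (simp add: kmul_assoc)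
      finally show ?thesis by (simp add: g_def)
    qed
    show ?thesis
      using Re_ktr_kadj_le[of "T i" "T k"] *[OF that] *[OF that(1) that(1)] *[OF that(2) that(2)]
      unfolding mult_2 by linarith
  qed
  have conv: "g (2 * i) + g (2 * (P - i)) \<le> g 0 + g (2 * P)" if "i \<le> P" for i
  proof -
    have "2 * g (2 * (i + 1)) \<le> g (2 * i) + g (2 * (i + 2))" if "i + 2 \<le> P" for i
    proof -
      have "i + (i + 2) = 2 * (i + 1)" by simp
      from mid[of i "i + 2", unfolded this] that show ?thesis by linarith
    qed
    from convex_seq_ends[of P "\<lambda>i. g (2 * i)", OF this that] show ?thesis by simp
  qed
  show ?thesis
  proof (cases "even q")
    case True
    then obtain i where "q = 2 * i" by (rule evenE)
    moreover have "2 * P - 2 * i = 2 * (P - i)" "i \<le> P" using q calculation by simp_all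
    ultimately show ?thesis using conv[of i] by metis
  next
    case False
    then obtain i where i: "q = 2 * i + 1" by (rule oddE)
    then have iP: "Suc i \<le> P" using q by simp
    have e: "2 * P - q = (P - Suc i) + (P - i)" using i iP by simp
    have "2 * g q \<le> g (2 * i) + g (2 * Suc i)"
    proof -
      have "i + Suc i = q" using i by simp
      from mid[of i "Suc i", unfolded this] iP show ?thesis by linarith
    qed
    moreover have "2 * g (2 * P - q) \<le> g (2 * (P - Suc i)) + g (2 * (P - i))"
      unfolding e using mid[of "P - Suc i" "P - i"] iP by simp
    moreover have "g (2 * i) + g (2 * (P - i)) \<le> g 0 + g (2 * P)"
      "g (2 * Suc i) + g (2 * (P - Suc i)) \<le> g 0 + g (2 * P)"
      using iP by (intro conv; simp)+
    ultimately show ?thesis by linarith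
  qed
qed

text \<open>Telescoping writes the difference of the two powers as the sum over \<open>q \<le> 2 P\<close> of \<open>X\<^sup>q D W\<^sup>2\<^sup>P\<^sup>-\<^sup>q\<close>.
Pairing the summands \<open>q\<close> and \<open>2 P - q\<close> bounds each pair by the two extreme ones.\<close>
lemma ktr_diff_kpow_le:
  assumes X: "ksupp S X" "kadj X = X" and W: "ksupp S W" "kadj W = W"
  defines "D \<equiv> \<lambda>k l. X k l - W k l"
  shows "Re (ktr S (D \<diamondop> (\<lambda>k l. kpow S X (2 * P + 1) k l - kpow S W (2 * P + 1) k l)))
     \<le> real (2 * P + 1) / 2 * Re (ktr S ((D \<diamondop> D) \<diamondop> (\<lambda>k l. kpow S X (2 * P) k l + kpow S W (2 * P) k l)))"
proof -
  have D: "ksupp S D" "kadj D = D"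
    using X W by (auto simp: D_def ksupp_def kadj_def fun_eq_iff)
  define g where "g = (\<lambda>q. Re (ktr S (D \<diamondop> (kpow S X q \<diamondop> (D \<diamondop> kpow S W (2 * P - q))))))"
  have e: "2 * P + 1 - Suc q = 2 * P - q" for q by simp
  have "(\<lambda>k l. kpow S X (2 * P + 1) k l - kpow S W (2 * P + 1) k l)
      = (\<lambda>k l. \<Sum>q<2 * P + 1. (kpow S X q \<diamondop> (D \<diamondop> kpow S W (2 * P - q))) k l)"
    unfolding D_def by (intro ext trans[OF kpow_diff[OF X(1) W(1)]]) (simp only: e)
  then have "Re (ktr S (D \<diamondop> (\<lambda>k l. kpow S X (2 * P + 1) k l - kpow S W (2 * P + 1) k l)))
      = Re (ktr S (D \<diamondop> (\<lambda>k l. \<Sum>q<2 * P + 1. (kpow S X q \<diamondop> (D \<diamondop> kpow S W (2 * P - q))) k l)))"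
    by (simp only:)
  also have "\<dots> = (\<Sum>q<2 * P + 1. g q)"
    unfolding g_def ktr_kmul_sum Re_sum ..
  also have "\<dots> = (\<Sum>q\<le>2 * P. g q)" by (simp only: Suc_eq_plus1[symmetric] lessThan_Suc_atMost)
  finally have 1: "Re (ktr S (D \<diamondop> (\<lambda>k l. kpow S X (2 * P + 1) k l - kpow S W (2 * P + 1) k l))) = (\<Sum>q\<le>2 * P. g q)" .
  have "2 * (\<Sum>q\<le>2 * P. g q) = (\<Sum>q\<le>2 * P. g q) + (\<Sum>q\<le>2 * P. g (2 * P - q))"
    using sum.atLeastAtMost_rev[of g 0 "2 * P"] by (simp add: atLeast0AtMost)
  also have "\<dots> = (\<Sum>q\<le>2 * P. g q + g (2 * P - q))" by (simp add: sum.distrib)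
  also have "\<dots> \<le> (\<Sum>q\<le>2 * P. g 0 + g (2 * P))"
    unfolding g_def by (intro sum_mono ktr_sandwich_le D X W) auto
  also have "\<dots> = real (2 * P + 1) * (g 0 + g (2 * P))" by simp
  also have "g (2 * P) = Re (ktr S ((D \<diamondop> D) \<diamondop> kpow S X (2 * P)))"
  proof -
    have "ktr S (D \<diamondop> (kpow S X (2 * P) \<diamondop> D)) = ktr S ((D \<diamondop> D) \<diamondop> kpow S X (2 * P))"
      by (subst ktr_comm, subst (2) ktr_comm) (simp add: kmul_assoc)
    then show ?thesis by (simp add: g_def kmul_kid_right D)
  qed
  also have "g 0 = Re (ktr S ((D \<diamondop> D) \<diamondop> kpow S W (2 * P)))"
    by (simp add: g_def kmul_kid_left ksupp_kmul ksupp_kpow D W kmul_assoc)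
  also have "Re (ktr S ((D \<diamondop> D) \<diamondop> kpow S W (2 * P))) + Re (ktr S ((D \<diamondop> D) \<diamondop> kpow S X (2 * P)))
     = Re (ktr S ((D \<diamondop> D) \<diamondop> (\<lambda>k l. kpow S X (2 * P) k l + kpow S W (2 * P) k l)))"
    by (simp add: ktr_kmul_add)
  finally show ?thesis using 1 by simp
qed

end

section \<open>Bounded measurable functions\<close>

text \<open>The random matrices of the next parts and the traces of their powers are polynomials in the bounded
functions \<open>\<eta>\<^sub>k\<close> and their conjugates. This class is closed under the matrix operations, which settles
measurability and integrability at once.\<close>
definition bmeas :: "'a measure \<Rightarrow> ('a \<Rightarrow> complex) \<Rightarrow> bool" where
  "bmeas N f \<longleftrightarrow> f \<in> borel_measurable N \<and> (\<exists>B. \<forall>x\<in>space N. cmod (f x) \<le> B)"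

lemma bmeas_const: "bmeas N (\<lambda>_. c)"
  by (auto simp: bmeas_def)

lemma bmeas_add: "bmeas N f \<Longrightarrow> bmeas N g \<Longrightarrow> bmeas N (\<lambda>x. f x + g x)"
  unfolding bmeas_def by (auto intro!: borel_measurable_add) (meson add_mono norm_triangle_le)

lemma bmeas_mult: "bmeas N f \<Longrightarrow> bmeas N g \<Longrightarrow> bmeas N (\<lambda>x. f x * g x)"
  unfolding bmeas_def
proof (safe, goal_cases)
  case (2 B C)
  then have "cmod (f x * g x) \<le> \<bar>B\<bar> * \<bar>C\<bar>" if "x \<in> space N" for x
    unfolding norm_mult using that by (intro mult_mono) fastforce+
  then show ?case by blast
qed auto

lemma bmeas_cnj: "bmeas N f \<Longrightarrow> bmeas N (\<lambda>x. cnj (f x))"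
  unfolding bmeas_def
  by (auto intro!: measurable_compose[OF _ borel_measurable_continuous_onI[of cnj]] continuous_intros)

lemma bmeas_diff: "bmeas N f \<Longrightarrow> bmeas N g \<Longrightarrow> bmeas N (\<lambda>x. f x - g x)"
  using bmeas_add[of N f "\<lambda>x. - 1 * g x"] bmeas_mult[of N "\<lambda>_. - 1" g] by (simp add: bmeas_const)

lemma bmeas_sum: "(\<And>i. i \<in> I \<Longrightarrow> bmeas N (f i)) \<Longrightarrow> bmeas N (\<lambda>x. \<Sum>i\<in>I. f i x)"
  by (induction I rule: infinite_finite_induct) (auto intro: bmeas_const bmeas_add)

lemma bmeas_compose: "bmeas N f \<Longrightarrow> g \<in> measurable M N \<Longrightarrow> bmeas M (\<lambda>x. f (g x))"
  unfolding bmeas_def by (auto dest: measurable_space)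

lemma bmeas_kmul:
  "(\<And>k l. bmeas N (\<lambda>x. A x k l)) \<Longrightarrow> (\<And>k l. bmeas N (\<lambda>x. B x k l)) \<Longrightarrow>
     bmeas N (\<lambda>x. kmul S (A x) (B x) k l)"
  unfolding kmul_def by (intro bmeas_sum bmeas_mult)

lemma bmeas_kpow: "(\<And>k l. bmeas N (\<lambda>x. A x k l)) \<Longrightarrow> bmeas N (\<lambda>x. kpow S (A x) n k l)"
  by (induction n arbitrary: k l) (auto intro!: bmeas_kmul bmeas_const)

lemma bmeas_ktr: "(\<And>k l. bmeas N (\<lambda>x. A x k l)) \<Longrightarrow> bmeas N (\<lambda>x. ktr S (A x))"
  unfolding ktr_def by (intro bmeas_sum)

lemmas bmeas_intros = bmeas_const bmeas_add bmeas_mult bmeas_cnj bmeas_diff bmeas_sum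
  bmeas_kmul bmeas_kpow bmeas_ktr

lemma (in prob_space) integrable_bmeas: "bmeas M f \<Longrightarrow> integrable M f"
  unfolding bmeas_def by (auto intro: integrable_const_bound)

lemma (in prob_space) integral_ktr_kmul:
  assumes "\<And>k l. bmeas M (\<lambda>x. A x k l)"
  shows "(\<integral>x. Re (ktr S (kmul S (A x) B)) \<partial>M) = Re (ktr S (kmul S (\<lambda>k l. \<integral>x. A x k l \<partial>M) B))"
proof -
  note [simp] = integrable_bmeas[OF assms]
  have "(\<integral>x. Re (ktr S (kmul S (A x) B)) \<partial>M) = Re (\<integral>x. ktr S (kmul S (A x) B) \<partial>M)"
    by (simp add: ktr_def kmul_def)
  also have "(\<integral>x. ktr S (kmul S (A x) B) \<partial>M) = ktr S (kmul S (\<lambda>k l. \<integral>x. A x k l \<partial>M) B)"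
    by (simp add: ktr_def kmul_def)
  finally show ?thesis .
qed

text \<open>Exchanging two independent copies preserves integrals, so it suffices to compare the symmetrized
integrands.\<close>
lemma (in prob_space) pair_integral_le_of_swap:
  fixes G H :: "'a \<times> 'a \<Rightarrow> real"
  assumes G: "integrable (M \<Otimes>\<^sub>M M) G" and H: "integrable (M \<Otimes>\<^sub>M M) H"
    and le: "\<And>x y. x \<in> space M \<Longrightarrow> y \<in> space M \<Longrightarrow> G (x, y) + G (y, x) \<le> H (x, y) + H (y, x)"
  shows "(\<integral>x. \<integral>y. G (x, y) \<partial>M \<partial>M) \<le> (\<integral>x. \<integral>y. H (x, y) \<partial>M \<partial>M)"
proof -
  interpret P: pair_prob_space M M ..
  have *: "2 * (\<integral>x. \<integral>y. F (x, y) \<partial>M \<partial>M) = (\<integral>z. F z + F (case z of (x, y) \<Rightarrow> (y, x)) \<partial>(M \<Otimes>\<^sub>M M))"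
    if F: "integrable (M \<Otimes>\<^sub>M M) F" for F :: "'a \<times> 'a \<Rightarrow> real"
  proof -
    have s: "integrable (M \<Otimes>\<^sub>M M) (\<lambda>z. F (case z of (x, y) \<Rightarrow> (y, x)))"
      using P.integrable_product_swap[OF F] by (simp add: case_prod_unfold)
    have "(\<integral>z. F (case z of (x, y) \<Rightarrow> (y, x)) \<partial>(M \<Otimes>\<^sub>M M)) = (\<integral>z. F z \<partial>(M \<Otimes>\<^sub>M M))"
      using P.integral_product_swap[of F] F by (simp add: case_prod_unfold)
    then show ?thesis using F s P.integral_fst'[of F] by simp
  qed
  have sw: "integrable (M \<Otimes>\<^sub>M M) (\<lambda>z. F (case z of (x, y) \<Rightarrow> (y, x)))"
    if "integrable (M \<Otimes>\<^sub>M M) F" for F :: "'a \<times> 'a \<Rightarrow> real"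
    using P.integrable_product_swap[OF that] by (simp add: case_prod_unfold)
  have "2 * (\<integral>x. \<integral>y. G (x, y) \<partial>M \<partial>M) \<le> 2 * (\<integral>x. \<integral>y. H (x, y) \<partial>M \<partial>M)"
    unfolding *[OF G] *[OF H]
    by (intro integral_mono Bochner_Integration.integrable_add G H sw)
       (auto simp: space_pair_measure intro: le)
  then show ?thesis by simp
qed

section \<open>Trace moments of random Gram matrices\<close>

locale unimodular_system = prob_space M for M :: "'a measure" +
  fixes \<eta> :: "'k \<Rightarrow> 'a \<Rightarrow> complex"
  assumes \<eta>_measurable [measurable]: "\<eta> k \<in> borel_measurable M"
    and \<eta>_unimodular: "x \<in> space M \<Longrightarrow> cmod (\<eta> k x) = 1"
    and \<eta>_orthonormal: "(\<integral>x. cnj (\<eta> k x) * \<eta> l x \<partial>M) = of_bool (k = l)"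
begin

text \<open>The deviation from the identity of the rank-one Gram matrix \<open>u u\<^sup>*\<close> of a single node, where \<open>u\<close> has the
entries \<open>cnj (\<eta>\<^sub>k x)\<close> for \<open>k \<in> S\<close>. Orthonormality says that its mean is zero.\<close>
definition dev :: "'k set \<Rightarrow> 'a \<Rightarrow> 'k \<Rightarrow> 'k \<Rightarrow> complex" where
  "dev S x = (\<lambda>k l. of_bool (k \<in> S \<and> l \<in> S) * (cnj (\<eta> k x) * \<eta> l x) - kid S k l)"

lemma ksupp_dev: "ksupp S (dev S x)"
  by (auto simp: ksupp_def dev_def kid_def)

lemma kadj_dev: "kadj (dev S x) = dev S x"
  by (auto simp: kadj_def dev_def kid_def fun_eq_iff)

lemma bmeas_\<eta>: "bmeas M (\<eta> k)"
  unfolding bmeas_def by (auto simp: \<eta>_unimodular intro!: exI[of _ 1])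

lemma bmeas_dev: "bmeas M (\<lambda>x. dev S x k l)"
  unfolding dev_def by (intro bmeas_intros bmeas_\<eta>)

lemma integral_dev: "(\<integral>x. dev S x k l \<partial>M) = 0"
  unfolding dev_def
  by (simp add: integrable_bmeas bmeas_intros bmeas_\<eta> \<eta>_orthonormal) (auto simp: kid_def prob_space)

text \<open>Unimodularity gives \<open>(u u\<^sup>*)\<^sup>2 = b u u\<^sup>*\<close> with \<open>b = card S\<close>. Hence the square of the deviation is again
affine in the deviation, and this closes the recursion for the moments.\<close>
lemma dev_square:
  assumes "finite S" "x \<in> space M"
  shows "kmul S (dev S x) (dev S x) =
    (\<lambda>k l. of_real (real (card S) - 2) * dev S x k l + of_real (real (card S) - 1) * kid S k l)"
proof -
  define U where "U = (\<lambda>k l. of_bool (k \<in> S \<and> l \<in> S) * (cnj (\<eta> k x) * \<eta> l x))"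
  have U: "ksupp S U" by (auto simp: U_def ksupp_def)
  have 1: "\<eta> i x * cnj (\<eta> i x) = 1" for i
    using \<eta>_unimodular[OF assms(2), of i] by (simp add: complex_mult_cnj cmod_def flip: of_real_power)
  have "kmul S U U k l = of_nat (card S) * U k l" for k l
  proof -
    have "kmul S U U k l = (\<Sum>i\<in>S. U k l)"
      unfolding kmul_def
    proof (intro sum.cong refl)
      fix i assume "i \<in> S"
      have "U k i * U i l = of_bool (k \<in> S \<and> l \<in> S) * (cnj (\<eta> k x) * (\<eta> i x * cnj (\<eta> i x)) * \<eta> l x)"
        using \<open>i \<in> S\<close> unfolding U_def by (simp add: mult_ac)
      then show "U k i * U i l = U k l" by (simp add: 1 U_def)
    qed
    then show ?thesis by simp
  qed
  moreover have "kmul S (dev S x) (dev S x) k l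
      = kmul S U U k l - kmul S U (kid S) k l - kmul S (kid S) U k l + kmul S (kid S) (kid S) k l" for k l
    unfolding dev_def U_def[symmetric] kmul_def
    by (simp add: U_def algebra_simps sum.distrib sum_subtractf)
  moreover have "dev S x k l = U k l - kid S k l" for k l
    by (simp add: dev_def U_def)
  ultimately have "kmul S (dev S x) (dev S x) k l = of_nat (card S) * U k l - 2 * U k l + kid S k l"
    and "U k l = dev S x k l + kid S k l" for k l
    by (simp_all add: kmul_kid_left kmul_kid_right U ksupp_kid assms)
  then show ?thesis
    by (simp add: fun_eq_iff algebra_simps)
qed

text \<open>The exchange argument for one node, all others being fixed in \<open>A\<close>. As \<open>dev S y\<close> has mean zero, \<open>dev S x\<close>
may be replaced by \<open>D x y = dev S x - dev S y\<close> with an independent copy \<open>y\<close>. Symmetrizing in \<open>x\<close> and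
\<open>y\<close> turns the power into a difference of powers, to which the trace inequality applies because
\<open>\<phi> x - \<phi> y = c D x y\<close>. Integrating \<open>(D x y)\<^sup>2\<close> over \<open>y\<close> produces the affine expression on the right.\<close>
lemma integral_dev_kpow_le:
  fixes A :: "'k \<Rightarrow> 'k \<Rightarrow> complex"
  assumes fin: "finite S" and A: "ksupp S A" "kadj A = A" and c: "c > 0"
  defines "\<phi> \<equiv> \<lambda>x k l. A k l + of_real c * dev S x k l"
    and "b \<equiv> real (card S)"
  shows "(\<integral>x. Re (ktr S (kmul S (dev S x) (kpow S (\<phi> x) (2 * P + 1)))) \<partial>M)
    \<le> (\<integral>x. c * real (2 * P + 1) / 2 * Re (ktr S (kmul S
          (\<lambda>k l. of_real (b - 2) * dev S x k l + of_real (2 * (b - 1)) * kid S k l)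
          (kpow S (\<phi> x) (2 * P)))) \<partial>M)"
proof -
  interpret P: pair_prob_space M M ..
  define D where "D = (\<lambda>x y k l. dev S x k l - dev S y k l)"
  define G where "G = (\<lambda>(x, y). Re (ktr S (kmul S (D x y) (kpow S (\<phi> x) (2 * P + 1)))))"
  define H where "H = (\<lambda>(x, y). c * real (2 * P + 1) / 2 *
     Re (ktr S (kmul S (kmul S (D x y) (D x y)) (kpow S (\<phi> x) (2 * P)))))"
  have \<phi>: "ksupp S (\<phi> x)" "kadj (\<phi> x) = \<phi> x" for x
    using A ksupp_dev[of S x] kadj_dev[of S x]
    by (auto simp: \<phi>_def ksupp_def kadj_def fun_eq_iff)
  have bm1: "bmeas (M \<Otimes>\<^sub>M M) (\<lambda>z. dev S (fst z) k l)" for k l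
    by (rule bmeas_compose[OF bmeas_dev]) auto
  have bm2: "bmeas (M \<Otimes>\<^sub>M M) (\<lambda>z. dev S (snd z) k l)" for k l
    by (rule bmeas_compose[OF bmeas_dev]) auto
  have G: "integrable (M \<Otimes>\<^sub>M M) G"
    unfolding G_def case_prod_unfold D_def \<phi>_def
    by (intro integrable_Re P.integrable_bmeas bmeas_intros bm1 bm2)
  have H: "integrable (M \<Otimes>\<^sub>M M) H"
    unfolding H_def case_prod_unfold D_def \<phi>_def
    by (intro integrable_Re P.integrable_bmeas bmeas_intros bm1 bm2 integrable_mult_right)
  have le: "G (x, y) + G (y, x) \<le> H (x, y) + H (y, x)" for x y
  proof -
    have D: "(\<lambda>k l. \<phi> x k l - \<phi> y k l) = (\<lambda>k l. of_real c * D x y k l)" for x y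
      by (simp add: \<phi>_def D_def algebra_simps)
    have "kmul S (D y x) (D y x) = kmul S (D x y) (D x y)"
      by (simp add: D_def kmul_def algebra_simps)
    then have Hs: "H (x, y) + H (y, x) = c * real (2 * P + 1) / 2 *
        Re (ktr S (kmul S (kmul S (D x y) (D x y)) (\<lambda>k l. kpow S (\<phi> x) (2 * P) k l + kpow S (\<phi> y) (2 * P) k l)))"
      by (simp add: H_def ktr_kmul_add[OF fin] distrib_left)
    have Gs: "G (x, y) + G (y, x) =
        Re (ktr S (kmul S (D x y) (\<lambda>k l. kpow S (\<phi> x) (2 * P + 1) k l - kpow S (\<phi> y) (2 * P + 1) k l)))"
      unfolding G_def D_def ktr_def kmul_def
      by (simp add: algebra_simps sum.distrib sum_subtractf del: kpow.simps)
    have sc: "ktr S (kmul S (\<lambda>k l. of_real c * B k l) C) = of_real c * ktr S (kmul S B C)" for B C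
      by (simp add: ktr_def kmul_def sum_distrib_left mult_ac)
    have sc2: "kmul S (\<lambda>k l. of_real c * D x y k l) (\<lambda>k l. of_real c * D x y k l)
        = (\<lambda>k l. of_real c * (of_real c * kmul S (D x y) (D x y) k l))"
      by (simp add: kmul_def sum_distrib_left mult_ac)
    have "c * (G (x, y) + G (y, x)) \<le> c * (H (x, y) + H (y, x))"
      using ktr_diff_kpow_le[OF fin \<phi>[of x] \<phi>[of y], of P] unfolding D Gs Hs sc sc2
      by (simp add: mult_ac)
    then show ?thesis using c by simp
  qed
  have "(\<integral>x. Re (ktr S (kmul S (dev S x) (kpow S (\<phi> x) (2 * P + 1)))) \<partial>M) = (\<integral>x. \<integral>y. G (x, y) \<partial>M \<partial>M)"
  proof (intro Bochner_Integration.integral_cong refl)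
    fix x
    have "(\<integral>y. D x y k l \<partial>M) = dev S x k l" for k l
      unfolding D_def by (simp add: integrable_bmeas bmeas_dev integral_dev prob_space)
    then show "Re (ktr S (kmul S (dev S x) (kpow S (\<phi> x) (2 * P + 1)))) = (\<integral>y. G (x, y) \<partial>M)"
      unfolding G_def prod.case
      by (subst integral_ktr_kmul) (auto simp: D_def intro!: bmeas_intros bmeas_dev)
  qed
  also have "\<dots> \<le> (\<integral>x. \<integral>y. H (x, y) \<partial>M \<partial>M)"
    by (rule pair_integral_le_of_swap[OF G H le])
  also have "\<dots> = (\<integral>x. c * real (2 * P + 1) / 2 * Re (ktr S (kmul S
          (\<lambda>k l. of_real (b - 2) * dev S x k l + of_real (2 * (b - 1)) * kid S k l)
          (kpow S (\<phi> x) (2 * P)))) \<partial>M)"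
  proof (intro Bochner_Integration.integral_cong refl)
    fix x assume x: "x \<in> space M"
    have "(\<integral>y. kmul S (D x y) (D x y) k l \<partial>M)
        = of_real (b - 2) * dev S x k l + of_real (2 * (b - 1)) * kid S k l" for k l
    proof -
      have "(\<integral>y. kmul S (D x y) (D x y) k l \<partial>M) =
         (\<integral>y. kmul S (dev S x) (dev S x) k l - kmul S (dev S x) (dev S y) k l
            - kmul S (dev S y) (dev S x) k l + kmul S (dev S y) (dev S y) k l \<partial>M)"
        by (intro Bochner_Integration.integral_cong refl)
           (simp add: D_def kmul_def algebra_simps sum.distrib sum_subtractf)
      also have "\<dots> = kmul S (dev S x) (dev S x) k l - (\<integral>y. kmul S (dev S x) (dev S y) k l \<partial>M)
         - (\<integral>y. kmul S (dev S y) (dev S x) k l \<partial>M) + (\<integral>y. kmul S (dev S y) (dev S y) k l \<partial>M)"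
        by (simp add: integrable_bmeas bmeas_intros bmeas_dev prob_space)
      also have "(\<integral>y. kmul S (dev S x) (dev S y) k l \<partial>M) = 0"
        by (simp add: kmul_def integrable_bmeas bmeas_intros bmeas_dev integral_dev)
      also have "(\<integral>y. kmul S (dev S y) (dev S x) k l \<partial>M) = 0"
        by (simp add: kmul_def integrable_bmeas bmeas_intros bmeas_dev integral_dev)
      also have "(\<integral>y. kmul S (dev S y) (dev S y) k l \<partial>M)
          = (\<integral>y. of_real (b - 2) * dev S y k l + of_real (b - 1) * kid S k l \<partial>M)"
        by (intro Bochner_Integration.integral_cong refl) (simp add: dev_square[OF fin] b_def)
      also have "\<dots> = of_real (b - 1) * kid S k l"
        by (simp add: integrable_bmeas bmeas_intros bmeas_dev integral_dev prob_space)
      finally show ?thesis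
        by (simp add: dev_square[OF fin x] b_def[symmetric] algebra_simps)
    qed
    then show "(\<integral>y. H (x, y) \<partial>M) = c * real (2 * P + 1) / 2 * Re (ktr S (kmul S
          (\<lambda>k l. of_real (b - 2) * dev S x k l + of_real (2 * (b - 1)) * kid S k l)
          (kpow S (\<phi> x) (2 * P))))"
      unfolding H_def prod.case integral_mult_right_zero
      by (subst integral_ktr_kmul) (auto simp: D_def intro!: bmeas_intros bmeas_dev)
  qed
  finally show ?thesis .
qed

end

context prob_space begin

text \<open>Fubini's theorem: an inequality that holds after integrating out one coordinate, the others being
fixed, holds for the full integral.\<close>
lemma integral_PiM_le_of_coordinate:
  fixes F G :: "(nat \<Rightarrow> 'a) \<Rightarrow> complex"
  assumes j: "j < n"
    and F: "bmeas (PiM {..<n} (\<lambda>_. M)) F" and G: "bmeas (PiM {..<n} (\<lambda>_. M)) G"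
    and le: "\<And>X. X \<in> space (PiM ({..<n} - {j}) (\<lambda>_. M)) \<Longrightarrow>
      (\<integral>x. Re (F (X(j := x))) \<partial>M) \<le> (\<integral>x. Re (G (X(j := x))) \<partial>M)"
  shows "(\<integral>X. Re (F X) \<partial>PiM {..<n} (\<lambda>_. M)) \<le> (\<integral>X. Re (G X) \<partial>PiM {..<n} (\<lambda>_. M))"
proof -
  let ?I = "{..<n} - {j}"
  interpret P: product_prob_space "\<lambda>_. M" ..
  interpret N: prob_space "PiM {..<n} (\<lambda>_. M)" by (rule prob_space_PiM) unfold_locales
  interpret N': prob_space "PiM ?I (\<lambda>_. M)" by (rule prob_space_PiM) unfold_locales
  have ins: "insert j ?I = {..<n}" using j by auto
  have eq: "(\<integral>X. Re (F X) \<partial>PiM {..<n} (\<lambda>_. M)) = (\<integral>X. \<integral>x. Re (F (X(j := x))) \<partial>M \<partial>PiM ?I (\<lambda>_. M))"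
    if F: "bmeas (PiM {..<n} (\<lambda>_. M)) F" for F
  proof -
    have "integrable (PiM (insert j ?I) (\<lambda>_. M)) (\<lambda>X. Re (F X))"
      unfolding ins by (intro integrable_Re N.integrable_bmeas F)
    from P.product_integral_insert[OF _ _ this] show ?thesis unfolding ins by simp
  qed
  have int: "integrable (PiM ?I (\<lambda>_. M)) (\<lambda>X. \<integral>x. Re (F (X(j := x))) \<partial>M)"
    if F: "bmeas (PiM {..<n} (\<lambda>_. M)) F" for F
  proof -
    obtain B where [measurable]: "F \<in> borel_measurable (PiM {..<n} (\<lambda>_. M))"
      and B: "\<And>X. X \<in> space (PiM {..<n} (\<lambda>_. M)) \<Longrightarrow> cmod (F X) \<le> B"
      using F by (auto simp: bmeas_def)
    have [measurable]: "(\<lambda>z. (fst z)(j := snd z)) \<in> measurable (PiM ?I (\<lambda>_. M) \<Otimes>\<^sub>M M) (PiM {..<n} (\<lambda>_. M))"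
      using measurable_add_dim[of j ?I "\<lambda>_. M"] unfolding ins by (simp add: case_prod_unfold)
    have bd: "\<bar>Re (F (X(j := x)))\<bar> \<le> B" if "X \<in> space (PiM ?I (\<lambda>_. M))" "x \<in> space M" for X x
    proof -
      have "X(j := x) \<in> space (PiM {..<n} (\<lambda>_. M))"
        using that j by (auto simp: space_PiM PiE_iff extensional_def split: if_splits)
      from B[OF this] show ?thesis using abs_Re_le_cmod order_trans by blast
    qed
    have m: "(\<lambda>X. \<integral>x. Re (F (X(j := x))) \<partial>M) \<in> borel_measurable (PiM ?I (\<lambda>_. M))"
      by (rule borel_measurable_lebesgue_integral) (simp add: case_prod_unfold)
    have "\<bar>\<integral>x. Re (F (X(j := x))) \<partial>M\<bar> \<le> B" if X: "X \<in> space (PiM ?I (\<lambda>_. M))" for X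
    proof -
      have mx: "(\<lambda>x. X(j := x)) \<in> measurable M (PiM {..<n} (\<lambda>_. M))"
        using measurable_component_update[OF X, of j] ins by simp
      have "integrable M (\<lambda>x. Re (F (X(j := x))))"
        using bd[OF X] mx by (intro integrable_const_bound[where B=B]) (auto intro: measurable_compose[OF mx])
      then have "\<bar>\<integral>x. Re (F (X(j := x))) \<partial>M\<bar> \<le> (\<integral>x. B \<partial>M)"
        using bd[OF X] by (intro order_trans[OF integral_abs_bound] integral_mono) auto
      then show ?thesis by (simp add: prob_space)
    qed
    then show ?thesis
      by (intro N'.integrable_const_bound[where B=B] m) auto
  qed
  show ?thesis
    unfolding eq[OF F] eq[OF G] by (intro integral_mono int F G le)
qed

end

context unimodular_system begin

definition gram_dev :: "'k set \<Rightarrow> nat \<Rightarrow> (nat \<Rightarrow> 'a) \<Rightarrow> 'k \<Rightarrow> 'k \<Rightarrow> complex" where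
  "gram_dev S n X = (\<lambda>k l. (\<Sum>j<n. dev S (X j) k l) / of_nat n)"

lemma ksupp_gram_dev: "ksupp S (gram_dev S n X)"
  using ksupp_dev[of S] by (simp add: gram_dev_def ksupp_def)

lemma kadj_gram_dev: "kadj (gram_dev S n X) = gram_dev S n X"
proof (intro ext)
  fix k l
  have "cnj (dev S x l k) = dev S x k l" for x
    using kadj_dev[of S x] by (metis kadj_def)
  then show "kadj (gram_dev S n X) k l = gram_dev S n X k l"
    by (simp add: gram_dev_def kadj_def)
qed

lemma bmeas_dev_component: "j < n \<Longrightarrow> bmeas (PiM {..<n} (\<lambda>_. M)) (\<lambda>X. dev S (X j) k l)"
  by (rule bmeas_compose[OF bmeas_dev]) simp

lemma bmeas_gram_dev: "bmeas (PiM {..<n} (\<lambda>_. M)) (\<lambda>X. gram_dev S n X k l)"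
  unfolding gram_dev_def divide_inverse by (intro bmeas_intros bmeas_dev_component) simp

definition moment :: "'k set \<Rightarrow> nat \<Rightarrow> nat \<Rightarrow> real" where
  "moment S n N = (\<integral>X. Re (ktr S (kpow S (gram_dev S n X) N)) \<partial>PiM {..<n} (\<lambda>_. M))"

lemma prob_space_nodes: "prob_space (PiM {..<n} (\<lambda>_. M))"
  by (rule prob_space_PiM) unfold_locales

lemma integrable_trace_kpow:
  "integrable (PiM {..<n} (\<lambda>_. M)) (\<lambda>X. Re (ktr S (kpow S (gram_dev S n X) N)))"
  by (intro integrable_Re prob_space.integrable_bmeas prob_space_nodes bmeas_intros bmeas_gram_dev)

text \<open>Split off one factor \<open>Z = (1 / n) \<Sum>\<^sub>j dev S (X j)\<close> of \<open>Z\<^sup>2\<^sup>P\<^sup>+\<^sup>2\<close> and apply the exchange argument to every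
node \<open>j\<close> with \<open>c = 1 / n\<close>; the affine bounds add up to \<open>(b - 2) Z + 2 (b - 1)\<close>.\<close>
lemma moment_even_step:
  assumes fin: "finite S" and n: "n > 0"
  defines "b \<equiv> real (card S)"
  shows "moment S n (2 * P + 2) \<le> real (2 * P + 1) / (2 * real n) *
     ((b - 2) * moment S n (2 * P + 1) + 2 * (b - 1) * moment S n (2 * P))"
proof -
  let ?N = "PiM {..<n} (\<lambda>_. M)"
  interpret N: prob_space ?N by (rule prob_space_nodes)
  define c where "c = real (2 * P + 1) / (2 * real n)"
  define B where "B = (\<lambda>x k l. of_real (b - 2) * dev S x k l + of_real (2 * (b - 1)) * kid S k l)"
  define F where "F = (\<lambda>j X. ktr S (kmul S (dev S (X j)) (kpow S (gram_dev S n X) (2 * P + 1))))"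
  define G where "G = (\<lambda>j X. of_real c * ktr S (kmul S (B (X j)) (kpow S (gram_dev S n X) (2 * P))))"
  have F: "bmeas ?N (F j)" if "j < n" for j
    unfolding F_def using that by (intro bmeas_intros bmeas_gram_dev bmeas_dev_component)
  have G: "bmeas ?N (G j)" if "j < n" for j
    unfolding G_def B_def using that by (intro bmeas_intros bmeas_gram_dev bmeas_dev_component)
  have step: "(\<integral>X. Re (F j X) \<partial>?N) \<le> (\<integral>X. Re (G j X) \<partial>?N)" if j: "j < n" for j
  proof (rule integral_PiM_le_of_coordinate[OF j F[OF j] G[OF j]])
    fix X :: "nat \<Rightarrow> 'a"
    define A where "A = (\<lambda>k l. (\<Sum>i\<in>{..<n} - {j}. dev S (X i) k l) / of_nat n)"
    have A: "ksupp S A" "kadj A = A"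
    proof -
      show "ksupp S A" using ksupp_dev[of S] by (simp add: A_def ksupp_def)
      have "cnj (dev S x l k) = dev S x k l" for x k l
        using kadj_dev[of S x] by (metis kadj_def)
      then show "kadj A = A" by (simp add: A_def kadj_def fun_eq_iff)
    qed
    \<comment> \<open>\<open>A\<close> collects the nodes other than \<open>j\<close>\<close>
    have gd: "gram_dev S n (X(j := x)) = (\<lambda>k l. A k l + of_real (1 / real n) * dev S x k l)" for x
    proof (intro ext)
      fix k l
      have "(\<Sum>i<n. dev S ((X(j := x)) i) k l) = dev S x k l + (\<Sum>i\<in>{..<n} - {j}. dev S (X i) k l)"
        using j by (simp add: sum.remove[of "{..<n}" j])
      then show "gram_dev S n (X(j := x)) k l = A k l + of_real (1 / real n) * dev S x k l"
        by (simp add: gram_dev_def A_def add_divide_distrib)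
    qed
    show "(\<integral>x. Re (F j (X(j := x))) \<partial>M) \<le> (\<integral>x. Re (G j (X(j := x))) \<partial>M)"
      using integral_dev_kpow_le[OF fin A, of "1 / real n" P] n
      unfolding F_def G_def gd B_def c_def b_def
      by (simp del: kpow.simps)
  qed
  have "moment S n (2 * P + 2) = (\<integral>X. (\<Sum>j<n. Re (F j X)) / real n \<partial>?N)"
    unfolding moment_def
  proof (intro Bochner_Integration.integral_cong refl)
    fix X
    have "ktr S (kpow S (gram_dev S n X) (2 * P + 2)) = ktr S (kmul S (gram_dev S n X) (kpow S (gram_dev S n X) (2 * P + 1)))"
      by simp
    also have "\<dots> = (\<Sum>j<n. F j X) / of_nat n"
      unfolding F_def
      by (subst (1 2) ktr_comm[OF fin], subst ktr_kmul_sum[OF fin, symmetric])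
         (simp add: gram_dev_def ktr_def kmul_def sum_divide_distrib sum_distrib_left del: kpow.simps)
    finally show "Re (ktr S (kpow S (gram_dev S n X) (2 * P + 2))) = (\<Sum>j<n. Re (F j X)) / real n"
      by simp
  qed
  also have "\<dots> = (\<Sum>j<n. \<integral>X. Re (F j X) \<partial>?N) / real n"
    using F by (simp add: N.integrable_bmeas)
  also have "\<dots> \<le> (\<Sum>j<n. \<integral>X. Re (G j X) \<partial>?N) / real n"
    by (intro divide_right_mono sum_mono step) auto
  also have "\<dots> = (\<integral>X. (\<Sum>j<n. Re (G j X)) / real n \<partial>?N)"
    using G by (simp add: N.integrable_bmeas)
  also have "\<dots> = (\<integral>X. c * ((b - 2) * Re (ktr S (kpow S (gram_dev S n X) (2 * P + 1)))
       + 2 * (b - 1) * Re (ktr S (kpow S (gram_dev S n X) (2 * P)))) \<partial>?N)"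
  proof (intro Bochner_Integration.integral_cong refl)
    fix X
    let ?Z = "gram_dev S n X"
    have "(\<Sum>j<n. G j X) / of_nat n = of_real c * (\<Sum>j<n. ktr S (kmul S (kpow S ?Z (2 * P)) (B (X j)))) / of_nat n"
      unfolding G_def by (subst ktr_comm[OF fin]) (simp add: sum_distrib_left)
    also have "(\<Sum>j<n. ktr S (kmul S (kpow S ?Z (2 * P)) (B (X j))))
       = ktr S (kmul S (kpow S ?Z (2 * P)) (\<lambda>k l. of_nat n * (of_real (b - 2) * ?Z k l) + of_nat n * (of_real (2 * (b - 1)) * kid S k l)))"
    proof -
      have "(\<lambda>k l. \<Sum>j<n. B (X j) k l) =
          (\<lambda>k l. of_nat n * (of_real (b - 2) * ?Z k l) + of_nat n * (of_real (2 * (b - 1)) * kid S k l))"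
        using n by (simp add: fun_eq_iff B_def gram_dev_def sum.distrib flip: sum_distrib_left)
      then show ?thesis unfolding ktr_kmul_sum[OF fin, symmetric] by simp
    qed
    also have "\<dots> = of_nat n * of_real (b - 2) * ktr S (kmul S (kpow S ?Z (2 * P)) ?Z)
         + of_nat n * of_real (2 * (b - 1)) * ktr S (kmul S (kpow S ?Z (2 * P)) (kid S))"
      unfolding ktr_kmul_add[OF fin]
      by (simp add: ktr_def kmul_def sum_distrib_left mult_ac)
    also have "kmul S (kpow S ?Z (2 * P)) (kid S) = kpow S ?Z (2 * P)"
      by (intro kmul_kid_right fin ksupp_kpow ksupp_gram_dev)
    also have "ktr S (kmul S (kpow S ?Z (2 * P)) ?Z) = ktr S (kpow S ?Z (2 * P + 1))"
      by (subst ktr_comm[OF fin]) simp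
    finally have "(\<Sum>j<n. G j X) / of_nat n = of_real c * (of_real (b - 2) * ktr S (kpow S ?Z (2 * P + 1))
       + of_real (2 * (b - 1)) * ktr S (kpow S ?Z (2 * P)))"
      using n by (simp add: field_simps del: kpow.simps)
    then have "Re ((\<Sum>j<n. G j X) / of_nat n) = Re (of_real c * (of_real (b - 2) * ktr S (kpow S ?Z (2 * P + 1))
       + of_real (2 * (b - 1)) * ktr S (kpow S ?Z (2 * P))))"
      by simp
    then show "(\<Sum>j<n. Re (G j X)) / real n = c * ((b - 2) * Re (ktr S (kpow S ?Z (2 * P + 1)))
       + 2 * (b - 1) * Re (ktr S (kpow S ?Z (2 * P))))"
      by (simp add: Re_divide_of_nat del: kpow.simps)
  qed
  also have "\<dots> = c * ((b - 2) * moment S n (2 * P + 1) + 2 * (b - 1) * moment S n (2 * P))"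
    unfolding moment_def
    by (simp add: integrable_trace_kpow del: kpow.simps)
  finally show ?thesis unfolding c_def .
qed

lemma Re_ktr_kpow_even:
  assumes "finite S"
  shows "Re (ktr S (kpow S (gram_dev S n X) (2 * p))) =
    (\<Sum>k\<in>S. \<Sum>l\<in>S. (cmod (kpow S (gram_dev S n X) p k l))\<^sup>2)"
proof -
  let ?Z = "gram_dev S n X"
  have "kpow S ?Z (2 * p) = kmul S (kpow S ?Z p) (kadj (kpow S ?Z p))"
    by (simp add: mult_2 kpow_add[OF assms] kadj_kpow[OF assms] ksupp_gram_dev kadj_gram_dev)
  then show ?thesis by (simp only: Re_ktr_kadj_self[OF assms])
qed

lemma moment_even_nonneg: "finite S \<Longrightarrow> 0 \<le> moment S n (2 * p)"
  unfolding moment_def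
  by (intro Bochner_Integration.integral_nonneg_AE) (simp add: Re_ktr_kpow_even sum_nonneg)

text \<open>The Hilbert-Schmidt inequality for \<open>Z\<^sup>p\<close> and \<open>Z\<^sup>p\<^sup>+\<^sup>1\<close>.\<close>
lemma moment_odd_le:
  assumes fin: "finite S"
  shows "2 * \<bar>moment S n (2 * p + 1)\<bar> \<le> moment S n (2 * p + 2) + moment S n (2 * p)"
proof -
  let ?N = "PiM {..<n} (\<lambda>_. M)"
  have e: "p + Suc p = 2 * p + 1" "Suc p + Suc p = 2 * p + 2" "p + p = 2 * p" by simp_all
  have pt: "2 * \<bar>Re (ktr S (kpow S (gram_dev S n X) (2 * p + 1)))\<bar>
     \<le> Re (ktr S (kpow S (gram_dev S n X) (2 * p + 2))) + Re (ktr S (kpow S (gram_dev S n X) (2 * p)))" for X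
  proof -
    let ?Z = "gram_dev S n X"
    have "kmul S (kpow S ?Z i) (kadj (kpow S ?Z j)) = kpow S ?Z (i + j)" for i j
      by (simp add: kpow_add[OF fin] kadj_kpow[OF fin] ksupp_gram_dev kadj_gram_dev)
    then show ?thesis
      using Re_ktr_kadj_le[OF fin, of "kpow S ?Z p" "kpow S ?Z (Suc p)"]
      by (simp only: e add.commute)
  qed
  have "2 * \<bar>moment S n (2 * p + 1)\<bar> \<le> 2 * (\<integral>X. \<bar>Re (ktr S (kpow S (gram_dev S n X) (2 * p + 1)))\<bar> \<partial>?N)"
    unfolding moment_def using integral_abs_bound by (intro mult_left_mono) auto
  also have "\<dots> = (\<integral>X. 2 * \<bar>Re (ktr S (kpow S (gram_dev S n X) (2 * p + 1)))\<bar> \<partial>?N)"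
    by simp
  also have "\<dots> \<le> (\<integral>X. Re (ktr S (kpow S (gram_dev S n X) (2 * p + 2))) + Re (ktr S (kpow S (gram_dev S n X) (2 * p))) \<partial>?N)"
    by (intro integral_mono integrable_mult_right integrable_abs Bochner_Integration.integrable_add
        integrable_trace_kpow pt)
  also have "\<dots> = moment S n (2 * p + 2) + moment S n (2 * p)"
    unfolding moment_def by (simp only: Bochner_Integration.integral_add[OF integrable_trace_kpow integrable_trace_kpow])
  finally show ?thesis .
qed

text \<open>Eliminating the odd moment from the recursion leaves
\<open>moment (2 p + 2) \<le> \<beta> (moment (2 p + 2) / 4 + 5 / 4 * moment (2 p))\<close>; the condition on \<open>r\<close> makes each
step cost at most a factor \<open>r\<close>, and the zeroth moment is \<open>card S\<close>.\<close>
lemma moment_even_le: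
  assumes fin: "finite S" and ne: "S \<noteq> {}" and n: "n > 0"
    and \<beta>: "real (2 * p - 1) * real (card S) / real n \<le> \<beta>" "\<beta> < 4" "0 \<le> \<beta>" "0 \<le> r"
    and r: "5 / 4 * \<beta> \<le> r * (1 - \<beta> / 4)"
  shows "moment S n (2 * p) \<le> real (card S) * r ^ p"
  using \<beta>(1)
proof (induction p)
  case 0
  interpret N: prob_space "PiM {..<n} (\<lambda>_. M)" by (rule prob_space_nodes)
  show ?case using fin by (simp add: moment_def ktr_def kid_def N.prob_space)
next
  case (Suc p)
  define b where "b = real (card S)"
  have b: "b \<ge> 1" unfolding b_def using fin ne by (simp add: Suc_leI card_gt_0_iff)
  define \<gamma> where "\<gamma> = real (2 * p + 1) * b / real n"
  have \<gamma>: "0 \<le> \<gamma>" "\<gamma> \<le> \<beta>" using Suc.prems b by (auto simp: \<gamma>_def b_def)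
  have m0: "moment S n (2 * p) \<ge> 0" "moment S n (2 * p + 2) \<ge> 0"
    using moment_even_nonneg[OF fin, of n p] moment_even_nonneg[OF fin, of n "Suc p"] by simp_all
  have "(b - 2) * moment S n (2 * p + 1) \<le> \<bar>b - 2\<bar> * \<bar>moment S n (2 * p + 1)\<bar>"
    unfolding abs_mult[symmetric] by simp
  also have "\<dots> \<le> b * ((moment S n (2 * p + 2) + moment S n (2 * p)) / 2)"
    using moment_odd_le[OF fin, of n p] b by (intro mult_mono) auto
  finally have "(b - 2) * moment S n (2 * p + 1) + 2 * (b - 1) * moment S n (2 * p)
     \<le> b * ((moment S n (2 * p + 2) + moment S n (2 * p)) / 2) + 2 * b * moment S n (2 * p)"
    using m0 b by (intro add_mono mult_right_mono) auto
  then have "moment S n (2 * p + 2) \<le> real (2 * p + 1) / (2 * real n) *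
     (b * ((moment S n (2 * p + 2) + moment S n (2 * p)) / 2) + 2 * b * moment S n (2 * p))"
    by (intro order_trans[OF moment_even_step[OF fin n, of p, folded b_def]] mult_left_mono) auto
  also have "\<dots> = \<gamma> * (moment S n (2 * p + 2) / 4 + 5 / 4 * moment S n (2 * p))"
    using n by (simp add: \<gamma>_def field_simps)
  also have "\<dots> \<le> \<beta> * (moment S n (2 * p + 2) / 4 + 5 / 4 * moment S n (2 * p))"
    using \<gamma> m0 by (intro mult_right_mono) auto
  finally have "(1 - \<beta> / 4) * moment S n (2 * p + 2) \<le> (5 / 4 * \<beta>) * moment S n (2 * p)"
    by (simp add: algebra_simps)
  also have "\<dots> \<le> (r * (1 - \<beta> / 4)) * moment S n (2 * p)"
    using r m0 by (intro mult_right_mono) auto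
  finally have "moment S n (2 * p + 2) \<le> r * moment S n (2 * p)"
    using \<beta>(2) by (simp add: mult.assoc[of r] mult.left_commute[of r])
  also have "\<dots> \<le> r * (b * r ^ p)"
  proof (intro mult_left_mono \<beta>(4))
    have "real (2 * p - 1) * real (card S) / real n \<le> real (2 * Suc p - 1) * real (card S) / real n"
      by (intro divide_right_mono mult_right_mono) auto
    then have "real (2 * p - 1) * real (card S) / real n \<le> \<beta>"
      using Suc.prems by (rule order_trans)
    then show "moment S n (2 * p) \<le> b * r ^ p" unfolding b_def by (rule Suc.IH)
  qed
  finally show ?case by (simp add: b_def mult_ac)
qed

end

section \<open>From trace moments to norm bounds\<close>

lemma of_real_cmod_square: "(complex_of_real (cmod z))\<^sup>2 = z * cnj z"
  by (metis complex_norm_square of_real_power)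

lemma Cauchy_Schwarz_sum_complex:
  "(cmod (\<Sum>i\<in>I. a i * b i))\<^sup>2 \<le> (\<Sum>i\<in>I. (cmod (a i))\<^sup>2) * (\<Sum>i\<in>I. (cmod (b i))\<^sup>2)"
proof -
  have "cmod (\<Sum>i\<in>I. a i * b i) \<le> (\<Sum>i\<in>I. cmod (a i) * cmod (b i))"
    by (intro order_trans[OF norm_sum]) (simp add: norm_mult)
  then have "(cmod (\<Sum>i\<in>I. a i * b i))\<^sup>2 \<le> (\<Sum>i\<in>I. cmod (a i) * cmod (b i))\<^sup>2"
    by (intro power_mono) auto
  also have "\<dots> \<le> (\<Sum>i\<in>I. (cmod (a i))\<^sup>2) * (\<Sum>i\<in>I. (cmod (b i))\<^sup>2)"
    by (rule Cauchy_Schwarz_ineq_sum)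
  finally show ?thesis .
qed

text \<open>A log-convex sequence grows at least like its first quotient: \<open>N\<^sub>1 N\<^sub>i \<le> N\<^sub>i\<^sub>+\<^sub>1 N\<^sub>0\<close>.\<close>
lemma log_convex_power_le:
  fixes N :: "nat \<Rightarrow> real"
  assumes nn: "\<And>i. 0 \<le> N i" and lc: "\<And>i. (N (i + 1))\<^sup>2 \<le> N i * N (i + 2)"
  shows "N 1 ^ Suc p \<le> N (Suc p) * N 0 ^ p"
proof -
  have growth: "N 1 * N i \<le> N (Suc i) * N 0" for i
  proof (induction i)
    case (Suc i)
    show ?case
    proof (cases "N i = 0")
      case True
      then have "N (Suc i) = 0" using lc[of i] by simp
      then show ?thesis using nn by simp
    next
      case False
      then have pos: "N i > 0" using nn[of i] by simp
      have "N i * (N 1 * N (Suc i)) = N (Suc i) * (N 1 * N i)" by simp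
      also have "\<dots> \<le> N (Suc i) * (N (Suc i) * N 0)"
        by (intro mult_left_mono Suc nn)
      also have "\<dots> = (N (i + 1))\<^sup>2 * N 0" by (simp add: power2_eq_square)
      also have "\<dots> \<le> (N i * N (i + 2)) * N 0" by (intro mult_right_mono lc nn)
      finally show ?thesis using pos by (simp add: mult.assoc)
    qed
  qed simp
  show ?thesis
  proof (induction p)
    case (Suc p)
    have "N 1 ^ Suc (Suc p) \<le> N 1 * (N (Suc p) * N 0 ^ p)"
      using Suc nn by (simp add: mult_left_mono)
    also have "\<dots> \<le> (N (Suc (Suc p)) * N 0) * N 0 ^ p"
      using growth[of "Suc p"] nn by (simp add: mult.assoc[symmetric] mult_right_mono)
    finally show ?case by (simp add: mult_ac)
  qed simp
qed

text \<open>The numbers \<open>\<parallel>Z\<^sup>i c\<parallel>\<^sup>2\<close> are log-convex in \<open>i\<close>, as \<open>Z\<close> is Hermitian. So \<open>\<parallel>Z c\<parallel>\<^sup>2\<close> is controlled by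
\<open>\<parallel>Z\<^sup>p c\<parallel>\<^sup>2\<close>, hence by the Hilbert-Schmidt norm of \<open>Z\<^sup>p\<close>, whose square is the trace of \<open>Z\<^sup>2\<^sup>p\<close>.\<close>
lemma quadratic_form_le_of_trace:
  assumes fin: "finite S" and Z: "ksupp S Z" "kadj Z = Z" and p: "p > 0" and \<tau>: "\<tau> \<ge> 0"
    and tr: "Re (ktr S (kpow S Z (2 * p))) \<le> \<tau> ^ (2 * p)"
  shows "cmod (\<Sum>k\<in>S. cnj (c k) * (\<Sum>l\<in>S. Z k l * c l)) \<le> \<tau> * (\<Sum>k\<in>S. (cmod (c k))\<^sup>2)"
proof -
  define v where "v = (\<lambda>i k. \<Sum>l\<in>S. kpow S Z i k l * c l)"
  define N where "N = (\<lambda>i. \<Sum>k\<in>S. (cmod (v i k))\<^sup>2)"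
  have N_nn: "0 \<le> N i" for i by (simp add: N_def sum_nonneg)
  have v0: "v 0 k = c k" if "k \<in> S" for k
  proof -
    have "v 0 k = (\<Sum>l\<in>S. if k = l then c l else 0)"
      unfolding v_def kpow.simps kid_def by (intro sum.cong) (use that in auto)
    then show ?thesis using fin that by simp
  qed
  have vSuc: "v (Suc i) k = (\<Sum>l\<in>S. Z k l * v i l)" for i k
    unfolding v_def kpow.simps kmul_def sum_distrib_left sum_distrib_right
    by (subst sum.swap) (simp add: mult_ac)
  have herm: "cnj (Z k l) = Z l k" for k l
    using Z(2) by (metis kadj_def)
  have shift: "(\<Sum>k\<in>S. cnj (v (Suc i) k) * v j k) = (\<Sum>k\<in>S. cnj (v i k) * v (Suc j) k)" for i j
    unfolding vSuc by (simp add: sum_distrib_left sum_distrib_right herm)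
      (subst sum.swap, simp add: mult_ac)
  have N_eq: "complex_of_real (N i) = (\<Sum>k\<in>S. cnj (v i k) * v i k)" for i
    by (simp add: N_def of_real_cmod_square mult.commute)
  have cs: "(cmod (\<Sum>k\<in>S. cnj (v i k) * v j k))\<^sup>2 \<le> N i * N j" for i j
    using Cauchy_Schwarz_sum_complex[of "\<lambda>k. cnj (v i k)" "v j" S] by (simp add: N_def)
  have "(N (i + 1))\<^sup>2 \<le> N i * N (i + 2)" for i
  proof -
    have "complex_of_real (N (i + 1)) = (\<Sum>k\<in>S. cnj (v i k) * v (i + 2) k)"
      using N_eq[of "i + 1"] shift[of i "i + 1"] by simp
    then have "N (i + 1) = cmod (\<Sum>k\<in>S. cnj (v i k) * v (i + 2) k)"
      using N_nn[of "i + 1"] by (metis abs_of_nonneg norm_of_real)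
    then show ?thesis using cs[of i "i + 2"] by simp
  qed
  then have lc: "N 1 ^ Suc (p - 1) \<le> N (Suc (p - 1)) * N 0 ^ (p - 1)"
    by (intro log_convex_power_le N_nn)
  have "N p \<le> (\<Sum>k\<in>S. \<Sum>l\<in>S. (cmod (kpow S Z p k l))\<^sup>2) * (\<Sum>l\<in>S. (cmod (c l))\<^sup>2)"
    unfolding N_def v_def sum_distrib_right[of _ S]
    by (intro sum_mono order_trans[OF Cauchy_Schwarz_sum_complex]) (simp add: sum_distrib_right)
  also have "(\<Sum>k\<in>S. \<Sum>l\<in>S. (cmod (kpow S Z p k l))\<^sup>2) = Re (ktr S (kpow S Z (2 * p)))"
    using Re_ktr_kadj_self[OF fin, of "kpow S Z p"]
    by (simp add: mult_2 kpow_add[OF fin] kadj_kpow[OF fin] Z)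
  also have "\<dots> * (\<Sum>l\<in>S. (cmod (c l))\<^sup>2) \<le> \<tau> ^ (2 * p) * N 0"
    using tr by (simp add: N_def v0 mult_right_mono sum_nonneg)
  finally have Np: "N p \<le> \<tau> ^ (2 * p) * N 0" .
  have "N 1 ^ p \<le> N p * N 0 ^ (p - 1)" using lc p by simp
  also have "\<dots> \<le> \<tau> ^ (2 * p) * N 0 * N 0 ^ (p - 1)"
    by (intro mult_right_mono Np) (simp add: N_nn)
  also have "\<dots> = (\<tau>\<^sup>2 * N 0) ^ p"
    using p by (cases p) (simp_all add: power_mult_distrib power_mult power2_eq_square)
  finally have N1: "N 1 \<le> \<tau>\<^sup>2 * N 0"
    using p N_nn[of 0] by (simp add: power_mono_iff N_nn)
  have "(\<Sum>k\<in>S. cnj (c k) * (\<Sum>l\<in>S. Z k l * c l)) = (\<Sum>k\<in>S. cnj (v 0 k) * v 1 k)"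
    using vSuc[of 0] by (intro sum.cong refl) (simp add: v0)
  then have "(cmod (\<Sum>k\<in>S. cnj (c k) * (\<Sum>l\<in>S. Z k l * c l)))\<^sup>2 \<le> N 0 * N 1"
    using cs[of 0 1] by simp
  also have "\<dots> \<le> N 0 * (\<tau>\<^sup>2 * N 0)" by (intro mult_left_mono N1 N_nn)
  also have "\<dots> = (\<tau> * N 0)\<^sup>2" by (simp add: power2_eq_square)
  finally have "cmod (\<Sum>k\<in>S. cnj (c k) * (\<Sum>l\<in>S. Z k l * c l)) \<le> \<tau> * N 0"
    using \<tau> N_nn[of 0] by (simp add: power2_le_iff_abs_le)
  also have "N 0 = (\<Sum>k\<in>S. (cmod (c k))\<^sup>2)" by (simp add: N_def v0)
  finally show ?thesis .
qed

context unimodular_system begin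

lemma synthesis_norm_eq:
  assumes fin: "finite S" and n: "n > 0"
  shows "complex_of_real (\<Sum>j<n. (cmod (\<Sum>k\<in>S. \<eta> k (X j) * c k))\<^sup>2)
    = of_nat n * (of_real (\<Sum>k\<in>S. (cmod (c k))\<^sup>2) + (\<Sum>k\<in>S. cnj (c k) * (\<Sum>l\<in>S. gram_dev S n X k l * c l)))"
proof -
  have "complex_of_real (\<Sum>j<n. (cmod (\<Sum>k\<in>S. \<eta> k (X j) * c k))\<^sup>2)
     = (\<Sum>j<n. \<Sum>k\<in>S. \<Sum>l\<in>S. cnj (c k) * (cnj (\<eta> k (X j)) * \<eta> l (X j)) * c l)"
    by (simp add: of_real_cmod_square sum_product) (subst sum.swap, simp add: mult_ac)
  also have "\<dots> = (\<Sum>k\<in>S. \<Sum>l\<in>S. \<Sum>j<n. cnj (c k) * (cnj (\<eta> k (X j)) * \<eta> l (X j)) * c l)"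
    by (subst sum.swap) (intro sum.cong refl sum.swap)
  also have "\<dots> = (\<Sum>k\<in>S. \<Sum>l\<in>S. of_nat n * (cnj (c k) * (gram_dev S n X k l * c l))
       + of_nat n * (if k = l then cnj (c k) * c l else 0))"
  proof (intro sum.cong refl)
    fix k l assume kl: "k \<in> S" "l \<in> S"
    have "(\<Sum>j<n. cnj (\<eta> k (X j)) * \<eta> l (X j)) = of_nat n * (gram_dev S n X k l + kid S k l)"
      using kl n by (simp add: gram_dev_def dev_def sum_subtractf field_simps)
    then have "(\<Sum>j<n. cnj (c k) * (cnj (\<eta> k (X j)) * \<eta> l (X j)) * c l)
       = cnj (c k) * (of_nat n * (gram_dev S n X k l + kid S k l)) * c l"
      by (simp only: sum_distrib_left[symmetric] sum_distrib_right[symmetric])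
    then show "(\<Sum>j<n. cnj (c k) * (cnj (\<eta> k (X j)) * \<eta> l (X j)) * c l) =
       of_nat n * (cnj (c k) * (gram_dev S n X k l * c l)) + of_nat n * (if k = l then cnj (c k) * c l else 0)"
      using kl by (simp add: kid_def algebra_simps)
  qed
  also have "\<dots> = of_nat n * (\<Sum>k\<in>S. cnj (c k) * (\<Sum>l\<in>S. gram_dev S n X k l * c l))
     + of_nat n * (\<Sum>k\<in>S. cnj (c k) * c k)"
    using fin by (simp add: sum.distrib flip: sum_distrib_left)
  finally show ?thesis by (simp add: of_real_cmod_square algebra_simps)
qed

text \<open>The squared norm of \<open>L c\<close> equals \<open>n (\<parallel>c\<parallel>\<^sup>2 + \<langle>c, Z c\<rangle>)\<close>.\<close>
lemma synthesis_norm_bounds: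
  assumes fin: "finite S" and n: "n > 0" and p: "p > 0" and \<tau>: "\<tau> \<ge> 0"
    and tr: "Re (ktr S (kpow S (gram_dev S n X) (2 * p))) \<le> \<tau> ^ (2 * p)"
  shows "real n * (1 - \<tau>) * (\<Sum>k\<in>S. (cmod (c k))\<^sup>2) \<le> (\<Sum>j<n. (cmod (\<Sum>k\<in>S. \<eta> k (X j) * c k))\<^sup>2)"
    and "(\<Sum>j<n. (cmod (\<Sum>k\<in>S. \<eta> k (X j) * c k))\<^sup>2) \<le> real n * (1 + \<tau>) * (\<Sum>k\<in>S. (cmod (c k))\<^sup>2)"
proof -
  define Q where "Q = (\<Sum>k\<in>S. cnj (c k) * (\<Sum>l\<in>S. gram_dev S n X k l * c l))"
  have "cmod Q \<le> \<tau> * (\<Sum>k\<in>S. (cmod (c k))\<^sup>2)"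
    unfolding Q_def by (rule quadratic_form_le_of_trace[OF fin ksupp_gram_dev kadj_gram_dev p \<tau> tr])
  then have Q: "\<bar>Re Q\<bar> \<le> \<tau> * (\<Sum>k\<in>S. (cmod (c k))\<^sup>2)"
    using abs_Re_le_cmod[of Q] by linarith
  have "(\<Sum>j<n. (cmod (\<Sum>k\<in>S. \<eta> k (X j) * c k))\<^sup>2) = real n * ((\<Sum>k\<in>S. (cmod (c k))\<^sup>2) + Re Q)"
    using arg_cong[OF synthesis_norm_eq[OF fin n, of X c], of Re] by (simp add: Q_def)
  then have eq: "(\<Sum>j<n. (cmod (\<Sum>k\<in>S. \<eta> k (X j) * c k))\<^sup>2) = real n * (\<Sum>k\<in>S. (cmod (c k))\<^sup>2) + real n * Re Q"
    by (simp add: distrib_left)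
  have "real n * \<bar>Re Q\<bar> \<le> real n * (\<tau> * (\<Sum>k\<in>S. (cmod (c k))\<^sup>2))"
    using Q by (intro mult_left_mono) auto
  then have "\<bar>real n * Re Q\<bar> \<le> real n * (\<tau> * (\<Sum>k\<in>S. (cmod (c k))\<^sup>2))"
    by (simp add: abs_mult)
  then show "real n * (1 - \<tau>) * (\<Sum>k\<in>S. (cmod (c k))\<^sup>2) \<le> (\<Sum>j<n. (cmod (\<Sum>k\<in>S. \<eta> k (X j) * c k))\<^sup>2)"
    and "(\<Sum>j<n. (cmod (\<Sum>k\<in>S. \<eta> k (X j) * c k))\<^sup>2) \<le> real n * (1 + \<tau>) * (\<Sum>k\<in>S. (cmod (c k))\<^sup>2)"
    unfolding eq by (simp_all add: algebra_simps)
qed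

text \<open>By duality: the adjoint of the synthesis map has the same norm.\<close>
lemma analysis_norm_le:
  assumes fin: "finite S" and n: "n > 0" and p: "p > 0" and \<tau>: "\<tau> \<ge> 0"
    and tr: "Re (ktr S (kpow S (gram_dev S n X) (2 * p))) \<le> \<tau> ^ (2 * p)"
  shows "(\<Sum>k\<in>S. (cmod (\<Sum>j<n. q j * \<eta> k (X j)))\<^sup>2) \<le> real n * (1 + \<tau>) * (\<Sum>j<n. (cmod (q j))\<^sup>2)"
proof -
  define c where "c = (\<lambda>k. cnj (\<Sum>j<n. q j * \<eta> k (X j)))"
  define N where "N = (\<Sum>k\<in>S. (cmod (c k))\<^sup>2)"
  have N0: "N \<ge> 0" by (simp add: N_def sum_nonneg)
  have "complex_of_real N = (\<Sum>k\<in>S. c k * (\<Sum>j<n. q j * \<eta> k (X j)))"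
    by (simp add: N_def of_real_cmod_square c_def)
  also have "\<dots> = (\<Sum>j<n. q j * (\<Sum>k\<in>S. \<eta> k (X j) * c k))"
    by (simp add: sum_distrib_left) (subst sum.swap, simp add: mult_ac)
  finally have "N = cmod (\<Sum>j<n. q j * (\<Sum>k\<in>S. \<eta> k (X j) * c k))"
    using N0 by (metis abs_of_nonneg norm_of_real)
  then have "N\<^sup>2 \<le> (\<Sum>j<n. (cmod (q j))\<^sup>2) * (\<Sum>j<n. (cmod (\<Sum>k\<in>S. \<eta> k (X j) * c k))\<^sup>2)"
    using Cauchy_Schwarz_sum_complex[of q "\<lambda>j. \<Sum>k\<in>S. \<eta> k (X j) * c k" "{..<n}"] by simp
  also have "\<dots> \<le> (\<Sum>j<n. (cmod (q j))\<^sup>2) * (real n * (1 + \<tau>) * N)"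
    unfolding N_def by (intro mult_left_mono synthesis_norm_bounds(2)[OF assms] sum_nonneg) auto
  finally have "N * N \<le> (real n * (1 + \<tau>) * (\<Sum>j<n. (cmod (q j))\<^sup>2)) * N"
    by (simp add: power2_eq_square mult_ac)
  moreover have "0 \<le> real n * (1 + \<tau>) * (\<Sum>j<n. (cmod (q j))\<^sup>2)"
    using \<tau> by (intro mult_nonneg_nonneg sum_nonneg) auto
  ultimately have "N \<le> real n * (1 + \<tau>) * (\<Sum>j<n. (cmod (q j))\<^sup>2)"
    using N0 by (cases "N = 0") (auto simp: mult_le_cancel_right)
  then show ?thesis by (simp only: N_def c_def complex_mod_cnj)
qed

end

section \<open>Probability estimates for Gram matrices\<close>

lemma power_le_exp_minus: "c \<le> 1 / 3 \<Longrightarrow> 0 \<le> c \<Longrightarrow> (c::real) ^ p \<le> exp (- real p)"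
proof -
  assume c: "c \<le> 1 / 3" "0 \<le> c"
  have "(1 / 3 :: real) \<le> exp (- 1)"
    using exp_le by (simp add: exp_minus field_simps)
  then have "c \<le> exp (- 1)" using c by linarith
  then have "c ^ p \<le> exp (- 1) ^ p" using c by (intro power_mono)
  also have "\<dots> = exp (- real p)" by (simp add: exp_of_nat_mult[symmetric])
  finally show ?thesis .
qed

context unimodular_system begin

definition trace_pow :: "'k set \<Rightarrow> nat \<Rightarrow> nat \<Rightarrow> (nat \<Rightarrow> 'a) \<Rightarrow> real" where
  "trace_pow S n p X = Re (ktr S (kpow S (gram_dev S n X) (2 * p)))"

lemma trace_pow_nonneg: "finite S \<Longrightarrow> 0 \<le> trace_pow S n p X"
  by (simp add: trace_pow_def Re_ktr_kpow_even sum_nonneg)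

lemma integrable_trace_pow: "integrable (PiM {..<n} (\<lambda>_. M)) (trace_pow S n p)"
  unfolding trace_pow_def by (rule integrable_trace_kpow)

text \<open>With \<open>p = \<lceil>x\<rceil>\<close> the hypothesis on \<open>n\<close> gives \<open>\<beta> \<le> 1 / 20\<close> in the moment estimate, which allows
\<open>r = 1 / 15\<close>. Markov's inequality then costs a factor \<open>4\<^sup>p\<close>, and \<open>4 / 15 < exp (- 1)\<close>.\<close>
lemma gram_concentration:
  assumes fin: "finite S" and ne: "S \<noteq> {}" and x: "x \<ge> 5 / 2" and n: "48 * x * real (card S) \<le> real n"
  shows "measure (PiM {..<n} (\<lambda>_. M))
      {X \<in> space (PiM {..<n} (\<lambda>_. M)). (1 / 2) ^ (2 * nat \<lceil>x\<rceil>) \<le> trace_pow S n (nat \<lceil>x\<rceil>) X}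
    \<le> real (card S) * exp (- x)"
proof -
  let ?N = "PiM {..<n} (\<lambda>_. M)"
  define p where "p = nat \<lceil>x\<rceil>"
  define b where "b = real (card S)"
  have b: "b \<ge> 1" unfolding b_def using fin ne by (simp add: Suc_leI card_gt_0_iff)
  have "0 < 48 * x * b" using x b by simp
  then have n0: "n > 0" using n by (simp add: b_def)
  have p: "x \<le> real p" "real p \<le> x + 1" using x by (simp_all add: p_def)
  have "real (2 * p - 1) * b / real n \<le> 1 / 20"
  proof -
    have "real (2 * p - 1) * b \<le> (2 * x + 1) * b"
      using p x b by (intro mult_right_mono) (auto simp: of_nat_diff)
    also have "\<dots> \<le> (48 * x / 20) * b" using x b by (intro mult_right_mono) auto
    also have "\<dots> \<le> real n / 20" using n by (simp add: b_def)
    finally show ?thesis using n0 by (simp add: field_simps)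
  qed
  then have mom: "moment S n (2 * p) \<le> b * (1 / 15) ^ p"
    unfolding b_def by (intro moment_even_le[where \<beta>="1/20"] fin ne n0) auto
  have "measure ?N {X \<in> space ?N. (1 / 2) ^ (2 * p) \<le> trace_pow S n p X}
      \<le> (\<integral>X. trace_pow S n p X \<partial>?N) / (1 / 2) ^ (2 * p)"
    by (intro integral_Markov_inequality_measure[where A="{}"] integrable_trace_pow)
       (auto simp: trace_pow_nonneg fin)
  also have "(\<integral>X. trace_pow S n p X \<partial>?N) = moment S n (2 * p)"
    by (simp add: moment_def trace_pow_def)
  also have "\<dots> / (1 / 2) ^ (2 * p) \<le> b * (1 / 15) ^ p / (1 / 2) ^ (2 * p)"
    by (intro divide_right_mono mom) auto
  also have "\<dots> = b * (4 / 15) ^ p"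
  proof -
    have "(1 / 15 :: real) ^ p / (1 / 2) ^ (2 * p) = ((1 / 15) / (1 / 2)\<^sup>2) ^ p"
      unfolding power_divide[of "1 / 15" "(1 / 2)\<^sup>2"] power_mult ..
    also have "(1 / 15 :: real) / (1 / 2)\<^sup>2 = 4 / 15" by (simp add: power2_eq_square)
    finally show ?thesis by (simp only: times_divide_eq_right[symmetric])
  qed
  also have "\<dots> \<le> b * exp (- x)"
    using b p power_le_exp_minus[of "4/15" p]
    by (intro mult_left_mono) (auto intro: order_trans)
  finally show ?thesis by (simp add: p_def b_def)
qed

text \<open>A random upper bound for the norm of the Gram matrix which, unlike the norm itself, is visibly integrable:
with \<open>y\<close> the trace of \<open>(Z / 4)\<^sup>2\<^sup>p\<close>, the norm of \<open>Z\<close> is at most \<open>4 y\<^sup>1\<^sup>/\<^sup>2\<^sup>p \<le> 4 (1 + y)\<close>.\<close>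
definition gram_bound :: "'k set \<Rightarrow> nat \<Rightarrow> (nat \<Rightarrow> 'a) \<Rightarrow> real" where
  "gram_bound S n X = 1 + 4 * (1 + trace_pow S n (nat \<lceil>ln (real n)\<rceil>) X / 16 ^ nat \<lceil>ln (real n)\<rceil>)"

lemma gram_bound_nonneg: "finite S \<Longrightarrow> 0 \<le> gram_bound S n X"
  by (simp add: gram_bound_def trace_pow_nonneg)

lemma analysis_norm_le_gram_bound:
  assumes fin: "finite S" and n: "n \<ge> 2"
  shows "(\<Sum>k\<in>S. (cmod (\<Sum>j<n. q j * \<eta> k (X j)))\<^sup>2) \<le> real n * gram_bound S n X * (\<Sum>j<n. (cmod (q j))\<^sup>2)"
proof -
  define p where "p = nat \<lceil>ln (real n)\<rceil>"
  define y where "y = trace_pow S n p X / 16 ^ p"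
  have p: "p > 0" using n by (simp add: p_def)
  have y: "y \<ge> 0" by (simp add: y_def trace_pow_nonneg fin)
  have "trace_pow S n p X = 4 ^ (2 * p) * y"
    by (simp add: y_def power_mult)
  also have "\<dots> \<le> 4 ^ (2 * p) * (1 + y) ^ (2 * p)"
  proof (intro mult_left_mono)
    have "y \<le> (1 + y) ^ 1" by simp
    also have "\<dots> \<le> (1 + y) ^ (2 * p)" using y p by (intro power_increasing) auto
    finally show "y \<le> (1 + y) ^ (2 * p)" .
  qed simp
  also have "\<dots> = (4 * (1 + y)) ^ (2 * p)" by (rule power_mult_distrib[symmetric])
  finally have "Re (ktr S (kpow S (gram_dev S n X) (2 * p))) \<le> (4 * (1 + y)) ^ (2 * p)"
    by (simp add: trace_pow_def)
  from analysis_norm_le[OF fin _ p _ this] n y show ?thesis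
    by (simp add: gram_bound_def p_def[symmetric] y_def[symmetric])
qed

lemma integrable_gram_bound: "integrable (PiM {..<n} (\<lambda>_. M)) (gram_bound S n)"
proof -
  interpret N: prob_space "PiM {..<n} (\<lambda>_. M)" by (rule prob_space_nodes)
  show ?thesis
    unfolding gram_bound_def
    by (intro Bochner_Integration.integrable_add integrable_mult_right integrable_divide
        integrable_trace_pow N.integrable_const)
qed

text \<open>For \<open>p = \<lceil>ln n\<rceil>\<close> and \<open>card S \<le> n / ln (8 n)\<close> the moment estimate holds with \<open>\<beta> = 2\<close> and \<open>r = 5\<close>. The
expectation of \<open>y\<close> is then at most \<open>n (5 / 16)\<^sup>p \<le> n exp (- p) \<le> 1\<close>.\<close>
lemma integral_gram_bound_le:
  assumes fin: "finite S" and n: "n \<ge> 2" and b: "real (card S) * ln (8 * real n) \<le> real n"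
  shows "(\<integral>X. gram_bound S n X \<partial>PiM {..<n} (\<lambda>_. M)) \<le> 9"
proof -
  interpret N: prob_space "PiM {..<n} (\<lambda>_. M)" by (rule prob_space_nodes)
  define p where "p = nat \<lceil>ln (real n)\<rceil>"
  have ln0: "ln (real n) > 0" using n by simp
  have p: "p > 0" "ln (real n) \<le> real p" "real p \<le> ln (real n) + 1"
    using ln0 by (simp_all add: p_def)
  have "moment S n (2 * p) / 16 ^ p \<le> 1"
  proof (cases "S = {}")
    case True
    then show ?thesis by (simp add: moment_def ktr_def)
  next
    case False
    have l8: "ln (8 * real n) = ln 8 + ln (real n)" using n by (simp add: ln_mult)
    have "1 \<le> ln (8::real)" using exp_le by (subst ln_ge_iff) auto
    then have "real (2 * p - 1) \<le> 2 * ln (8 * real n)" using p l8 by (simp add: of_nat_diff)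
    then have "real (2 * p - 1) * real (card S) \<le> 2 * ln (8 * real n) * real (card S)"
      by (intro mult_right_mono) auto
    also have "\<dots> \<le> 2 * real n" using b by (simp add: mult_ac)
    finally have "real (2 * p - 1) * real (card S) / real n \<le> 2" using n by (simp add: field_simps)
    then have "moment S n (2 * p) \<le> real (card S) * 5 ^ p"
      using n by (intro moment_even_le[where \<beta>=2] fin False) auto
    then have "moment S n (2 * p) / 16 ^ p \<le> real (card S) * 5 ^ p / 16 ^ p"
      by (intro divide_right_mono) auto
    also have "\<dots> = real (card S) * (5 / 16) ^ p" by (simp add: power_divide)
    also have "\<dots> \<le> real (card S) * exp (- real p)"
      by (intro mult_left_mono power_le_exp_minus) auto
    also have "\<dots> \<le> real n * exp (- ln (real n))"
    proof (intro mult_mono)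
      have "1 \<le> ln (8 * real n)" using l8 \<open>1 \<le> ln 8\<close> ln0 by linarith
      then have "real (card S) * 1 \<le> real (card S) * ln (8 * real n)" by (intro mult_left_mono) auto
      then show "real (card S) \<le> real n" using b by linarith
    qed (use p in auto)
    also have "\<dots> = 1" using n by (simp add: exp_minus)
    finally show ?thesis .
  qed
  moreover have "(\<integral>X. gram_bound S n X \<partial>PiM {..<n} (\<lambda>_. M)) = 1 + 4 * (1 + moment S n (2 * p) / 16 ^ p)"
    unfolding gram_bound_def p_def[symmetric]
  proof -
    have "moment S n (2 * p) = (\<integral>X. trace_pow S n p X \<partial>PiM {..<n} (\<lambda>_. M))"
      by (simp add: moment_def trace_pow_def)
    then show "(\<integral>X. 1 + 4 * (1 + trace_pow S n p X / 16 ^ p) \<partial>PiM {..<n} (\<lambda>_. M))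
        = 1 + 4 * (1 + moment S n (2 * p) / 16 ^ p)"
      using integrable_trace_pow[of n S p] by (simp add: N.prob_space)
  qed
  moreover have "y \<le> 1 \<Longrightarrow> E = 1 + 4 * (1 + y) \<Longrightarrow> E \<le> 9" for y E :: real by simp
  ultimately show ?thesis by blast
qed

text \<open>Markov's inequality for each partial sum, and continuity of the measure along the increasing events.\<close>
lemma weighted_gram_bound_tail:
  fixes S :: "nat \<Rightarrow> 'k set" and a :: "nat \<Rightarrow> real"
  assumes fin: "\<And>i. finite (S i)" and n: "n \<ge> 2"
    and b: "\<And>i. real (card (S i)) * ln (8 * real n) \<le> real n"
    and a: "\<And>i. 0 \<le> a i" "\<And>N. (\<Sum>i<N. a i) \<le> A" and K: "K > 0"
  shows "measure (PiM {..<n} (\<lambda>_. M))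
      {X \<in> space (PiM {..<n} (\<lambda>_. M)). \<exists>N. K \<le> (\<Sum>i<N. a i * gram_bound (S i) n X)} \<le> 9 * A / K"
    and "{X \<in> space (PiM {..<n} (\<lambda>_. M)). \<exists>N. K \<le> (\<Sum>i<N. a i * gram_bound (S i) n X)}
      \<in> sets (PiM {..<n} (\<lambda>_. M))"
proof -
  let ?N = "PiM {..<n} (\<lambda>_. M)"
  interpret N: prob_space ?N by (rule prob_space_nodes)
  define U where "U = (\<lambda>N. {X \<in> space ?N. K \<le> (\<Sum>i<N. a i * gram_bound (S i) n X)})"
  have int: "integrable ?N (\<lambda>X. \<Sum>i<N. a i * gram_bound (S i) n X)" for N
    by (intro Bochner_Integration.integrable_sum integrable_mult_right integrable_gram_bound)
  have U: "U N \<in> sets ?N" for N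
    unfolding U_def using borel_measurable_integrable[OF int[of N]] by measurable
  have eq: "{X \<in> space ?N. \<exists>N. K \<le> (\<Sum>i<N. a i * gram_bound (S i) n X)} = (\<Union>N. U N)"
    by (auto simp: U_def)
  show "{X \<in> space ?N. \<exists>N. K \<le> (\<Sum>i<N. a i * gram_bound (S i) n X)} \<in> sets ?N"
    unfolding eq using U by blast
  have "measure ?N (U N) \<le> 9 * A / K" for N
  proof -
    have "measure ?N (U N) \<le> (\<integral>X. (\<Sum>i<N. a i * gram_bound (S i) n X) \<partial>?N) / K"
      unfolding U_def
      by (intro integral_Markov_inequality_measure[where A="{}"] int)
         (auto intro!: sum_nonneg mult_nonneg_nonneg a gram_bound_nonneg fin K)
    also have "(\<integral>X. (\<Sum>i<N. a i * gram_bound (S i) n X) \<partial>?N) = (\<Sum>i<N. a i * (\<integral>X. gram_bound (S i) n X \<partial>?N))"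
      by (simp add: integrable_gram_bound)
    also have "\<dots> \<le> (\<Sum>i<N. a i * 9)"
      by (intro sum_mono mult_left_mono integral_gram_bound_le fin n b a)
    also have "\<dots> \<le> 9 * A" using a(2)[of N] by (simp flip: sum_distrib_right)
    finally show ?thesis using K by (simp add: divide_right_mono)
  qed
  moreover have "incseq U"
  proof (rule incseq_SucI)
    fix N
    have "0 \<le> a N * gram_bound (S N) n X" for X
      by (intro mult_nonneg_nonneg a gram_bound_nonneg fin)
    then show "U N \<subseteq> U (Suc N)" by (auto simp: U_def intro: add_increasing2)
  qed
  ultimately have "measure ?N (\<Union>N. U N) \<le> 9 * A / K"
    using U by (intro LIMSEQ_le_const2[OF N.finite_Lim_measure_incseq]) auto
  then show "measure ?N {X \<in> space ?N. \<exists>N. K \<le> (\<Sum>i<N. a i * gram_bound (S i) n X)} \<le> 9 * A / K"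
    unfolding eq .
qed

end

section \<open>The exponentials on the torus\<close>

abbreviation unit_cube :: "(real ^ 'd) set" where
  "unit_cube \<equiv> {x. \<forall>i. 0 \<le> x $ i \<and> x $ i < 1}"

text \<open>Lebesgue measure on \<open>real ^ 'd\<close> is the image of the product measure indexed by the basis vectors.\<close>
lemma integral_lborel_vec_prod:
  fixes f :: "'d::finite \<Rightarrow> real \<Rightarrow> complex"
  assumes "\<And>i. integrable lborel (f i)"
  shows "(\<integral>x. (\<Prod>i\<in>UNIV. f i (x $ i)) \<partial>(lborel :: (real ^ 'd) measure)) = (\<Prod>i\<in>UNIV. \<integral>t. f i t \<partial>lborel)"
proof -
  have Basis: "Basis = range (\<lambda>i::'d. axis i (1::real))" by (auto simp: Basis_vec_def)
  have inj: "inj (\<lambda>i::'d. axis i (1::real))" by (auto simp: inj_on_def axis_eq_axis)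
  define ix where "ix = (\<lambda>b::real ^ 'd. the_inv (\<lambda>i. axis i (1::real)) b)"
  have ix: "ix (axis i 1) = i" for i using the_inv_f_f[OF inj, of i] by (simp add: ix_def)
  have comp: "(\<Sum>b\<in>Basis. X b *\<^sub>R b) $ i = X (axis i 1)" for X and i :: 'd
  proof -
    have "(\<Sum>b\<in>Basis. X b *\<^sub>R b) $ i = (\<Sum>j\<in>UNIV. X (axis j 1) * axis j 1 $ i)"
      by (simp add: Basis sum.reindex[OF inj])
    also have "\<dots> = (\<Sum>j\<in>UNIV. if j = i then X (axis j 1) else 0)"
      by (intro sum.cong) (auto simp: axis_def)
    finally show ?thesis by simp
  qed
  interpret P: product_sigma_finite "\<lambda>_::real ^ 'd. lborel :: real measure" by standard
  have [measurable]: "f i \<in> borel_measurable borel" for i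
    using borel_measurable_integrable[OF assms[of i]] by simp
  have "(\<integral>x. (\<Prod>i\<in>UNIV. f i (x $ i)) \<partial>(lborel :: (real ^ 'd) measure))
      = (\<integral>X. (\<Prod>i\<in>UNIV. f i ((\<Sum>b\<in>Basis. X b *\<^sub>R b) $ i)) \<partial>(\<Pi>\<^sub>M b\<in>Basis. lborel))"
    by (subst lborel_eq, subst integral_distr) auto
  also have "\<dots> = (\<integral>X. (\<Prod>b\<in>Basis. f (ix b) (X b)) \<partial>(\<Pi>\<^sub>M b\<in>Basis. lborel))"
    unfolding comp by (simp add: Basis prod.reindex[OF inj] ix)
  also have "\<dots> = (\<Prod>b\<in>Basis. \<integral>t. f (ix b) t \<partial>lborel)"
    by (rule P.product_integral_prod) (auto intro: assms)
  also have "\<dots> = (\<Prod>i\<in>UNIV. \<integral>t. f i t \<partial>lborel)"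
    by (simp add: Basis prod.reindex[OF inj] ix)
  finally show ?thesis .
qed

lemma sets_unit_cube: "(unit_cube :: (real ^ 'd) set) \<in> sets lborel"
proof -
  have "{x :: real ^ 'd. \<forall>i. 0 \<le> x $ i \<and> x $ i < 1} = {x \<in> space borel. \<forall>i. 0 \<le> x $ i \<and> x $ i < 1}" by simp
  also have "\<dots> \<in> sets borel" by measurable
  finally show ?thesis by simp
qed

lemma space_torus: "space torus = unit_cube"
  by (simp add: torus_def space_restrict_space)

lemma integral_torus: "(\<integral>x. f x \<partial>torus) = (\<integral>x. indicator unit_cube x *\<^sub>R (f x :: complex) \<partial>lborel)"
  unfolding torus_def by (rule integral_restrict_space) (use sets_unit_cube in simp)

lemma indicator_unit_cube: "indicator unit_cube x = (\<Prod>i\<in>UNIV. indicator {0..<1} (x $ i) :: real)"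
  by (cases "x \<in> unit_cube") (auto simp: indicator_def not_less intro!: prod_zero[symmetric])

lemma integrable_indicator_continuous:
  fixes g :: "real \<Rightarrow> complex"
  assumes "continuous_on UNIV g"
  shows "integrable lborel (\<lambda>t. indicator {0..<1} t *\<^sub>R g t)"
    and "(\<integral>t. indicator {0..<1} t *\<^sub>R g t \<partial>lborel) = (\<integral>t. indicator {0..1} t *\<^sub>R g t \<partial>lborel)"
proof -
  have m: "g \<in> borel_measurable borel" using assms by (rule borel_measurable_continuous_onI)
  have ae: "AE t in lborel. indicator {0..1} t *\<^sub>R g t = indicator {0..<1} t *\<^sub>R g t"
    using AE_lborel_singleton[of 1] by eventually_elim (auto simp: indicator_def)
  have i: "integrable lborel (\<lambda>t. indicator {0..1} t *\<^sub>R g t)"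
    using borel_integrable_compact[of "{0..1}" g] assms
    by (simp add: continuous_on_subset indicator_def if_distrib cong: if_cong)
  show "integrable lborel (\<lambda>t. indicator {0..<1} t *\<^sub>R g t)"
    by (rule integrable_cong_AE_imp[OF i _ ae]) (use m in measurable)
  show "(\<integral>t. indicator {0..<1} t *\<^sub>R g t \<partial>lborel) = (\<integral>t. indicator {0..1} t *\<^sub>R g t \<partial>lborel)"
    by (rule integral_cong_AE[symmetric, OF _ _ ae]) (use m in measurable)
qed

text \<open>A full period of an exponential integrates to zero.\<close>
lemma integral_exp_unit_interval:
  "(\<integral>t. indicator {0..<1} t *\<^sub>R exp (2 * of_real pi * \<i> * of_real (of_int k * t)) \<partial>lborel) = of_bool (k = 0)"
proof -
  let ?g = "\<lambda>t. exp (2 * of_real pi * \<i> * of_real (of_int k * t))"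
  have c: "continuous_on UNIV ?g" by (intro continuous_intros)
  show ?thesis
  proof (cases "k = 0")
    case True
    then show ?thesis by simp
  next
    case False
    let ?a = "2 * of_real pi * \<i> * of_int k :: complex"
    have a: "?a \<noteq> 0" using False by simp
    have "((\<lambda>t. ?g t / ?a) has_vector_derivative ?g t) (at t within {0..1})" for t
    proof -
      have "((\<lambda>z. exp (?a * z) / ?a) has_field_derivative exp (?a * of_real t)) (at (of_real t))"
        using a by (auto intro!: derivative_eq_intros)
      from has_vector_derivative_real_field[OF this]
      have "((\<lambda>t. exp (?a * of_real t) / ?a) has_vector_derivative exp (?a * of_real t)) (at t)"
        by simp
      then show ?thesis by (simp add: mult_ac has_vector_derivative_at_within)
    qed
    then have "(\<integral>t. indicator {0..1} t *\<^sub>R ?g t \<partial>lborel) = ?g 1 / ?a - ?g 0 / ?a"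
      by (intro integral_FTC_Icc[where F="\<lambda>t. ?g t / ?a"] continuous_on_subset[OF c]) simp_all
    also have "?g 1 = 1"
      using exp_integer_2pi[of "of_int k"] by (simp add: mult_ac)
    finally show ?thesis using False integrable_indicator_continuous(2)[OF c] by simp
  qed
qed

lemma fourier_fun_prod:
  "fourier_fun k x = (\<Prod>i\<in>UNIV. exp (2 * of_real pi * \<i> * of_real (of_int (k $ i) * x $ i)))"
  unfolding fourier_fun_def by (simp add: sum_distrib_left exp_sum)

lemma fourier_fun_mult: "fourier_fun k x * fourier_fun l x = fourier_fun (k + l) x"
  by (simp add: fourier_fun_def sum.distrib algebra_simps flip: exp_add)

lemma cnj_fourier_fun: "cnj (fourier_fun k x) = fourier_fun (- k) x"
  by (simp add: fourier_fun_def exp_cnj sum_negf)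

lemma cmod_fourier_fun: "cmod (fourier_fun k x) = 1"
  by (simp add: fourier_fun_def norm_exp_eq_Re)

lemma fourier_fun_0 [simp]: "fourier_fun 0 x = 1"
  by (simp add: fourier_fun_def)

lemma fourier_coeff_eq: "fourier_coeff f k = (\<integral>x. f x * fourier_fun (- k) x \<partial>torus)"
  by (simp add: fourier_coeff_def fourier_fun_def sum_negf)

lemma continuous_fourier_fun: "continuous_on A (fourier_fun k)"
  unfolding fourier_fun_def by (intro continuous_intros)

lemma measurable_torus_of_continuous: "continuous_on UNIV f \<Longrightarrow> f \<in> borel_measurable torus"
  unfolding torus_def by (intro measurable_restrict_space1) (simp add: borel_measurable_continuous_onI)

lemma integral_fourier_fun: "(\<integral>x. fourier_fun k x \<partial>torus) = of_bool (k = 0)"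
proof -
  let ?g = "\<lambda>i t. exp (2 * of_real pi * \<i> * of_real (of_int (k $ i) * t))"
  have "(\<integral>x. fourier_fun k x \<partial>torus) = (\<integral>x. (\<Prod>i\<in>UNIV. indicator {0..<1} (x $ i) *\<^sub>R ?g i (x $ i)) \<partial>lborel)"
    unfolding integral_torus indicator_unit_cube fourier_fun_prod
    by (simp add: scaleR_conv_of_real prod.distrib)
  also have "\<dots> = (\<Prod>i\<in>UNIV. \<integral>t. indicator {0..<1} t *\<^sub>R ?g i t \<partial>lborel)"
    by (intro integral_lborel_vec_prod integrable_indicator_continuous continuous_intros)
  also have "\<dots> = (\<Prod>i\<in>UNIV. of_bool (k $ i = 0))"
    by (simp only: integral_exp_unit_interval)
  also have "\<dots> = of_bool (k = 0)"
    by (auto simp: Finite_Cartesian_Product.vec_eq_iff prod_zero_iff of_bool_def)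
  finally show ?thesis .
qed

lemma prob_space_torus: "prob_space torus"
proof
  have "integral\<^sup>L torus (\<lambda>_. 1 :: complex) = 1"
    using integral_fourier_fun[of 0] by simp
  then have "measure torus (space torus) = 1"
    by (simp add: scaleR_conv_of_real)
  then show "emeasure torus (space torus) = 1"
    by (metis emeasure_eq_ennreal_measure enn2real_top ennreal_1 measure_def zero_neq_one)
qed

interpretation torus: unimodular_system "torus :: (real ^ 'd) measure" fourier_fun
proof -
  interpret prob_space "torus :: (real ^ 'd) measure" by (rule prob_space_torus)
  show "unimodular_system (torus :: (real ^ 'd) measure) fourier_fun"
  proof
    show "fourier_fun k \<in> borel_measurable (torus :: (real ^ 'd) measure)" for k
      by (rule measurable_torus_of_continuous[OF continuous_fourier_fun])
    show "cmod (fourier_fun k x) = 1" for k and x :: "real ^ 'd" by (rule cmod_fourier_fun)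
    show "(\<integral>x. cnj (fourier_fun k x) * fourier_fun l x \<partial>(torus :: (real ^ 'd) measure)) = of_bool (k = l)" for k l
      unfolding cnj_fourier_fun fourier_fun_mult integral_fourier_fun by auto
  qed
qed

lemma bmeas_torus_of_continuous:
  fixes f :: "real ^ 'd \<Rightarrow> complex"
  assumes "continuous_on UNIV f"
  shows "bmeas torus f"
proof -
  have "compact (f ` cbox 0 1)"
    by (intro compact_continuous_image continuous_on_subset[OF assms]) auto
  then obtain B where B: "\<And>x. x \<in> cbox 0 1 \<Longrightarrow> cmod (f x) \<le> B"
    using compact_imp_bounded bounded_iff by (metis imageI)
  have "x \<in> cbox 0 1" if "x \<in> space torus" for x :: "real ^ 'd"
    using that unfolding space_torus by (auto simp: mem_box_cart intro: less_imp_le)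
  then show ?thesis
    unfolding bmeas_def using B measurable_torus_of_continuous[OF assms] by blast
qed

section \<open>Uniqueness of Fourier coefficients\<close>

text \<open>The product of these factors over all coordinates is a nonnegative trigonometric polynomial that
peaks at \<open>y\<close>; its powers concentrate there.\<close>
definition bump :: "real ^ 'd \<Rightarrow> 'd \<Rightarrow> real ^ 'd \<Rightarrow> real" where
  "bump y i x = (1 + cos (2 * pi * (x $ i - y $ i))) / 2"

lemma bump_bounds: "0 \<le> bump y i x" "bump y i x \<le> 1"
proof -
  have "0 \<le> (1 + c) / 2 \<and> (1 + c) / 2 \<le> 1" if "- 1 \<le> c" "c \<le> 1" for c :: real
    using that by simp
  then show "0 \<le> bump y i x" "bump y i x \<le> 1"
    unfolding bump_def using cos_ge_minus_one cos_le_one by blast+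
qed

lemma bump_fourier:
  "complex_of_real (bump y i x) = 1 / 2 * fourier_fun 0 x
     + exp (- (2 * of_real pi * \<i> * of_real (y $ i))) / 4 * fourier_fun (axis i 1) x
     + exp (2 * of_real pi * \<i> * of_real (y $ i)) / 4 * fourier_fun (- axis i 1) x"
proof -
  have s: "(\<Sum>j\<in>UNIV. of_int (axis i 1 $ j) * x $ j) = x $ i"
  proof -
    have "(\<Sum>j\<in>UNIV. of_int (axis i 1 $ j) * x $ j) = (\<Sum>j\<in>UNIV. if j = i then x $ j else 0)"
      by (intro sum.cong) (auto simp: axis_def)
    then show ?thesis by simp
  qed
  then have s': "(\<Sum>j\<in>UNIV. of_int ((- axis i 1) $ j) * x $ j) = - (x $ i)"
    by (simp add: sum_negf)
  define \<theta> where "\<theta> = 2 * pi * (x $ i - y $ i)"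
  have e0: "complex_of_real (cos \<theta>) = (exp (\<i> * of_real \<theta>) + exp (- (\<i> * of_real \<theta>))) / 2"
    by (simp add: cos_exp_eq flip: cos_of_real)
  have e1: "exp (\<i> * of_real \<theta>) = exp (- (2 * of_real pi * \<i> * of_real (y $ i))) * fourier_fun (axis i 1) x"
    unfolding fourier_fun_def s by (simp add: \<theta>_def algebra_simps flip: exp_add)
  have e2: "exp (- (\<i> * of_real \<theta>)) = exp (2 * of_real pi * \<i> * of_real (y $ i)) * fourier_fun (- axis i 1) x"
    unfolding fourier_fun_def s' by (simp add: \<theta>_def algebra_simps flip: exp_add)
  have "complex_of_real (bump y i x) = (1 + complex_of_real (cos \<theta>)) / 2"
    by (simp add: bump_def \<theta>_def)
  then show ?thesis
    unfolding e0 e1 e2 by (simp add: add_divide_distrib)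
qed

text \<open>If all Fourier coefficients of \<open>f T\<close> vanish, so do those of \<open>f T\<close> times a bump, because a bump is a
combination of three exponentials. Start with \<open>T = 1\<close> and multiply one factor at a time.\<close>
lemma integral_mult_bump_eq_0:
  assumes f: "bmeas torus f" and zero: "\<And>k. (\<integral>x. f x * fourier_fun k x \<partial>torus) = 0"
  shows "(\<integral>x. f x * of_real (\<Prod>i\<in>I. bump y i x ^ N) * fourier_fun k x \<partial>torus) = 0"
proof -
  define ann where "ann = (\<lambda>T. bmeas torus T \<and> (\<forall>k. (\<integral>x. f x * T x * fourier_fun k x \<partial>torus) = 0))"
  have step: "ann (\<lambda>x. T x * of_real (bump y i x))" if "ann T" for T i
  proof -
    have T: "bmeas torus T" "(\<integral>x. f x * T x * fourier_fun k x \<partial>torus) = 0" for k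
      using that by (auto simp: ann_def)
    have "bmeas torus (\<lambda>x. T x * of_real (bump y i x))"
      unfolding bump_fourier by (intro bmeas_intros T torus.bmeas_\<eta>)
    moreover have "(\<integral>x. f x * (T x * of_real (bump y i x)) * fourier_fun k x \<partial>torus) = 0" for k
    proof -
      let ?e = "exp (- (2 * of_real pi * \<i> * of_real (y $ i)))"
      let ?e' = "exp (2 * of_real pi * \<i> * of_real (y $ i))"
      have "(\<integral>x. f x * (T x * of_real (bump y i x)) * fourier_fun k x \<partial>torus)
        = (\<integral>x. 1 / 2 * (f x * T x * fourier_fun (0 + k) x) + ?e / 4 * (f x * T x * fourier_fun (axis i 1 + k) x)
            + ?e' / 4 * (f x * T x * fourier_fun (- axis i 1 + k) x) \<partial>torus)"
        unfolding bump_fourier fourier_fun_mult[symmetric] by (simp add: algebra_simps)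
      also have "\<dots> = 1 / 2 * (\<integral>x. f x * T x * fourier_fun (0 + k) x \<partial>torus)
         + ?e / 4 * (\<integral>x. f x * T x * fourier_fun (axis i 1 + k) x \<partial>torus)
         + ?e' / 4 * (\<integral>x. f x * T x * fourier_fun (- axis i 1 + k) x \<partial>torus)"
      proof -
        have int: "integrable torus (\<lambda>x. f x * T x * fourier_fun k x)" for k
          by (intro torus.integrable_bmeas bmeas_intros f T torus.bmeas_\<eta>)
        show ?thesis
          by (simp only: Bochner_Integration.integral_add integrable_mult_right int
              Bochner_Integration.integrable_add integral_mult_right_zero)
      qed
      finally show ?thesis by (simp add: T)
    qed
    ultimately show ?thesis by (simp add: ann_def)
  qed
  have powers: "ann (\<lambda>x. T x * of_real (bump y i x ^ N))" if "ann T" for T i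
  proof (induction N)
    case (Suc N)
    from step[OF this, of i] show ?case by (simp add: mult_ac)
  qed (use that in simp)
  have "ann (\<lambda>x. of_real (\<Prod>i\<in>I. bump y i x ^ N))"
  proof (induction I rule: infinite_finite_induct)
    case (insert i I)
    from powers[OF insert.IH, of i] insert.hyps show ?case by (simp add: mult_ac)
  qed (use zero in \<open>simp_all add: ann_def bmeas_const\<close>)
  then show ?thesis by (simp add: ann_def)
qed

lemma prod_bump_le:
  assumes far: "\<eta> \<le> \<bar>x $ j - y $ j\<bar>" "\<bar>x $ j - y $ j\<bar> \<le> 1 - \<eta>" and \<eta>: "0 < \<eta>"
  shows "(\<Prod>i\<in>UNIV. bump y i x) \<le> (1 + cos (2 * pi * \<eta>)) / 2"
proof -
  let ?t = "\<bar>x $ j - y $ j\<bar>"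
  have "cos (2 * pi * ?t) \<le> cos (2 * pi * \<eta>)"
  proof (cases "?t \<le> 1 / 2")
    case True
    then show ?thesis using far \<eta> by (intro cos_monotone_0_pi_le) auto
  next
    case False
    have "cos (2 * pi * ?t) = cos (2 * pi * (1 - ?t))"
      using cos_2pi_minus[of "2 * pi * ?t"] by (simp add: algebra_simps)
    also have "\<dots> \<le> cos (2 * pi * \<eta>)"
      using far \<eta> False by (intro cos_monotone_0_pi_le) auto
    finally show ?thesis .
  qed
  moreover have "cos (2 * pi * ?t) = cos (2 * pi * (x $ j - y $ j))"
    by (cases "x $ j - y $ j \<ge> 0") (auto simp: abs_if algebra_simps cos_diff)
  ultimately have "bump y j x \<le> (1 + cos (2 * pi * \<eta>)) / 2" by (simp add: bump_def)
  moreover have "(\<Prod>i\<in>UNIV. bump y i x) \<le> bump y j x"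
  proof -
    have "(\<Prod>i\<in>UNIV. bump y i x) = bump y j x * (\<Prod>i\<in>UNIV - {j}. bump y i x)"
      by (simp add: prod.remove[of UNIV j])
    also have "\<dots> \<le> bump y j x * 1"
      by (intro mult_left_mono prod_le_1) (auto simp: bump_bounds)
    finally show ?thesis by simp
  qed
  ultimately show ?thesis by linarith
qed

lemma prod_bump_ge:
  fixes x y :: "real ^ 'd"
  assumes near: "\<And>i. \<bar>x $ i - y $ i\<bar> \<le> \<eta>" and \<eta>: "\<eta> \<le> 1 / 2"
  shows "((1 + cos (2 * pi * \<eta>)) / 2) ^ CARD('d) \<le> (\<Prod>i\<in>UNIV. bump y i x)"
proof -
  have "(1 + cos (2 * pi * \<eta>)) / 2 \<le> bump y i x" for i
  proof -
    have "cos (2 * pi * \<eta>) \<le> cos (2 * pi * \<bar>x $ i - y $ i\<bar>)"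
      using near[of i] \<eta> by (intro cos_monotone_0_pi_le) auto
    also have "\<dots> = cos (2 * pi * (x $ i - y $ i))"
      by (cases "x $ i - y $ i \<ge> 0") (auto simp: abs_if algebra_simps cos_diff)
    finally show ?thesis by (simp add: bump_def)
  qed
  moreover have "0 \<le> (1 + cos (2 * pi * \<eta>)) / 2"
  proof -
    have *: "0 \<le> (1 + c) / 2" if "- 1 \<le> c" for c :: real using that by simp
    show ?thesis by (rule *[OF cos_ge_minus_one])
  qed
  ultimately have "(\<Prod>i\<in>(UNIV :: 'd set). (1 + cos (2 * pi * \<eta>)) / 2) \<le> (\<Prod>i\<in>UNIV. bump y i x)"
    by (intro prod_mono) auto
  then show ?thesis by simp
qed

text \<open>Suppose \<open>f y \<noteq> 0\<close> and let \<open>h\<close> be the real part of \<open>cnj (f y) * f\<close>, which is at least \<open>c > 0\<close> near \<open>y\<close>. The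
\<open>N\<close>-th power of the bump integrates against \<open>h\<close> to zero. It is at least \<open>\<rho>'\<^sup>N\<close> on a small cube \<open>V\<close> around
\<open>y\<close> and at most \<open>\<rho>\<^sup>N\<close> away from \<open>y\<close>, with \<open>\<rho> < \<rho>'\<close>. Hence \<open>c \<rho>'\<^sup>N \<mu>(V) \<le> K \<rho>\<^sup>N\<close> for all \<open>N\<close>, which is
impossible.\<close>
lemma continuous_eq_0_of_fourier_interior:
  fixes f :: "real ^ 'd \<Rightarrow> complex"
  assumes cont: "continuous_on UNIV f" and zero: "\<And>k. (\<integral>x. f x * fourier_fun k x \<partial>torus) = 0"
    and y: "\<And>i. 0 < y $ i \<and> y $ i < 1"
  shows "f y = 0"
proof (rule ccontr)
  assume ne: "f y \<noteq> 0"
  define h where "h = (\<lambda>x. Re (cnj (f y) * f x))"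
  define c where "c = h y / 2"
  have hy: "h y = (cmod (f y))\<^sup>2" unfolding h_def cmod_power2 by (simp add: power2_eq_square)
  then have c: "c > 0" using ne by (simp add: c_def)
  have hcont: "continuous_on UNIV h"
    unfolding h_def by (intro continuous_intros cont)
  obtain r where r: "r > 0" "\<And>x. dist x y < r \<Longrightarrow> \<bar>h x - h y\<bar> < c"
    using hcont c unfolding continuous_on_iff dist_real_def by (metis UNIV_I)
  define m where "m = Min (range (\<lambda>i. min (y $ i) (1 - y $ i)))"
  have m: "m > 0" "\<And>i. m \<le> y $ i" "\<And>i. y $ i \<le> 1 - m"
  proof -
    have *: "m \<le> min (y $ i) (1 - y $ i)" for i unfolding m_def by (rule Min_le) auto
    show "m \<le> y $ i" "y $ i \<le> 1 - m" for i using *[of i] by auto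
    have "m \<in> range (\<lambda>i. min (y $ i) (1 - y $ i))" unfolding m_def by (rule Min_in) auto
    then show "m > 0" using y by (auto simp: min_def)
  qed
  \<comment> \<open>\<open>\<eta> \<le> m\<close> keeps the cube of radius \<open>\<eta>\<close> inside the unit cube; there the distance to \<open>y\<close> in one
coordinate is at most \<open>1 - \<eta>\<close>, so the periodic images of \<open>y\<close> are at least \<open>\<eta>\<close> away\<close>
  define \<eta> where "\<eta> = min m (min (1 / 4) (r / (real CARD('d) + 1)))"
  have \<eta>: "\<eta> > 0" "\<eta> \<le> m" "\<eta> \<le> 1 / 4" "\<eta> * (real CARD('d) + 1) \<le> r"
  proof -
    show "\<eta> > 0" using m r by (simp add: \<eta>_def)
    show "\<eta> \<le> m" "\<eta> \<le> 1 / 4" unfolding \<eta>_def by linarith+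
    have "\<eta> \<le> r / (real CARD('d) + 1)" by (simp add: \<eta>_def)
    then show "\<eta> * (real CARD('d) + 1) \<le> r" by (simp add: field_simps)
  qed
  have near: "h x \<ge> c" if "\<And>i. \<bar>x $ i - y $ i\<bar> \<le> \<eta>" for x
  proof -
    have "norm (x - y) \<le> (\<Sum>i\<in>UNIV. \<bar>(x - y) $ i\<bar>)" by (rule norm_le_l1_cart)
    also have "\<dots> \<le> (\<Sum>i\<in>(UNIV::'d set). \<eta>)" using that by (intro sum_mono) simp
    also have "\<dots> = \<eta> * real CARD('d)" by simp
    also have "\<dots> < \<eta> * (real CARD('d) + 1)" using \<eta>(1) by (simp add: distrib_left)
    finally have "dist x y < r" using \<eta>(4) by (simp add: dist_norm)
    from r(2)[OF this] show ?thesis by (simp add: c_def abs_if split: if_splits)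
  qed
  define \<rho> where "\<rho> = (1 + cos (2 * pi * \<eta>)) / 2"
  have "cos (2 * pi * \<eta>) < cos 0"
    using \<eta> by (intro cos_monotone_0_pi) auto
  then have \<rho>1: "\<rho> < 1" by (simp add: \<rho>_def)
  have "cos (2 * pi * \<eta>) \<ge> 0" using \<eta> by (intro cos_ge_zero) (auto intro: order_trans[of _ 0])
  then have \<rho>0: "\<rho> > 0" by (simp add: \<rho>_def)
  have "((\<lambda>\<epsilon>. ((1 + cos (2 * pi * \<epsilon>)) / 2) ^ CARD('d)) \<longlongrightarrow> ((1 + cos (2 * pi * 0)) / 2) ^ CARD('d)) (at_right 0)"
    by (intro tendsto_intros) simp_all
  then have "((\<lambda>\<epsilon>. ((1 + cos (2 * pi * \<epsilon>)) / 2) ^ CARD('d)) \<longlongrightarrow> 1) (at_right 0)" by simp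
  then have "eventually (\<lambda>\<epsilon>. \<rho> < ((1 + cos (2 * pi * \<epsilon>)) / 2) ^ CARD('d)) (at_right 0)"
    using \<rho>1 by (rule order_tendstoD)
  moreover have "eventually (\<lambda>\<epsilon>. \<epsilon> > 0) (at_right (0::real))" "eventually (\<lambda>\<epsilon>. \<epsilon> < \<eta>) (at_right 0)"
    using \<eta>(1) by (auto simp: eventually_at_right_less eventually_at_right_field)
  ultimately have "eventually (\<lambda>\<epsilon>. \<rho> < ((1 + cos (2 * pi * \<epsilon>)) / 2) ^ CARD('d) \<and> \<epsilon> > 0 \<and> \<epsilon> < \<eta>) (at_right 0)"
    by eventually_elim auto
  then obtain \<epsilon> where \<epsilon>: "\<rho> < ((1 + cos (2 * pi * \<epsilon>)) / 2) ^ CARD('d)" "\<epsilon> > 0" "\<epsilon> < \<eta>"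
    using eventually_happens[of _ "at_right (0::real)"] by fastforce
  define \<rho>' where "\<rho>' = ((1 + cos (2 * pi * \<epsilon>)) / 2) ^ CARD('d)"
  define V where "V = cbox (y - (\<chi> i. \<epsilon>)) (y + (\<chi> i. \<epsilon>))"
  have V: "x \<in> V \<longleftrightarrow> (\<forall>i. \<bar>x $ i - y $ i\<bar> \<le> \<epsilon>)" for x
    unfolding V_def mem_box_cart by (auto simp: abs_le_iff algebra_simps)
  have V_cube: "V \<subseteq> unit_cube"
  proof
    fix x assume "x \<in> V"
    have "0 \<le> x $ i \<and> x $ i < 1" for i
    proof -
      have "\<bar>x $ i - y $ i\<bar> < m" using \<open>x \<in> V\<close> \<epsilon> \<eta> V by (meson order_le_less_trans order_less_le_trans)
      then show ?thesis using m(2,3)[of i] by (auto simp: abs_if split: if_splits)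
    qed
    then show "x \<in> unit_cube" by simp
  qed
  have V_sets: "V \<in> sets torus"
    unfolding torus_def sets_restrict_space using V_cube by (auto simp: V_def intro!: image_eqI[of _ _ V])
  define \<mu> where "\<mu> = measure torus V"
  have \<mu>: "\<mu> > 0"
  proof -
    have "\<mu> = measure lborel V"
      unfolding \<mu>_def torus_def using V_cube sets_unit_cube by (intro measure_restrict_space) auto
    also have "\<dots> = (2 * \<epsilon>) ^ CARD('d)"
    proof -
      have "y \<in> V" using \<epsilon>(2) by (simp add: V)
      then have "V \<noteq> {}" by blast
      then show ?thesis unfolding V_def by (subst content_cbox_cart) simp_all
    qed
    finally show ?thesis using \<epsilon>(2) by simp
  qed
  obtain B where B: "\<And>x. x \<in> space torus \<Longrightarrow> cmod (f x) \<le> B"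
    using bmeas_torus_of_continuous[OF cont] by (auto simp: bmeas_def)
  define K where "K = cmod (f y) * \<bar>B\<bar>"
  have hK: "\<bar>h x\<bar> \<le> K" if "x \<in> space torus" for x
  proof -
    have "\<bar>h x\<bar> \<le> cmod (f y) * cmod (f x)"
      using abs_Re_le_cmod[of "cnj (f y) * f x"] by (simp add: h_def norm_mult)
    also have "\<dots> \<le> K" unfolding K_def using B[OF that] by (intro mult_left_mono) auto
    finally show ?thesis .
  qed
  have K0: "K \<ge> 0" by (simp add: K_def)
  have main: "c * \<rho>' ^ N * \<mu> \<le> K * \<rho> ^ N" for N
  proof -
    define T where "T = (\<lambda>x. (\<Prod>i\<in>UNIV. bump y i x))"
    have T0: "T x \<ge> 0" for x unfolding T_def by (intro prod_nonneg) (simp add: bump_bounds)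
    have bmT: "bmeas torus (\<lambda>x. complex_of_real (T x ^ N))"
      unfolding T_def bump_def
      by (intro bmeas_torus_of_continuous continuous_intros) auto
    have "bmeas torus (\<lambda>x. cnj (f y) * (f x * of_real (T x ^ N)))"
      by (intro bmeas_intros bmT bmeas_torus_of_continuous cont)
    then have int: "integrable torus (\<lambda>x. cnj (f y) * (f x * of_real (T x ^ N)))"
      by (rule torus.integrable_bmeas)
    have "(\<integral>x. f x * of_real (T x ^ N) \<partial>torus) = 0"
      using integral_mult_bump_eq_0[OF bmeas_torus_of_continuous[OF cont] zero, where I=UNIV and y=y and N=N and k=0]
      by (simp add: T_def prod_power_distrib)
    then have "0 = Re (\<integral>x. cnj (f y) * (f x * of_real (T x ^ N)) \<partial>torus)" by simp
    also have "\<dots> = (\<integral>x. Re (cnj (f y) * (f x * of_real (T x ^ N))) \<partial>torus)"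
      using int by (rule integral_Re[symmetric])
    also have "\<dots> = (\<integral>x. h x * T x ^ N \<partial>torus)"
      by (intro Bochner_Integration.integral_cong refl) (simp add: h_def algebra_simps flip: of_real_power)
    finally have z: "(\<integral>x. h x * T x ^ N \<partial>torus) = 0" by simp
    have int2: "integrable torus (\<lambda>x. h x * T x ^ N)"
    proof -
      have "(\<lambda>x. h x * T x ^ N) = (\<lambda>x. Re (cnj (f y) * (f x * of_real (T x ^ N))))"
        by (simp add: h_def algebra_simps fun_eq_iff flip: of_real_power)
      then show ?thesis using integrable_Re[OF int] by simp
    qed
    have int3: "integrable torus (\<lambda>x. c * \<rho>' ^ N * indicator V x - K * \<rho> ^ N)"
      using V_sets by (intro Bochner_Integration.integrable_diff integrable_mult_right torus.integrable_const integrable_real_indicator) (simp_all add: torus.emeasure_eq_measure)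
    have "(\<integral>x. c * \<rho>' ^ N * indicator V x - K * \<rho> ^ N \<partial>torus) \<le> (\<integral>x. h x * T x ^ N \<partial>torus)"
    proof (rule integral_mono[OF int3 int2])
      fix x :: "real ^ 'd" assume x: "x \<in> space torus"
      have KN: "0 \<le> K * \<rho> ^ N" using K0 \<rho>0 by simp
      consider "x \<in> V" | "x \<notin> V" "\<forall>i. \<bar>x $ i - y $ i\<bar> \<le> \<eta>" | j where "x \<notin> V" "\<bar>x $ j - y $ j\<bar> > \<eta>"
        by (metis not_less)
      then show "c * \<rho>' ^ N * indicator V x - K * \<rho> ^ N \<le> h x * T x ^ N"
      proof cases
        case 1
        have nx: "\<bar>x $ i - y $ i\<bar> \<le> \<epsilon>" for i using 1 V by blast
        have "\<rho>' \<le> T x" unfolding \<rho>'_def T_def using nx \<epsilon> \<eta> by (intro prod_bump_ge) auto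
        moreover have "0 \<le> \<rho>'" using \<epsilon>(1) \<rho>0 by (simp add: \<rho>'_def)
        moreover have "c \<le> h x" using nx \<epsilon>(3) by (intro near) (meson less_imp_le order_trans)
        ultimately have "c * \<rho>' ^ N \<le> h x * T x ^ N"
          using c by (intro mult_mono power_mono) auto
        then show ?thesis using 1 KN by simp
      next
        case 2
        then have "c \<le> h x" by (intro near) auto
        then have "0 \<le> h x * T x ^ N" using c T0 by (intro mult_nonneg_nonneg) auto
        then show ?thesis using 2 KN by simp
      next
        case 3
        have "0 \<le> x $ j" "x $ j < 1" using x unfolding space_torus by auto
        then have "\<bar>x $ j - y $ j\<bar> \<le> 1 - \<eta>"
          using m(2,3)[of j] \<eta>(2) by (auto simp: abs_if)
        then have "T x \<le> \<rho>" unfolding T_def \<rho>_def using 3 \<eta> by (intro prod_bump_le[of \<eta> x j]) auto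
        then have "\<bar>h x * T x ^ N\<bar> \<le> K * \<rho> ^ N"
          unfolding abs_mult using hK[OF x] T0 K0 by (intro mult_mono power_mono) (auto simp: power_abs intro!: power_mono)
        then show ?thesis using 3 by (simp add: abs_le_iff)
      qed
    qed
    moreover have "(\<integral>x. c * \<rho>' ^ N * indicator V x - K * \<rho> ^ N \<partial>torus) = c * \<rho>' ^ N * \<mu> - K * \<rho> ^ N"
      using V_sets by (simp add: \<mu>_def torus.prob_space torus.emeasure_eq_measure Int_absorb2 sets.sets_into_space)
    ultimately show ?thesis using z by simp
  qed
  have q: "\<rho>' / \<rho> > 1" using \<epsilon>(1) \<rho>0 by (simp add: \<rho>'_def)
  obtain N where N: "K / (c * \<mu>) < (\<rho>' / \<rho>) ^ N"
    using real_arch_pow[OF q] by blast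
  have "K < (\<rho>' / \<rho>) ^ N * (c * \<mu>)" using N c \<mu> by (simp add: pos_divide_less_eq)
  also have "\<dots> = c * \<rho>' ^ N * \<mu> / \<rho> ^ N" by (simp add: power_divide)
  also have "\<dots> \<le> K" using main[of N] \<rho>0 by (simp add: divide_le_eq)
  finally show False by simp
qed

text \<open>Points on the boundary are reached along the segment to the centre of the cube.\<close>
lemma continuous_eq_0_of_fourier:
  fixes f :: "real ^ 'd \<Rightarrow> complex"
  assumes cont: "continuous_on UNIV f" and zero: "\<And>k. (\<integral>x. f x * fourier_fun k x \<partial>torus) = 0"
    and y: "y \<in> space torus"
  shows "f y = 0"
proof -
  define z :: "nat \<Rightarrow> real ^ 'd" where "z = (\<lambda>n. y + inverse (real (Suc n)) *\<^sub>R ((\<chi> i. 1 / 2) - y))"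
  have "z \<longlonglongrightarrow> y + 0 *\<^sub>R ((\<chi> i. 1 / 2) - y)"
    unfolding z_def by (intro tendsto_intros LIMSEQ_inverse_real_of_nat)
  then have "(\<lambda>n. f (z n)) \<longlonglongrightarrow> f y"
    using cont by (intro isCont_tendsto_compose[of _ f]) (simp_all add: continuous_on_eq_continuous_at)
  moreover have "f (z n) = 0" for n
  proof (rule continuous_eq_0_of_fourier_interior[OF cont zero])
    fix i
    define t where "t = inverse (real (Suc n))"
    have t: "0 < t" "t \<le> 1" by (simp_all add: t_def field_simps)
    have yi: "0 \<le> y $ i" "y $ i < 1" using y by (auto simp: space_torus)
    have "z n = y + t *\<^sub>R ((\<chi> i. 1 / 2) - y)" by (simp only: z_def t_def)
    then have "z n $ i = y $ i + t * (1 / 2 - y $ i)" by simp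
    then have zi: "z n $ i = (1 - t) * (y $ i) + t / 2" by (simp add: algebra_simps)
    have "0 \<le> (1 - t) * (y $ i)" "(1 - t) * (y $ i) \<le> (1 - t) * 1"
      using t yi by (intro mult_nonneg_nonneg mult_left_mono; simp)+
    then show "0 < z n $ i \<and> z n $ i < 1" unfolding zi using t by auto
  qed
  ultimately have "(\<lambda>n. 0) \<longlonglongrightarrow> f y" by simp
  then show ?thesis by (simp add: LIMSEQ_const_iff)
qed

section \<open>The worst-case error as a dual norm\<close>

text \<open>The series converges uniformly to a continuous function with the Fourier coefficients of \<open>f\<close>, so
uniqueness identifies it with \<open>f\<close>. Summation follows an arbitrary enumeration \<open>E\<close> of the frequencies.\<close>
lemma fourier_series_sums:
  fixes f :: "real ^ 'd \<Rightarrow> complex"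
  assumes cont: "continuous_on UNIV f" and E: "bij E"
    and sm: "summable (\<lambda>j. cmod (fourier_coeff f (E j)))" and x: "x \<in> space torus"
  shows "(\<lambda>j. fourier_coeff f (E j) * fourier_fun (E j) x) sums f x"
proof -
  define c where "c = (\<lambda>j. fourier_coeff f (E j))"
  define g where "g = (\<lambda>x. \<Sum>j. c j * fourier_fun (E j) x)"
  have ul: "uniform_limit UNIV (\<lambda>n x. \<Sum>j<n. c j * fourier_fun (E j) x) g sequentially"
    unfolding g_def by (rule Weierstrass_m_test[where M="\<lambda>j. cmod (c j)"]) (use sm in \<open>simp_all add: norm_mult cmod_fourier_fun c_def\<close>)
  have gcont: "continuous_on UNIV g"
    by (rule uniform_limit_theorem[OF _ ul])
       (auto intro!: always_eventually continuous_intros continuous_fourier_fun)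
  have "(\<integral>x. g x * fourier_fun k x \<partial>torus) = (\<integral>x. f x * fourier_fun k x \<partial>torus)" for k
  proof -
    obtain j0 where j0: "E j0 = - k" using E by (metis bij_pointE)
    have inj: "E j = - k \<longleftrightarrow> j = j0" for j using E j0 by (metis bij_is_inj injD)
    have sm': "summable (\<lambda>j. c j * fourier_fun (E j) x)" for x
      by (rule summable_norm_cancel) (use sm in \<open>simp add: norm_mult cmod_fourier_fun c_def\<close>)
    have "(\<integral>x. g x * fourier_fun k x \<partial>torus) = (\<integral>x. (\<Sum>j. c j * fourier_fun (E j + k) x) \<partial>torus)"
    proof (intro Bochner_Integration.integral_cong refl)
      fix x
      show "g x * fourier_fun k x = (\<Sum>j. c j * fourier_fun (E j + k) x)"
        unfolding g_def by (subst suminf_mult2[OF sm']) (simp add: fourier_fun_mult mult.assoc)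
    qed
    also have "\<dots> = (\<Sum>j. \<integral>x. c j * fourier_fun (E j + k) x \<partial>torus)"
    proof (rule integral_suminf)
      show "integrable torus (\<lambda>x. c j * fourier_fun (E j + k) x)" for j
        by (intro torus.integrable_bmeas bmeas_intros torus.bmeas_\<eta>)
      show "AE x in torus. summable (\<lambda>j. norm (c j * fourier_fun (E j + k) x))"
        using sm by (simp add: norm_mult cmod_fourier_fun c_def)
      show "summable (\<lambda>j. \<integral>x. norm (c j * fourier_fun (E j + k) x) \<partial>torus)"
        using sm by (simp add: norm_mult cmod_fourier_fun c_def torus.prob_space)
    qed
    also have "\<dots> = (\<Sum>j. if j = j0 then c j else 0)"
      by (intro suminf_cong) (auto simp: integral_fourier_fun j0 inj[symmetric] eq_neg_iff_add_eq_0)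
    also have "\<dots> = c j0" using suminf_finite[of "{j0}" "\<lambda>j. if j = j0 then c j else 0"] by simp
    also have "\<dots> = (\<integral>x. f x * fourier_fun k x \<partial>torus)"
      by (simp add: c_def j0 fourier_coeff_eq)
    finally show ?thesis .
  qed
  then have "(\<integral>x. (f x - g x) * fourier_fun k x \<partial>torus) = 0" for k
    by (simp add: left_diff_distrib torus.integrable_bmeas bmeas_intros torus.bmeas_\<eta>
        bmeas_torus_of_continuous cont gcont)
  then have "f x - g x = 0"
    using cont gcont x by (intro continuous_eq_0_of_fourier[of "\<lambda>x. f x - g x" x] continuous_on_diff)
  moreover have "(\<lambda>j. c j * fourier_fun (E j) x) sums g x"
    unfolding g_def by (rule summable_sums, rule summable_norm_cancel) (use sm in \<open>simp add: norm_mult cmod_fourier_fun c_def\<close>)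
  ultimately show ?thesis by (simp add: c_def)
qed

lemma weight_ge_1: "1 \<le> weight w s k" if "s \<ge> 0"
proof (cases w)
  case Sharp
  then show ?thesis using that by (simp add: ge_one_powr_ge_zero)
qed (simp add: that)

lemma mix_weight_ge_1: "s \<ge> 0 \<Longrightarrow> 1 \<le> mix_weight w s k"
  unfolding mix_weight_def by (intro prod_ge_1 weight_ge_1)

lemma mix_enumeration_bij: "mix_enumeration w s e \<Longrightarrow> bij (\<lambda>j. e (Suc j))"
proof -
  assume "mix_enumeration w s e"
  then have "bij_betw e {1..} UNIV" by (simp add: mix_enumeration_def)
  moreover have "bij_betw Suc UNIV {1..}"
    by (rule bij_betwI[where g="\<lambda>n. n - 1"]) auto
  ultimately show ?thesis using bij_betw_trans[of Suc UNIV "{1..}" e UNIV] by (simp add: comp_def)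
qed

lemma fourier_coeff_trig_poly:
  assumes "finite F"
  shows "fourier_coeff (\<lambda>x. \<Sum>k\<in>F. c k * fourier_fun k x) l = (if l \<in> F then c l else 0)"
proof -
  have "fourier_coeff (\<lambda>x. \<Sum>k\<in>F. c k * fourier_fun k x) l
     = (\<integral>x. (\<Sum>k\<in>F. c k * fourier_fun (k - l) x) \<partial>torus)"
    unfolding fourier_coeff_eq sum_distrib_right mult.assoc fourier_fun_mult by simp
  also have "\<dots> = (\<Sum>k\<in>F. \<integral>x. c k * fourier_fun (k - l) x \<partial>torus)"
    by (intro Bochner_Integration.integral_sum torus.integrable_bmeas bmeas_intros torus.bmeas_\<eta>)
  also have "\<dots> = (\<Sum>k\<in>F. if k = l then c k else 0)"
    by (intro sum.cong refl) (simp add: integral_fourier_fun)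
  also have "\<dots> = (if l \<in> F then c l else 0)" using assms by simp
  finally show ?thesis .
qed

lemma torus_continuous_fourier_fun: "torus_continuous (fourier_fun k)"
  unfolding torus_continuous_def
proof (intro conjI allI)
  show "continuous_on UNIV (fourier_fun k)" by (rule continuous_fourier_fun)
  fix x and l :: "int ^ 'a"
  have "fourier_fun k (x + (\<chi> i. of_int (l $ i)))
      = fourier_fun k x * exp (2 * of_real pi * \<i> * of_int (\<Sum>i\<in>UNIV. k $ i * l $ i))"
    by (simp add: fourier_fun_def algebra_simps sum.distrib flip: exp_add)
  also have "exp (2 * of_real pi * \<i> * of_int (\<Sum>i\<in>UNIV. k $ i * l $ i)) = 1"
  proof -
    define z where "z = (\<Sum>i\<in>UNIV. k $ i * l $ i)"
    show ?thesis
      unfolding z_def[symmetric] using exp_integer_2pi[OF Ints_of_int[of z]] by (simp add: mult_ac)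
  qed
  finally show "fourier_fun k (x + (\<chi> i. of_int (l $ i))) = fourier_fun k x" by simp
qed

lemma trig_poly_mem_Hmix:
  fixes w :: weight_kind and s :: real and c :: "int ^ 'd \<Rightarrow> complex"
  assumes F: "finite F"
  defines "f \<equiv> \<lambda>x. \<Sum>k\<in>F. c k * fourier_fun k x"
  shows "f \<in> Hmix w s"
    and "(Hmix_norm w s f)\<^sup>2 = (\<Sum>k\<in>F. (cmod (c k))\<^sup>2 * (mix_weight w s k)\<^sup>2)"
proof -
  let ?a = "\<lambda>k. (cmod (fourier_coeff f k))\<^sup>2 * (mix_weight w s k)\<^sup>2"
  have fc: "fourier_coeff f k = (if k \<in> F then c k else 0)" for k
    unfolding f_def by (rule fourier_coeff_trig_poly[OF F])
  have "?a summable_on UNIV \<longleftrightarrow> ?a summable_on F"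
    by (intro summable_on_cong_neutral) (auto simp: fc)
  then have sm: "?a summable_on UNIV" using F by simp
  have "infsum ?a UNIV = infsum ?a F" by (intro infsum_cong_neutral) (auto simp: fc)
  also have "\<dots> = (\<Sum>k\<in>F. (cmod (c k))\<^sup>2 * (mix_weight w s k)\<^sup>2)"
    using F by (simp add: fc)
  finally show "(Hmix_norm w s f)\<^sup>2 = (\<Sum>k\<in>F. (cmod (c k))\<^sup>2 * (mix_weight w s k)\<^sup>2)"
    unfolding Hmix_norm_def by (simp add: sum_nonneg)
  have "torus_continuous f"
    unfolding torus_continuous_def f_def
  proof (intro conjI allI)
    show "continuous_on UNIV (\<lambda>x. \<Sum>k\<in>F. c k * fourier_fun k x)"
      by (intro continuous_intros continuous_fourier_fun)
    show "(\<Sum>k\<in>F. c k * fourier_fun k (x + (\<chi> i. of_int (l $ i)))) = (\<Sum>k\<in>F. c k * fourier_fun k x)" for x l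
      using torus_continuous_fourier_fun unfolding torus_continuous_def by metis
  qed
  with sm show "f \<in> Hmix w s" by (simp add: Hmix_def)
qed

text \<open>The error of the rule with weights \<open>q\<close> and nodes \<open>X\<close> for the exponential of frequency \<open>k\<close>.\<close>
definition quad_error :: "nat \<Rightarrow> (nat \<Rightarrow> complex) \<Rightarrow> (nat \<Rightarrow> real ^ 'd) \<Rightarrow> int ^ 'd \<Rightarrow> complex" where
  "quad_error n q X k = of_bool (k = 0) - (\<Sum>j<n. q j * fourier_fun k (X j))"

lemma integral_eq_fourier_coeff_0: "(\<integral>x. f x \<partial>torus) = fourier_coeff f 0"
  by (simp add: fourier_coeff_eq)

lemma cubature_error_sums:
  fixes f :: "real ^ 'd \<Rightarrow> complex"
  assumes cont: "continuous_on UNIV f" and E: "bij E"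
    and sm: "summable (\<lambda>j. cmod (fourier_coeff f (E j)))" and X: "\<And>j. j < n \<Longrightarrow> X j \<in> space torus"
  shows "(\<lambda>j. fourier_coeff f (E j) * quad_error n q X (E j)) sums ((\<integral>x. f x \<partial>torus) - (\<Sum>j<n. q j * f (X j)))"
proof -
  obtain j0 where j0: "E j0 = 0" using E by (metis bij_pointE)
  have inj: "E j = 0 \<longleftrightarrow> j = j0" for j using E j0 by (metis bij_is_inj injD)
  have "(\<lambda>j. if j = j0 then fourier_coeff f (E j) else 0) sums fourier_coeff f (E j0)"
    by (rule sums_single)
  then have "(\<lambda>j. fourier_coeff f (E j) * of_bool (E j = 0)) sums (\<integral>x. f x \<partial>torus)"
    by (simp add: j0 inj integral_eq_fourier_coeff_0 of_bool_def if_distrib cong: if_cong)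
  moreover have "(\<lambda>j. \<Sum>i<n. q i * (fourier_coeff f (E j) * fourier_fun (E j) (X i))) sums (\<Sum>i<n. q i * f (X i))"
    by (intro sums_sum sums_mult fourier_series_sums cont E sm X) auto
  ultimately show ?thesis
    unfolding quad_error_def right_diff_distrib
    by (intro sums_diff) (simp_all add: sum_distrib_left mult_ac)
qed

text \<open>By the Cauchy-Schwarz inequality the worst-case error is at most the norm of the sequence of all
\<open>\<sigma>\<^sub>k quad_error\<^sub>k\<close>. Conversely, every partial sum of its square is attained by a normalized
trigonometric polynomial with coefficients proportional to \<open>\<sigma>\<^sub>k\<^sup>2 cnj (quad_error\<^sub>k)\<close>. The equivalence
replaces a supremum over an uncountable set by countably many conditions, as measurability requires.\<close>
lemma worst_case_error_le_iff:
  fixes e :: "nat \<Rightarrow> int ^ 'd" and m :: nat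
  assumes s: "s \<ge> 0" and e: "mix_enumeration w s e"
    and sm: "summable (\<lambda>j. (sing_num w s e (Suc j))\<^sup>2)"
    and X: "\<And>j. j < n \<Longrightarrow> X j \<in> space torus" and B: "B \<ge> 0"
  defines "d \<equiv> \<lambda>j. quad_error n (Matrix.vec_index (cub_weights e n m X)) X (e (Suc j))"
  shows "worst_case_error w s e n m X \<le> ereal B \<longleftrightarrow>
    (\<forall>N. (\<Sum>j<N. (sing_num w s e (Suc j))\<^sup>2 * (cmod (d j))\<^sup>2) \<le> B\<^sup>2)"
proof -
  define E where "E = (\<lambda>j. e (Suc j))"
  define \<omega> where "\<omega> = (\<lambda>j. mix_weight w s (E j))"
  define q where "q = Matrix.vec_index (cub_weights e n m X)"
  have E: "bij E" unfolding E_def by (rule mix_enumeration_bij[OF e])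
  have \<omega>: "\<omega> j \<ge> 1" for j unfolding \<omega>_def by (rule mix_weight_ge_1[OF s])
  have \<sigma>: "sing_num w s e (Suc j) = 1 / \<omega> j" for j by (simp add: sing_num_def \<omega>_def E_def divide_inverse)
  have d: "d j = quad_error n q X (E j)" for j by (simp add: d_def q_def E_def)
  have cub: "cubature e n m X f = (\<Sum>j<n. q j * f (X j))" for f
    by (simp add: cubature_def q_def)
  show ?thesis
  proof
    assume L: "worst_case_error w s e n m X \<le> ereal B"
    show "\<forall>N. (\<Sum>j<N. (sing_num w s e (Suc j))\<^sup>2 * (cmod (d j))\<^sup>2) \<le> B\<^sup>2"
    proof
      fix N
      define t where "t = (\<Sum>j<N. (sing_num w s e (Suc j))\<^sup>2 * (cmod (d j))\<^sup>2)"
      have t0: "t \<ge> 0" unfolding t_def by (intro sum_nonneg) simp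
      show "t \<le> B\<^sup>2"
      proof (cases "t = 0")
        case False
        then have t: "t > 0" using t0 by simp
        define c where "c = (\<lambda>k. of_real (1 / (sqrt t * (mix_weight w s k)\<^sup>2)) * cnj (quad_error n q X k))"
        define f where "f = (\<lambda>x. \<Sum>k\<in>E ` {..<N}. c k * fourier_fun k x)"
        have injE: "inj_on E A" for A using E by (metis bij_is_inj inj_on_subset subset_UNIV)
        have "(Hmix_norm w s f)\<^sup>2 = (\<Sum>j<N. (cmod (c (E j)))\<^sup>2 * (\<omega> j)\<^sup>2)"
          unfolding f_def by (subst trig_poly_mem_Hmix(2)) (simp_all add: sum.reindex[OF injE] \<omega>_def)
        also have "\<dots> = (\<Sum>j<N. (sing_num w s e (Suc j))\<^sup>2 * (cmod (d j))\<^sup>2 / t)"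
        proof (intro sum.cong refl)
          fix j
          have ce: "cmod (c (E j)) = cmod (d j) / (sqrt t * (\<omega> j)\<^sup>2)"
            using t by (simp add: c_def d \<omega>_def norm_mult norm_divide norm_power)
          show "(cmod (c (E j)))\<^sup>2 * (\<omega> j)\<^sup>2 = (sing_num w s e (Suc j))\<^sup>2 * (cmod (d j))\<^sup>2 / t"
            unfolding ce \<sigma> using t \<omega>[of j]
            by (simp add: power_divide power_mult_distrib less_imp_le) (simp add: field_simps power2_eq_square power4_eq_xxxx)
        qed
        also have "\<dots> = 1" using t by (simp add: t_def flip: sum_divide_distrib)
        finally have "(Hmix_norm w s f)\<^sup>2 \<le> 1\<^sup>2" by simp
        then have n1: "Hmix_norm w s f \<le> 1" by (rule power2_le_imp_le) simp
        have fH: "f \<in> Hmix w s" unfolding f_def by (rule trig_poly_mem_Hmix(1)) simp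
        have fc: "fourier_coeff f (E j) = (if j < N then c (E j) else 0)" for j
          unfolding f_def using injE[of UNIV] by (subst fourier_coeff_trig_poly) (auto simp: inj_on_def)
        have "(\<lambda>j. fourier_coeff f (E j) * quad_error n q X (E j)) sums ((\<integral>x. f x \<partial>torus) - cubature e n m X f)"
          unfolding cub
        proof (rule cubature_error_sums[OF _ E _ X])
          show "continuous_on UNIV f" using fH by (simp add: Hmix_def torus_continuous_def)
          show "summable (\<lambda>j. cmod (fourier_coeff f (E j)))"
            by (rule summable_finite[of "{..<N}"]) (auto simp: fc)
        qed
        moreover have "(\<lambda>j. fourier_coeff f (E j) * quad_error n q X (E j)) sums
            (\<Sum>j<N. fourier_coeff f (E j) * quad_error n q X (E j))"
          by (rule sums_finite) (auto simp: fc)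
        ultimately have "(\<integral>x. f x \<partial>torus) - cubature e n m X f = (\<Sum>j<N. fourier_coeff f (E j) * quad_error n q X (E j))"
          by (rule sums_unique2)
        also have "\<dots> = (\<Sum>j<N. of_real ((sing_num w s e (Suc j))\<^sup>2 * (cmod (d j))\<^sup>2 / sqrt t))"
        proof (intro sum.cong refl)
          fix j assume "j \<in> {..<N}"
          then have "fourier_coeff f (E j) * quad_error n q X (E j)
             = of_real (1 / (sqrt t * (\<omega> j)\<^sup>2)) * (d j * cnj (d j))"
            by (simp add: fc c_def d \<omega>_def)
          also have "\<dots> = of_real (1 / (sqrt t * (\<omega> j)\<^sup>2)) * of_real ((cmod (d j))\<^sup>2)"
            by (simp only: complex_norm_square)
          also have "\<dots> = of_real ((sing_num w s e (Suc j))\<^sup>2 * (cmod (d j))\<^sup>2 / sqrt t)"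
            unfolding of_real_mult[symmetric] by (simp add: \<sigma> power_divide field_simps)
          finally show "fourier_coeff f (E j) * quad_error n q X (E j)
             = of_real ((sing_num w s e (Suc j))\<^sup>2 * (cmod (d j))\<^sup>2 / sqrt t)" .
        qed
        also have "\<dots> = of_real (t / sqrt t)"
          unfolding t_def sum_divide_distrib of_real_sum ..
        finally have "cmod ((\<integral>x. f x \<partial>torus) - cubature e n m X f) = sqrt t"
          using t by (simp add: real_div_sqrt del: of_real_divide)
        moreover have "ereal (cmod ((\<integral>x. f x \<partial>torus) - cubature e n m X f)) \<le> ereal B"
          using L fH n1 unfolding worst_case_error_def SUP_le_iff by blast
        ultimately have "sqrt t \<le> B" by simp
        then show ?thesis using B real_le_rsqrt real_sqrt_le_iff by (metis real_sqrt_le_iff real_sqrt_abs abs_of_nonneg)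
      qed simp
    qed
  next
    assume R: "\<forall>N. (\<Sum>j<N. (sing_num w s e (Suc j))\<^sup>2 * (cmod (d j))\<^sup>2) \<le> B\<^sup>2"
    show "worst_case_error w s e n m X \<le> ereal B"
      unfolding worst_case_error_def
    proof (rule SUP_least)
      fix f :: "real ^ 'd \<Rightarrow> complex" assume "f \<in> {f \<in> Hmix w s. Hmix_norm w s f \<le> 1}"
      then have fH: "f \<in> Hmix w s" and f1: "Hmix_norm w s f \<le> 1" by auto
      let ?a = "\<lambda>k. (cmod (fourier_coeff f k))\<^sup>2 * (mix_weight w s k)\<^sup>2"
      have cont: "continuous_on UNIV f" and sa: "?a summable_on UNIV"
        using fH by (auto simp: Hmix_def torus_continuous_def)
      have inf1: "infsum ?a UNIV \<le> 1"
        using f1 by (simp add: Hmix_norm_def)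
      have a1: "(\<Sum>j<N. (cmod (fourier_coeff f (E j)) * \<omega> j)\<^sup>2) \<le> 1" for N
      proof -
        have "(\<Sum>j<N. (cmod (fourier_coeff f (E j)) * \<omega> j)\<^sup>2) = sum ?a (E ` {..<N})"
          using E by (subst sum.reindex) (auto simp: \<omega>_def power_mult_distrib bij_is_inj intro: inj_on_subset[OF bij_is_inj])
        also have "\<dots> \<le> infsum ?a UNIV"
          by (rule finite_sum_le_infsum[OF sa]) auto
        finally show ?thesis using inf1 by simp
      qed
      have cs: "(\<Sum>j<N. cmod (fourier_coeff f (E j)) * v j)\<^sup>2 \<le> (\<Sum>j<N. (sing_num w s e (Suc j))\<^sup>2 * (v j)\<^sup>2)" for N v
      proof -
        have "(\<Sum>j<N. cmod (fourier_coeff f (E j)) * v j)\<^sup>2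
            = (\<Sum>j<N. (cmod (fourier_coeff f (E j)) * \<omega> j) * (sing_num w s e (Suc j) * v j))\<^sup>2"
        proof -
          have "\<omega> j \<noteq> 0" for j using \<omega>[of j] by linarith
          then show ?thesis by (simp add: \<sigma>)
        qed
        also have "\<dots> \<le> (\<Sum>j<N. (cmod (fourier_coeff f (E j)) * \<omega> j)\<^sup>2) * (\<Sum>j<N. (sing_num w s e (Suc j) * v j)\<^sup>2)"
          by (rule Cauchy_Schwarz_ineq_sum)
        also have "\<dots> \<le> 1 * (\<Sum>j<N. (sing_num w s e (Suc j) * v j)\<^sup>2)"
          by (intro mult_right_mono a1 sum_nonneg) auto
        finally show ?thesis by (simp add: power_mult_distrib)
      qed
      have "summable (\<lambda>j. cmod (fourier_coeff f (E j)))"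
      proof (rule bounded_imp_summable)
        fix N
        have "(\<Sum>j<Suc N. cmod (fourier_coeff f (E j)))\<^sup>2 \<le> (\<Sum>j<Suc N. (sing_num w s e (Suc j))\<^sup>2)"
          using cs[of "\<lambda>_. 1" "Suc N"] by simp
        also have "\<dots> \<le> (\<Sum>j. (sing_num w s e (Suc j))\<^sup>2)"
          by (rule sum_le_suminf[OF sm]) auto
        finally show "(\<Sum>j\<le>N. cmod (fourier_coeff f (E j))) \<le> sqrt (\<Sum>j. (sing_num w s e (Suc j))\<^sup>2)"
          by (intro real_le_rsqrt) (simp add: lessThan_Suc_atMost)
      qed simp
      from cubature_error_sums[OF cont E this X]
      have "(\<lambda>j. fourier_coeff f (E j) * d j) sums ((\<integral>x. f x \<partial>torus) - cubature e n m X f)"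
        by (simp add: d cub)
      then have lim: "(\<lambda>N. cmod (\<Sum>j<N. fourier_coeff f (E j) * d j)) \<longlonglongrightarrow> cmod ((\<integral>x. f x \<partial>torus) - cubature e n m X f)"
        unfolding sums_def by (rule tendsto_norm)
      have "cmod (\<Sum>j<N. fourier_coeff f (E j) * d j) \<le> B" for N
      proof -
        have "cmod (\<Sum>j<N. fourier_coeff f (E j) * d j) \<le> (\<Sum>j<N. cmod (fourier_coeff f (E j)) * cmod (d j))"
          by (intro order_trans[OF norm_sum]) (simp add: norm_mult)
        moreover have "(\<Sum>j<N. cmod (fourier_coeff f (E j)) * cmod (d j))\<^sup>2 \<le> B\<^sup>2"
          by (rule order_trans[OF cs]) (use R in blast)
        then have "(\<Sum>j<N. cmod (fourier_coeff f (E j)) * cmod (d j)) \<le> B"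
          using B by (rule power2_le_imp_le)
        ultimately show ?thesis by linarith
      qed
      then have "cmod ((\<integral>x. f x \<partial>torus) - cubature e n m X f) \<le> B"
        by (intro LIMSEQ_le_const2[OF lim]) auto
      then show "ereal (cmod ((\<integral>x. f x \<partial>torus) - cubature e n m X f)) \<le> ereal B" by simp
    qed
  qed
qed

section \<open>The least-squares weights\<close>

lemma gram_carrier: "L \<in> carrier_mat n r \<Longrightarrow> mat_adjoint L * L \<in> carrier_mat r r"
  by (auto simp: mat_adjoint_def)

lemma gram_index:
  assumes L: "L \<in> carrier_mat n r" and kl: "k < r" "l < r"
  shows "(mat_adjoint L * L) $$ (k, l) = (\<Sum>j<n. cnj (L $$ (j, k)) * L $$ (j, l))"
  using assms by (simp add: mat_adjoint_def scalar_prod_def atLeast0LessThan)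

lemma mult_mat_index:
  assumes "A \<in> carrier_mat n r" "B \<in> carrier_mat r q" "i < n" "j < q"
  shows "(A * B) $$ (i, j) = (\<Sum>k<r. A $$ (i, k) * B $$ (k, j))"
  using assms by (simp add: scalar_prod_def atLeast0LessThan)

lemma mult_vec_index:
  assumes "A \<in> carrier_mat n r" "v \<in> carrier_vec r" "i < n"
  shows "Matrix.vec_index (A *\<^sub>v v) i = (\<Sum>k<r. A $$ (i, k) * Matrix.vec_index v k)"
  using assms by (simp add: scalar_prod_def atLeast0LessThan)

lemma full_column_rank_iff_injective:
  assumes L: "L \<in> carrier_mat n r"
  shows "full_column_rank L \<longleftrightarrow> (\<forall>v\<in>carrier_vec r. L *\<^sub>v v = 0\<^sub>v n \<longrightarrow> v = 0\<^sub>v r)"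
proof -
  interpret vec_space "TYPE(complex)" n .
  have dist_full: "distinct (cols L)" if "rank L = r"
  proof (rule ccontr)
    assume nd: "\<not> distinct (cols L)"
    obtain S where S: "maximal S (\<lambda>T. T \<subseteq> set (cols L) \<and> lin_indpt T)"
      using maximal_exists[of "(\<lambda>T. T \<subseteq> set (cols L) \<and> lin_indpt T)" "card (set (cols L))" "{}"]
      by (meson List.finite_set card_mono empty_iff empty_subsetI finite_lin_indpt2 rev_finite_subset)
    then have "card S \<le> card (set (cols L))" by (simp add: card_mono maximal_def)
    also have "\<dots> < length (cols L)"
      using nd card_length[of "cols L"] card_distinct[of "cols L"] by linarith
    finally show False using rank_card_indpt[OF L S] that L by simp
  qed
  have "rank L = r \<longleftrightarrow> (\<forall>v\<in>carrier_vec r. L *\<^sub>v v = 0\<^sub>v n \<longrightarrow> v = 0\<^sub>v r)"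
  proof
    assume r: "rank L = r"
    show "\<forall>v\<in>carrier_vec r. L *\<^sub>v v = 0\<^sub>v n \<longrightarrow> v = 0\<^sub>v r"
      using lin_depI[OF L _ _ _ dist_full[OF r]] full_rank_lin_indpt[OF L r dist_full[OF r]] by blast
  next
    assume inj: "\<forall>v\<in>carrier_vec r. L *\<^sub>v v = 0\<^sub>v n \<longrightarrow> v = 0\<^sub>v r"
    have d: "distinct (cols L)"
    proof (rule ccontr)
      assume "\<not> distinct (cols L)"
      then obtain i j where ij: "i \<noteq> j" "cols L ! i = cols L ! j" "i < length (cols L)" "j < length (cols L)"
        using distinct_conv_nth by blast
      then have ij': "i < r" "j < r" "col L i = col L j" using L by auto
      define v :: "complex vec" where "v = vec r (\<lambda>k. if k = i then 1 else if k = j then - 1 else 0)"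
      have "L *\<^sub>v v = 0\<^sub>v n"
      proof (rule eq_vecI)
        fix a assume "a < dim_vec (0\<^sub>v n :: complex vec)"
        then have a: "a < n" by simp
        have "L $$ (a, i) = L $$ (a, j)"
          using ij' L a by (metis carrier_matD index_col)
        have "Matrix.vec_index (L *\<^sub>v v) a = (\<Sum>k<r. L $$ (a, k) * (if k = i then 1 else if k = j then - 1 else 0))"
          using mult_vec_index[OF L _ a, of v] by (simp add: v_def)
        also have "\<dots> = (\<Sum>k<r. (if k = i then L $$ (a, k) else 0) - (if k = j then L $$ (a, k) else 0))"
          using ij(1) by (intro sum.cong) auto
        also have "\<dots> = 0" using ij' \<open>L $$ (a, i) = L $$ (a, j)\<close> by (simp add: sum_subtractf)
        finally show "Matrix.vec_index (L *\<^sub>v v) a = Matrix.vec_index (0\<^sub>v n) a" using a by simp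
      qed (use L in simp)
      moreover have "Matrix.vec_index v i \<noteq> Matrix.vec_index (0\<^sub>v r) i" using ij' by (simp add: v_def)
      then have "v \<noteq> 0\<^sub>v r" by metis
      moreover have "v \<in> carrier_vec r" by (simp add: v_def)
      ultimately show False using inj by blast
    qed
    have "lin_indpt (set (cols L))"
      using lin_depE[OF L _ d] inj by metis
    then show "rank L = r" by (rule lin_indpt_full_rank[OF L d])
  qed
  then show ?thesis using L by (simp add: full_column_rank_def)
qed

text \<open>\<open>L\<close> and \<open>L\<^sup>* L\<close> have the same kernel, since \<open>\<parallel>L v\<parallel>\<^sup>2 = \<langle>v, L\<^sup>* L v\<rangle>\<close>.\<close>
lemma full_column_rank_iff_det:
  assumes L: "L \<in> carrier_mat n r"
  shows "full_column_rank L \<longleftrightarrow> det (mat_adjoint L * L) \<noteq> 0"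
proof -
  have A: "mat_adjoint L \<in> carrier_mat r n" using L by (auto simp: mat_adjoint_def)
  have G: "mat_adjoint L * L \<in> carrier_mat r r" by (rule gram_carrier[OF L])
  have "L *\<^sub>v v = 0\<^sub>v n \<longleftrightarrow> (mat_adjoint L * L) *\<^sub>v v = 0\<^sub>v r" if v: "v \<in> carrier_vec r" for v
  proof
    assume "L *\<^sub>v v = 0\<^sub>v n"
    then show "(mat_adjoint L * L) *\<^sub>v v = 0\<^sub>v r"
      using assoc_mult_mat_vec[OF A L v] A by auto
  next
    assume 0: "(mat_adjoint L * L) *\<^sub>v v = 0\<^sub>v r"
    define y where "y = (\<lambda>j. \<Sum>k<r. L $$ (j, k) * Matrix.vec_index v k)"
    have "complex_of_real (\<Sum>j<n. (cmod (y j))\<^sup>2)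
        = (\<Sum>j<n. \<Sum>k<r. \<Sum>l<r. cnj (Matrix.vec_index v k) * (cnj (L $$ (j, k)) * L $$ (j, l) * Matrix.vec_index v l))"
      unfolding y_def
      by (simp add: of_real_cmod_square sum_product) (subst sum.swap, simp add: mult_ac)
    also have "\<dots> = (\<Sum>k<r. cnj (Matrix.vec_index v k) * (\<Sum>l<r. (mat_adjoint L * L) $$ (k, l) * Matrix.vec_index v l))"
      by (subst sum.swap, intro sum.cong refl, subst sum.swap)
         (simp add: gram_index[OF L] sum_distrib_left sum_distrib_right mult.assoc del: index_mult_mat)
    also have "\<dots> = (\<Sum>k<r. cnj (Matrix.vec_index v k) * Matrix.vec_index ((mat_adjoint L * L) *\<^sub>v v) k)"
      by (intro sum.cong refl) (simp add: mult_vec_index[OF G v] del: index_mult_mat index_mult_mat_vec)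
    also have "\<dots> = 0" unfolding 0 by simp
    finally have "(\<Sum>j<n. (cmod (y j))\<^sup>2) = 0" by (simp only: of_real_eq_0_iff)
    then have "y j = 0" if "j < n" for j using that by (simp add: sum_nonneg_eq_0_iff)
    then show "L *\<^sub>v v = 0\<^sub>v n"
      using L mult_vec_index[OF L v] by (intro eq_vecI) (auto simp: y_def simp del: index_mult_mat_vec)
  qed
  then show ?thesis
    unfolding full_column_rank_iff_injective[OF L] det_0_iff_vec_prod_zero_field[OF G] by blast
qed

lemma mat_inverse_eq_cofactor:
  fixes A :: "complex mat"
  assumes A: "A \<in> carrier_mat r r" and det: "det A \<noteq> 0"
  obtains B where "mat_inverse A = Some B" "B \<in> carrier_mat r r" "A * B = 1\<^sub>m r"
    "\<And>i j. i < r \<Longrightarrow> j < r \<Longrightarrow> B $$ (i, j) = cofactor A j i / det A"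
proof -
  have "mat_inverse A \<noteq> None"
    using mat_inverse(1)[OF A, where b="()"] det_non_zero_imp_unit[OF A det, where b="()"] by blast
  then obtain B where B: "mat_inverse A = Some B" by blast
  from mat_inverse(2)[OF A this] have inv: "A * B = 1\<^sub>m r" "B * A = 1\<^sub>m r" and Bc: "B \<in> carrier_mat r r"
    by auto
  note adj = adj_mat[OF A]
  have "adj_mat A = (B * A) * adj_mat A" using adj(1) by (simp add: inv)
  also have "\<dots> = B * (A * adj_mat A)" by (rule assoc_mult_mat[OF Bc A adj(1)])
  also have "\<dots> = det A \<cdot>\<^sub>m B" unfolding adj(2) by (simp add: mult_smult_distrib[OF Bc one_carrier_mat] right_mult_one_mat[OF Bc])
  finally have eq: "adj_mat A = det A \<cdot>\<^sub>m B" .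
  have "B $$ (i, j) = cofactor A j i / det A" if "i < r" "j < r" for i j
  proof -
    have "adj_mat A $$ (i, j) = det A * B $$ (i, j)" unfolding eq using Bc that by simp
    then show ?thesis using A that det by (simp add: adj_mat_def)
  qed
  with B Bc inv(1) show ?thesis by (rule that)
qed

text \<open>The weights by Cramer's rule. Off the event of full column rank the value is the arbitrary one
that division by zero gives, but measurability in \<open>X\<close> holds everywhere.\<close>
definition cofactor_weight :: "(nat \<Rightarrow> int ^ 'd) \<Rightarrow> nat \<Rightarrow> nat \<Rightarrow> (nat \<Rightarrow> real ^ 'd) \<Rightarrow> nat \<Rightarrow> complex" where
  "cofactor_weight e n m X j = (let L = L_mat e n m X; G = mat_adjoint L * L
     in \<Sum>k<m - 1. cnj (L $$ (j, k)) * cnj (cofactor G 0 k / det G))"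

lemma L_mat_carrier: "L_mat e n m X \<in> carrier_mat n (m - 1)"
  by (simp add: L_mat_def)

lemma cub_weights_eq:
  assumes m: "m \<ge> 2" and full: "full_column_rank (L_mat e n m X)" and j: "j < n"
  shows "Matrix.vec_index (cub_weights e n m X) j = cofactor_weight e n m X j"
proof -
  let ?L = "L_mat e n m X"
  let ?G = "mat_adjoint ?L * ?L"
  have det: "det ?G \<noteq> 0" using full full_column_rank_iff_det[OF L_mat_carrier] by blast
  obtain B where B: "mat_inverse ?G = Some B" "B \<in> carrier_mat (m - 1) (m - 1)"
    and Bi: "\<And>i j. i < m - 1 \<Longrightarrow> j < m - 1 \<Longrightarrow> B $$ (i, j) = cofactor ?G j i / det ?G"
    using mat_inverse_eq_cofactor[OF gram_carrier[OF L_mat_carrier] det] by metis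
  have "Matrix.vec_index (cub_weights e n m X) j = (\<Sum>k<m - 1. cnj (?L $$ (j, k)) * cnj (B $$ (k, 0)))"
    unfolding cub_weights_def Let_def B(1) option.sel
    using j m B(2) L_mat_carrier[of e n m X] by (simp add: scalar_prod_def atLeast0LessThan)
  also have "\<dots> = cofactor_weight e n m X j"
    unfolding cofactor_weight_def Let_def
    using m by (intro sum.cong refl) (simp add: Bi)
  finally show ?thesis .
qed

text \<open>The weights are the conjugates of \<open>L g\<close>, where \<open>g\<close> is the first column of the inverse of \<open>L\<^sup>* L\<close>.\<close>
lemma cub_weights_normal_equation:
  assumes m: "m \<ge> 2" and full: "full_column_rank (L_mat e n m X)"
  shows "\<exists>g. (\<forall>j<n. Matrix.vec_index (cub_weights e n m X) j
          = cnj (\<Sum>k<m - 1. fourier_fun (e (k + 1)) (X j) * g k)) \<and>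
      (\<forall>k<m - 1. (\<Sum>j<n. cnj (fourier_fun (e (k + 1)) (X j)) *
          (\<Sum>l<m - 1. fourier_fun (e (l + 1)) (X j) * g l)) = of_bool (k = 0))"
proof -
  let ?L = "L_mat e n m X"
  let ?G = "mat_adjoint ?L * ?L"
  have det: "det ?G \<noteq> 0" using full full_column_rank_iff_det[OF L_mat_carrier] by blast
  obtain B where B: "mat_inverse ?G = Some B" "B \<in> carrier_mat (m - 1) (m - 1)" "?G * B = 1\<^sub>m (m - 1)"
    using mat_inverse_eq_cofactor[OF gram_carrier[OF L_mat_carrier] det] by metis
  have Lj: "?L $$ (j, k) = fourier_fun (e (k + 1)) (X j)" if "j < n" "k < m - 1" for j k
    using that by (simp add: L_mat_def)
  show ?thesis
  proof (intro exI[of _ "\<lambda>k. B $$ (k, 0)"] conjI allI impI)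
    fix j assume j: "j < n"
    have "Matrix.vec_index (cub_weights e n m X) j = (\<Sum>k<m - 1. cnj (?L $$ (j, k)) * cnj (B $$ (k, 0)))"
      unfolding cub_weights_def Let_def B(1) option.sel
      using j m B(2) L_mat_carrier[of e n m X] by (simp add: scalar_prod_def atLeast0LessThan)
    then show "Matrix.vec_index (cub_weights e n m X) j = cnj (\<Sum>k<m - 1. fourier_fun (e (k + 1)) (X j) * B $$ (k, 0))"
      using j by (simp add: Lj)
  next
    fix k assume k: "k < m - 1"
    have "of_bool (k = 0) = (?G * B) $$ (k, 0)" using k by (simp add: B(3))
    also have "\<dots> = (\<Sum>l<m - 1. ?G $$ (k, l) * B $$ (l, 0))"
      by (rule mult_mat_index[OF gram_carrier[OF L_mat_carrier] B(2)]) (use k in auto)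
    also have "\<dots> = (\<Sum>l<m - 1. \<Sum>j<n. cnj (fourier_fun (e (k + 1)) (X j)) * (fourier_fun (e (l + 1)) (X j) * B $$ (l, 0)))"
      using k by (intro sum.cong refl)
        (simp add: gram_index[OF L_mat_carrier] Lj sum_distrib_right mult.assoc del: index_mult_mat)
    also have "\<dots> = (\<Sum>j<n. cnj (fourier_fun (e (k + 1)) (X j)) * (\<Sum>l<m - 1. fourier_fun (e (l + 1)) (X j) * B $$ (l, 0)))"
      by (subst sum.swap) (simp add: sum_distrib_left)
    finally show "(\<Sum>j<n. cnj (fourier_fun (e (k + 1)) (X j)) * (\<Sum>l<m - 1. fourier_fun (e (l + 1)) (X j) * B $$ (l, 0))) = of_bool (k = 0)"
      by simp
  qed
qed

lemma cub_weights_exact: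
  assumes m: "m \<ge> 2" and full: "full_column_rank (L_mat e n m X)" and k: "k < m - 1"
  shows "(\<Sum>j<n. Matrix.vec_index (cub_weights e n m X) j * fourier_fun (e (k + 1)) (X j)) = of_bool (k = 0)"
proof -
  obtain g where g: "\<And>j. j < n \<Longrightarrow> Matrix.vec_index (cub_weights e n m X) j
        = cnj (\<Sum>k<m - 1. fourier_fun (e (k + 1)) (X j) * g k)"
    "\<And>k. k < m - 1 \<Longrightarrow>
        (\<Sum>j<n. cnj (fourier_fun (e (k + 1)) (X j)) * (\<Sum>l<m - 1. fourier_fun (e (l + 1)) (X j) * g l)) = of_bool (k = 0)"
    using cub_weights_normal_equation[OF m full] by blast
  have "(\<Sum>j<n. Matrix.vec_index (cub_weights e n m X) j * fourier_fun (e (k + 1)) (X j))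
     = cnj (\<Sum>j<n. cnj (fourier_fun (e (k + 1)) (X j)) * (\<Sum>l<m - 1. fourier_fun (e (l + 1)) (X j) * g l))"
    unfolding cnj_sum by (intro sum.cong refl) (simp add: g(1) mult.commute)
  then show ?thesis unfolding g(2)[OF k] by simp
qed

text \<open>A lower bound for \<open>\<parallel>L c\<parallel>\<close> excludes a kernel.\<close>
lemma full_column_rank_of_stable:
  assumes stable: "\<And>c. a * (\<Sum>k<m - 1. (cmod (c k))\<^sup>2) \<le> (\<Sum>j<n. (cmod (\<Sum>k<m - 1. fourier_fun (e (k + 1)) (X j) * c k))\<^sup>2)"
    and a: "a > 0"
  shows "full_column_rank (L_mat e n m X)"
  unfolding full_column_rank_iff_injective[OF L_mat_carrier]
proof (intro ballI impI)
  fix v assume v: "v \<in> carrier_vec (m - 1)" and 0: "L_mat e n m X *\<^sub>v v = 0\<^sub>v n"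
  have "(\<Sum>k<m - 1. fourier_fun (e (k + 1)) (X j) * Matrix.vec_index v k) = 0" if j: "j < n" for j
    using mult_vec_index[OF L_mat_carrier v j, of e X] j unfolding 0 by (simp add: L_mat_def)
  then have "a * (\<Sum>k<m - 1. (cmod (Matrix.vec_index v k))\<^sup>2) \<le> 0"
    using stable[of "Matrix.vec_index v"] by simp
  then have "(\<Sum>k<m - 1. (cmod (Matrix.vec_index v k))\<^sup>2) \<le> 0" using a by (simp add: mult_le_0_iff)
  then have "(\<Sum>k<m - 1. (cmod (Matrix.vec_index v k))\<^sup>2) = 0" by (intro antisym sum_nonneg) auto
  then have "Matrix.vec_index v k = 0" if "k < m - 1" for k
    using that by (simp add: sum_nonneg_eq_0_iff)
  then show "v = 0\<^sub>v (m - 1)" using v by (intro eq_vecI) auto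
qed

text \<open>Let \<open>t = \<parallel>q\<parallel>\<^sup>2 = \<parallel>L g\<parallel>\<^sup>2\<close>. The normal equation gives \<open>t = \<bar>g\<^sub>0\<bar>\<close>, and stability gives
\<open>a \<bar>g\<^sub>0\<bar>\<^sup>2 \<le> t\<close>. Hence \<open>a t\<^sup>2 \<le> t\<close>.\<close>
lemma cub_weights_norm_le:
  assumes m: "m \<ge> 2" and a: "a > 0"
    and stable: "\<And>c. a * (\<Sum>k<m - 1. (cmod (c k))\<^sup>2) \<le> (\<Sum>j<n. (cmod (\<Sum>k<m - 1. fourier_fun (e (k + 1)) (X j) * c k))\<^sup>2)"
  shows "(\<Sum>j<n. (cmod (Matrix.vec_index (cub_weights e n m X) j))\<^sup>2) \<le> 1 / a"
proof -
  have full: "full_column_rank (L_mat e n m X)" by (rule full_column_rank_of_stable[OF stable a])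
  obtain g where g: "\<And>j. j < n \<Longrightarrow> Matrix.vec_index (cub_weights e n m X) j
        = cnj (\<Sum>k<m - 1. fourier_fun (e (k + 1)) (X j) * g k)"
    "\<And>k. k < m - 1 \<Longrightarrow>
        (\<Sum>j<n. cnj (fourier_fun (e (k + 1)) (X j)) * (\<Sum>l<m - 1. fourier_fun (e (l + 1)) (X j) * g l)) = of_bool (k = 0)"
    using cub_weights_normal_equation[OF m full] by blast
  define y where "y = (\<lambda>j. \<Sum>k<m - 1. fourier_fun (e (k + 1)) (X j) * g k)"
  define t where "t = (\<Sum>j<n. (cmod (y j))\<^sup>2)"
  have t0: "t \<ge> 0" by (simp add: t_def sum_nonneg)
  have tq: "(\<Sum>j<n. (cmod (Matrix.vec_index (cub_weights e n m X) j))\<^sup>2) = t"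
    unfolding t_def by (intro sum.cong refl) (simp add: g(1) y_def del: cnj_sum complex_cnj_mult)
  have "complex_of_real t = (\<Sum>j<n. cnj (y j) * y j)"
    by (simp add: t_def of_real_cmod_square mult.commute)
  also have "\<dots> = (\<Sum>k<m - 1. cnj (g k) * (\<Sum>j<n. cnj (fourier_fun (e (k + 1)) (X j)) * y j))"
    unfolding y_def cnj_sum sum_distrib_right[of _ _ "\<Sum>k<m - 1. _ k"]
    by (simp add: sum_distrib_left sum_distrib_right) (subst sum.swap, simp add: mult_ac)
  also have "\<dots> = (\<Sum>k<m - 1. if k = 0 then cnj (g k) else 0)"
  proof (intro sum.cong refl)
    fix k assume "k \<in> {..<m - 1}"
    then have "(\<Sum>j<n. cnj (fourier_fun (e (k + 1)) (X j)) * y j) = of_bool (k = 0)"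
      unfolding y_def by (intro g(2)) simp
    then show "cnj (g k) * (\<Sum>j<n. cnj (fourier_fun (e (k + 1)) (X j)) * y j) = (if k = 0 then cnj (g k) else 0)"
      by simp
  qed
  also have "\<dots> = cnj (g 0)" using m by simp
  finally have "t = cmod (g 0)" using t0 by (metis abs_of_nonneg complex_mod_cnj norm_of_real)
  then have "a * t\<^sup>2 \<le> a * (\<Sum>k<m - 1. (cmod (g k))\<^sup>2)"
    using a m member_le_sum[of 0 "{..<m - 1}" "\<lambda>k. (cmod (g k))\<^sup>2"] by (intro mult_left_mono) auto
  also have "\<dots> \<le> t" unfolding t_def y_def by (rule stable)
  finally have "t * (a * t) \<le> t * 1" by (simp add: power2_eq_square mult_ac)
  then have "t \<le> 1 / a" using t0 a by (cases "t = 0") (auto simp: field_simps)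
  then show ?thesis by (simp add: tq)
qed

lemma measurable_det:
  fixes A :: "'a \<Rightarrow> complex mat"
  assumes A: "\<And>x. A x \<in> carrier_mat r r" and m: "\<And>i j. i < r \<Longrightarrow> j < r \<Longrightarrow> (\<lambda>x. A x $$ (i, j)) \<in> borel_measurable M"
  shows "(\<lambda>x. det (A x)) \<in> borel_measurable M"
  unfolding det_def'[OF A]
proof (intro borel_measurable_sum borel_measurable_times borel_measurable_const borel_measurable_prod m)
  fix p i assume "p \<in> {p. p permutes {0..<r}}" "i \<in> {0..<r}"
  then show "i < r" "p i < r" using permutes_in_image[of p "{0..<r}" i] by auto
qed

lemma measurable_cofactor:
  fixes A :: "'a \<Rightarrow> complex mat"
  assumes A: "\<And>x. A x \<in> carrier_mat r r" and m: "\<And>i j. i < r \<Longrightarrow> j < r \<Longrightarrow> (\<lambda>x. A x $$ (i, j)) \<in> borel_measurable M"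
    and ij: "i < r" "j < r"
  shows "(\<lambda>x. cofactor (A x) i j) \<in> borel_measurable M"
proof -
  have "(\<lambda>x. det (mat_delete (A x) i j)) \<in> borel_measurable M"
  proof (rule measurable_det[where r="r - 1"])
    show "mat_delete (A x) i j \<in> carrier_mat (r - 1) (r - 1)" for x
      using A[of x] by (simp add: mat_delete_def)
    fix i' j' assume ij': "i' < r - 1" "j' < r - 1"
    have "mat_delete (A x) i j $$ (i', j') = A x $$ (if i' < i then i' else Suc i', if j' < j then j' else Suc j')" for x
      using A[of x] ij' by (simp add: mat_delete_def)
    then show "(\<lambda>x. mat_delete (A x) i j $$ (i', j')) \<in> borel_measurable M"
      using ij' ij by (simp only:) (intro m; auto)
  qed
  then show ?thesis unfolding cofactor_def by measurable
qed

lemma measurable_L_mat: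
  assumes "j < n" "k < m - 1"
  shows "(\<lambda>X. L_mat e n m X $$ (j, k)) \<in> borel_measurable (random_nodes n)"
proof -
  have "(\<lambda>X. X j) \<in> measurable (random_nodes n) torus"
    unfolding random_nodes_def using assms by simp
  then have "(\<lambda>X. fourier_fun (e (k + 1)) (X j)) \<in> borel_measurable (random_nodes n)"
    by (rule measurable_compose) (rule torus.\<eta>_measurable)
  then show ?thesis using assms by (simp add: L_mat_def)
qed

lemma measurable_gram:
  assumes "k < m - 1" "l < m - 1"
  shows "(\<lambda>X. (mat_adjoint (L_mat e n m X) * L_mat e n m X) $$ (k, l)) \<in> borel_measurable (random_nodes n)"
  unfolding gram_index[OF L_mat_carrier assms]
  by (intro borel_measurable_sum borel_measurable_times measurable_L_mat
      measurable_compose[OF _ borel_measurable_continuous_onI[of cnj]] continuous_intros) (use assms in auto)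

lemma measurable_cofactor_weight:
  assumes "j < n"
  shows "(\<lambda>X. cofactor_weight e n m X j) \<in> borel_measurable (random_nodes n)"
  unfolding cofactor_weight_def Let_def
  by (intro borel_measurable_sum borel_measurable_times borel_measurable_divide measurable_L_mat
      measurable_det[where r="m - 1"] measurable_cofactor[where r="m - 1"] gram_carrier[OF L_mat_carrier] measurable_gram
      measurable_compose[OF _ borel_measurable_continuous_onI[of cnj]] continuous_intros) (use assms in auto)

lemma sets_worst_case_event:
  fixes e :: "nat \<Rightarrow> int ^ 'd"
  assumes s: "s \<ge> 0" and e: "mix_enumeration w s e" and m: "m \<ge> 2"
    and sm: "summable (\<lambda>j. (sing_num w s e (Suc j))\<^sup>2)" and B: "B \<ge> 0"
  shows "{X \<in> space (random_nodes n). full_column_rank (L_mat e n m X) \<and> worst_case_error w s e n m X \<le> ereal B}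
    \<in> sets (random_nodes n)"
proof -
  define D where "D = (\<lambda>X. det (mat_adjoint (L_mat e n m X) * L_mat e n m X))"
  define T where "T = (\<lambda>N X. \<Sum>j<N. (sing_num w s e (Suc j))\<^sup>2 *
      (cmod (quad_error n (cofactor_weight e n m X) X (e (Suc j))))\<^sup>2)"
  have D: "D \<in> borel_measurable (random_nodes n)"
    unfolding D_def by (rule measurable_det[OF gram_carrier[OF L_mat_carrier] measurable_gram])
  have comp: "(\<lambda>X. fourier_fun k (X j)) \<in> borel_measurable (random_nodes n)" if "j < n" for j and k :: "int ^ 'd"
  proof -
    have "(\<lambda>X. X j) \<in> measurable (random_nodes n) torus"
      unfolding random_nodes_def using that by simp
    then show ?thesis by (rule measurable_compose) (rule torus.\<eta>_measurable)
  qed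
  have Q: "(\<lambda>X. quad_error n (cofactor_weight e n m X) X k) \<in> borel_measurable (random_nodes n)" for k
    unfolding quad_error_def
    by (intro borel_measurable_diff borel_measurable_const borel_measurable_sum borel_measurable_times
        measurable_cofactor_weight comp) auto
  have T: "T N \<in> borel_measurable (random_nodes n)" for N
    unfolding T_def using Q by measurable
  have "{X \<in> space (random_nodes n). full_column_rank (L_mat e n m X) \<and> worst_case_error w s e n m X \<le> ereal B}
      = {X \<in> space (random_nodes n). D X \<noteq> 0 \<and> (\<forall>N. T N X \<le> B\<^sup>2)}"
  proof (intro Collect_cong conj_cong refl)
    fix X :: "nat \<Rightarrow> real ^ 'd" assume X: "X \<in> space (random_nodes n)"
    show "full_column_rank (L_mat e n m X) \<longleftrightarrow> D X \<noteq> 0"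
      unfolding D_def by (rule full_column_rank_iff_det[OF L_mat_carrier])
    assume D0: "D X \<noteq> 0"
    have full: "full_column_rank (L_mat e n m X)"
      using D0 unfolding D_def full_column_rank_iff_det[OF L_mat_carrier] .
    have Xj: "X j \<in> space torus" if "j < n" for j
      using X that by (auto simp: random_nodes_def space_PiM)
    have "quad_error n (Matrix.vec_index (cub_weights e n m X)) X k = quad_error n (cofactor_weight e n m X) X k" for k
      unfolding quad_error_def by (simp add: cub_weights_eq[OF m full])
    then show "worst_case_error w s e n m X \<le> ereal B \<longleftrightarrow> (\<forall>N. T N X \<le> B\<^sup>2)"
      using worst_case_error_le_iff[where n=n and X=X and m=m, OF s e sm Xj B] by (simp add: T_def)
  qed
  also have "\<dots> \<in> sets (random_nodes n)"
    using D T by measurable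
  finally show ?thesis .
qed

section \<open>The error bound in terms of singular numbers\<close>

lemma mix_weight_zero: "mix_weight w s 0 = 1"
proof -
  have "weight w s 0 = 1" by (cases w) simp_all
  then show ?thesis by (simp add: mix_weight_def)
qed

lemma mix_weight_gt_1:
  assumes s: "s > 0" and k: "k \<noteq> 0"
  shows "1 < mix_weight w s k"
proof -
  obtain i where i: "k $ i \<noteq> 0" using k by (metis Finite_Cartesian_Product.vec_eq_iff zero_index)
  have "1 < weight w s (k $ i)"
    using i s by (cases w) (auto intro!: gr_one_powr)
  also have "weight w s (k $ i) * 1 \<le> weight w s (k $ i) * (\<Prod>j\<in>UNIV - {i}. weight w s (k $ j))"
    using s weight_ge_1[of s w "k $ i"] by (intro mult_left_mono prod_ge_1 weight_ge_1) auto
  also have "\<dots> = mix_weight w s k" by (simp add: mix_weight_def prod.remove[of UNIV i])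
  finally show ?thesis by simp
qed

text \<open>Frequency zero is the only one of weight one, so it comes first in every admissible order.\<close>
lemma mix_enumeration_first:
  assumes s: "s > 0" and e: "mix_enumeration w s e"
  shows "e (Suc j) = 0 \<longleftrightarrow> j = 0"
proof -
  have bij: "bij (\<lambda>j. e (Suc j))" by (rule mix_enumeration_bij[OF e])
  obtain j0 where j0: "e (Suc j0) = 0" using bij by (metis bij_pointE)
  have "inverse (mix_weight w s (e (Suc j0))) \<le> inverse (mix_weight w s (e (Suc 0)))"
    using e unfolding mix_enumeration_def by simp
  then have "mix_weight w s (e (Suc 0)) \<le> 1"
    by (simp add: j0 mix_weight_zero one_le_inverse_iff)
  then have "e (Suc 0) = 0" using mix_weight_gt_1[OF s] by (metis not_less)
  then show ?thesis using bij by (metis (mono_tags, lifting) bij_is_inj injD)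
qed

lemma sing_num_pos: "s \<ge> 0 \<Longrightarrow> 0 < sing_num w s e j"
  unfolding sing_num_def using mix_weight_ge_1[of s w "e j"] by simp

lemma sing_num_antimono: "mix_enumeration w s e \<Longrightarrow> 1 \<le> i \<Longrightarrow> i \<le> j \<Longrightarrow> sing_num w s e j \<le> sing_num w s e i"
  by (simp add: mix_enumeration_def sing_num_def)

text \<open>Exactness removes the frequencies before \<open>m\<close> from the dual norm. The later ones are nonzero, so their
exponentials have integral zero and the quadrature error is just the quadrature sum.\<close>
lemma worst_case_error_le_tail:
  fixes e :: "nat \<Rightarrow> int ^ 'd"
  assumes s: "s > 0" and e: "mix_enumeration w s e" and m: "m \<ge> 2"
    and sm: "summable (\<lambda>j. (sing_num w s e (Suc j))\<^sup>2)"
    and X: "\<And>j. j < n \<Longrightarrow> X j \<in> space torus" and B: "B \<ge> 0"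
    and full: "full_column_rank (L_mat e n m X)"
    and tail: "\<And>N. (\<Sum>k\<in>{m..<N}. (sing_num w s e k)\<^sup>2 *
        (cmod (\<Sum>j<n. Matrix.vec_index (cub_weights e n m X) j * fourier_fun (e k) (X j)))\<^sup>2) \<le> B\<^sup>2"
  shows "worst_case_error w s e n m X \<le> ereal B"
proof -
  define q where "q = Matrix.vec_index (cub_weights e n m X)"
  have qe: "quad_error n q X (e (Suc j)) = (if j < m - 1 then 0 else - (\<Sum>i<n. q i * fourier_fun (e (Suc j)) (X i)))" for j
    using cub_weights_exact[OF m full, of j] m
    by (auto simp: quad_error_def q_def mix_enumeration_first[OF s e])
  have iff: "worst_case_error w s e n m X \<le> ereal B \<longleftrightarrow>
      (\<forall>N. (\<Sum>j<N. (sing_num w s e (Suc j))\<^sup>2 * (cmod (quad_error n q X (e (Suc j))))\<^sup>2) \<le> B\<^sup>2)"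
    unfolding q_def by (rule worst_case_error_le_iff) (use s e sm X B in auto)
  show ?thesis
    unfolding iff
  proof
    fix N
    have "(\<Sum>j<N. (sing_num w s e (Suc j))\<^sup>2 * (cmod (quad_error n q X (e (Suc j))))\<^sup>2)
        = (\<Sum>j\<in>{m - 1..<N}. (sing_num w s e (Suc j))\<^sup>2 * (cmod (\<Sum>i<n. q i * fourier_fun (e (Suc j)) (X i)))\<^sup>2)"
      by (rule sum.mono_neutral_cong_right) (auto simp: qe)
    also have "\<dots> = (\<Sum>k\<in>{m..<Suc N}. (sing_num w s e k)\<^sup>2 * (cmod (\<Sum>i<n. q i * fourier_fun (e k) (X i)))\<^sup>2)"
      using m sum.shift_bounds_Suc_ivl[of "\<lambda>k. (sing_num w s e k)\<^sup>2 * (cmod (\<Sum>i<n. q i * fourier_fun (e k) (X i)))\<^sup>2" "m - 1" N]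
      by simp
    also have "\<dots> \<le> B\<^sup>2" using tail[of "Suc N"] by (simp only: q_def)
    finally show "(\<Sum>j<N. (sing_num w s e (Suc j))\<^sup>2 * (cmod (quad_error n q X (e (Suc j))))\<^sup>2) \<le> B\<^sup>2" .
  qed
qed

lemma sum_blocks:
  fixes f :: "nat \<Rightarrow> 'a::comm_monoid_add"
  shows "sum f {m..<m + N * b} = (\<Sum>i<N. sum f {m + i * b..<m + Suc i * b})"
proof (induction N)
  case (Suc N)
  have "sum f {m..<m + Suc N * b} = sum f {m..<m + N * b} + sum f {m + N * b..<m + Suc N * b}"
    by (rule sum.atLeastLessThan_concat[symmetric]) auto
  then show ?case using Suc by simp
qed simp

text \<open>The value at the start of a block is at most the mean over the preceding block; only the first block
has no predecessor.\<close>
lemma sum_block_starts_le: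
  fixes f :: "nat \<Rightarrow> real"
  assumes f: "\<And>i j. m \<le> i \<Longrightarrow> i \<le> j \<Longrightarrow> f j \<le> f i" and nn: "\<And>k. 0 \<le> f k"
    and b: "b > 0" and T: "\<And>N. (\<Sum>k\<in>{m..<N}. f k) \<le> T"
  shows "(\<Sum>i<N. f (m + i * b)) \<le> f m + T / real b"
proof -
  have T0: "T \<ge> 0" using T[of m] by simp
  show ?thesis
  proof (cases N)
    case 0
    then show ?thesis using nn[of m] T0 by simp
  next
    case (Suc M)
    have "(\<Sum>i<N. f (m + i * b)) = f m + (\<Sum>i<M. f (m + Suc i * b))"
      unfolding Suc sum.lessThan_Suc_shift by simp
    also have "real b * (\<Sum>i<M. f (m + Suc i * b)) \<le> (\<Sum>i<M. sum f {m + i * b..<m + Suc i * b})"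
      unfolding sum_distrib_left
    proof (rule sum_mono)
      fix i
      have "real b * f (m + Suc i * b) = (\<Sum>k\<in>{m + i * b..<m + Suc i * b}. f (m + Suc i * b))" by simp
      also have "\<dots> \<le> sum f {m + i * b..<m + Suc i * b}" by (intro sum_mono f) auto
      finally show "real b * f (m + Suc i * b) \<le> sum f {m + i * b..<m + Suc i * b}" .
    qed
    then have "(\<Sum>i<M. f (m + Suc i * b)) \<le> T / real b"
      using T[of "m + M * b"] b unfolding sum_blocks[symmetric] by (simp add: field_simps)
    finally show ?thesis by simp
  qed
qed

text \<open>All that the definition of \<open>num_freq\<close> contributes. The condition \<open>num_freq n \<delta> \<ge> 2\<close> forces
\<open>n \<ge> 48 x\<close> with \<open>x \<ge> 4\<close>, and \<open>exp (- x) \<le> \<delta> / (2 n)\<close>.\<close>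
lemma num_freq_bounds:
  assumes \<delta>: "0 < \<delta>" "\<delta> < 1 / 3" and m: "num_freq n \<delta> \<ge> 2"
  defines "x \<equiv> sqrt 2 * ln (2 * real n) - ln \<delta>"
  shows "48 * x * real (num_freq n \<delta> - 1) \<le> real n" "4 \<le> x" "real (num_freq n \<delta> - 1) * exp (- x) \<le> \<delta>"
    and "2 * ln (8 * real n) \<le> real n" "n \<ge> 192" "real n \<le> 48 * x * real (num_freq n \<delta>)"
proof -
  let ?t = "real n / (48 * x)"
  have t1: "\<lfloor>?t\<rfloor> \<ge> 1" and mt: "num_freq n \<delta> - 1 = nat \<lfloor>?t\<rfloor>"
    using m unfolding num_freq_def x_def by linarith+
  have n0: "n \<ge> 1"
  proof (rule ccontr)
    assume "\<not> n \<ge> 1"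
    then have "?t = 0" by simp
    then have "\<lfloor>?t\<rfloor> = 0" by (simp only: floor_zero)
    then show False using t1 by linarith
  qed
  have "1 \<le> ln (3::real)" using exp_le by (subst ln_ge_iff) auto
  also have "\<dots> \<le> ln (1 / \<delta>)" using \<delta> by (subst ln_le_cancel_iff) (auto simp: field_simps)
  finally have l1: "1 \<le> - ln \<delta>" using \<delta> by (simp add: ln_div)
  have l2: "ln (2 * real n) > 0" using n0 by simp
  have s2: "1 \<le> sqrt (2::real)" by simp
  have xl: "ln (2 * real n) + (- ln \<delta>) \<le> x"
    unfolding x_def using mult_right_mono[OF s2 less_imp_le[OF l2]] by simp
  then have x0: "x > 1" using l1 l2 by linarith
  have "1 \<le> ?t" using t1 by linarith
  then have nx: "48 * x \<le> real n" using x0 by (simp add: field_simps)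
  then have n48: "48 \<le> real n" using x0 by linarith
  have "exp (3::real) \<le> 27"
  proof -
    have "exp (3::real) = exp 1 ^ 3" by (simp flip: exp_of_nat_mult)
    also have "\<dots> \<le> 3 ^ 3" using exp_le by (intro power_mono) auto
    finally show ?thesis by simp
  qed
  then have "3 \<le> ln (2 * real n)" using n48 by (subst ln_ge_iff) auto
  then show x4: "4 \<le> x" using xl l1 by linarith
  then have "192 \<le> real n" using nx by linarith
  then show "n \<ge> 192" by simp
  have fl: "real (num_freq n \<delta> - 1) \<le> ?t" unfolding mt using t1 by linarith
  then show *: "48 * x * real (num_freq n \<delta> - 1) \<le> real n" using x0 by (simp add: field_simps)
  have "?t < real (num_freq n \<delta>)"
    using mt t1 m by linarith
  then show "real n \<le> 48 * x * real (num_freq n \<delta>)" using x0 by (simp add: field_simps)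
  have "1 * real (num_freq n \<delta> - 1) \<le> 48 * x * real (num_freq n \<delta> - 1)"
    using x0 by (intro mult_right_mono) auto
  then have mn: "real (num_freq n \<delta> - 1) \<le> real n" using * by linarith
  have "exp (- x) \<le> exp (- (ln (2 * real n)) + ln \<delta>)" using xl by simp
  also have "\<dots> = \<delta> / (2 * real n)"
  proof -
    have "exp (ln (2 * real n)) = 2 * real n" using n0 by (intro exp_ln) simp
    then show ?thesis unfolding exp_add exp_minus exp_ln[OF \<delta>(1)] by (simp only: divide_inverse mult.commute)
  qed
  finally have "real (num_freq n \<delta> - 1) * exp (- x) \<le> real n * (\<delta> / (2 * real n))"
    using mn by (intro mult_mono) auto
  also have "\<dots> \<le> \<delta>" using \<delta> n0 by simp
  finally show "real (num_freq n \<delta> - 1) * exp (- x) \<le> \<delta>" .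
  have "ln (8 * real n) = ln 4 + ln (2 * real n)" using ln_mult[of 4 "2 * real n"] n0 by simp
  moreover have "ln (4::real) \<le> 3" using ln_le_minus_one[of 4] by simp
  ultimately show "2 * ln (8 * real n) \<le> real n" using nx xl l1 \<open>3 \<le> ln (2 * real n)\<close> by linarith
qed

text \<open>Gram matrix concentration for the first \<open>m - 1\<close> frequencies, transported from sets of frequencies to
their positions in the enumeration.\<close>
lemma stable_nodes_event:
  fixes e :: "nat \<Rightarrow> int ^ 'd"
  assumes \<delta>: "0 < \<delta>" "\<delta> < 1 / 3" and m: "num_freq n \<delta> \<ge> 2" and e: "mix_enumeration w s e"
  obtains U where "U \<in> sets (random_nodes n)" "measure (random_nodes n) U \<le> \<delta>"
    "\<And>X. X \<in> space (random_nodes n) - U \<Longrightarrow> full_column_rank (L_mat e n (num_freq n \<delta>) X) \<and>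
        (\<Sum>j<n. (cmod (Matrix.vec_index (cub_weights e n (num_freq n \<delta>) X) j))\<^sup>2) \<le> 2 / real n"
proof -
  define r where "r = num_freq n \<delta> - 1"
  define x where "x = sqrt 2 * ln (2 * real n) - ln \<delta>"
  note nb = num_freq_bounds[OF \<delta> m, folded x_def r_def]
  define h where "h = (\<lambda>k. e (k + 1))"
  have h: "inj_on h A" for A
    using mix_enumeration_bij[OF e] by (auto simp: h_def inj_on_def dest: bij_is_inj injD)
  define S where "S = h ` {..<r}"
  define p where "p = nat \<lceil>x\<rceil>"
  define U where "U = {X \<in> space (random_nodes n). (1 / 2) ^ (2 * p) \<le> torus.trace_pow S n p X}"
  have card: "card S = r" by (simp add: S_def card_image[OF h])
  have fin: "finite S" by (simp add: S_def)
  have n0: "n > 0" using nb(5) by simp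
  have r0: "r > 0" using m by (simp add: r_def)
  have p0: "p > 0" using nb(2) by (simp add: p_def)
  show ?thesis
  proof (rule that[of U])
    have "torus.trace_pow S n p \<in> borel_measurable (random_nodes n)"
      unfolding random_nodes_def by (rule borel_measurable_integrable[OF torus.integrable_trace_pow])
    then show "U \<in> sets (random_nodes n)" unfolding U_def by measurable
    have "measure (random_nodes n) U \<le> real (card S) * exp (- x)"
      unfolding U_def random_nodes_def p_def
      using nb(1,2) r0 card by (intro torus.gram_concentration fin) (auto simp: mult_ac)
    then show "measure (random_nodes n) U \<le> \<delta>" using nb(3) by (simp add: card)
  next
    fix X assume X: "X \<in> space (random_nodes n) - U"
    then have tr: "Re (ktr S (kpow S (torus.gram_dev S n X) (2 * p))) \<le> (1 / 2) ^ (2 * p)"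
      by (auto simp: U_def torus.trace_pow_def)
    have stable: "real n / 2 * (\<Sum>k<num_freq n \<delta> - 1. (cmod (c k))\<^sup>2)
        \<le> (\<Sum>j<n. (cmod (\<Sum>k<num_freq n \<delta> - 1. fourier_fun (e (k + 1)) (X j) * c k))\<^sup>2)" for c
    proof -
      define c' where "c' = (\<lambda>f. c (the_inv_into UNIV h f))"
      have c': "c' (h k) = c k" for k by (simp add: c'_def the_inv_into_f_f[OF h])
      have "real n * (1 - 1 / 2) * (\<Sum>f\<in>S. (cmod (c' f))\<^sup>2) \<le> (\<Sum>j<n. (cmod (\<Sum>f\<in>S. fourier_fun f (X j) * c' f))\<^sup>2)"
        by (rule torus.synthesis_norm_bounds(1)[OF fin n0 p0 _ tr]) simp
      then show ?thesis
        unfolding r_def[symmetric] by (simp add: S_def sum.reindex[OF h] c') (simp add: h_def)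
    qed
    have "real n / 2 > 0" using n0 by simp
    from full_column_rank_of_stable[OF stable this] cub_weights_norm_le[OF m this stable]
    show "full_column_rank (L_mat e n (num_freq n \<delta>) X) \<and>
        (\<Sum>j<n. (cmod (Matrix.vec_index (cub_weights e n (num_freq n \<delta>) X) j))\<^sup>2) \<le> 2 / real n"
      by simp
  qed
qed

lemma prob_space_random_nodes: "prob_space (random_nodes n)"
  unfolding random_nodes_def by (rule torus.prob_space_nodes)

lemma sum_le_suminf_tail:
  fixes f :: "nat \<Rightarrow> real"
  assumes "summable (\<lambda>j. f (Suc j))" and nn: "\<And>k. 0 \<le> f k"
  shows "(\<Sum>k\<in>{m..<N}. f k) \<le> (\<Sum>k. f (k + m))"
proof -
  have sf: "summable (\<lambda>k. f (k + m))"
    using assms(1) by (simp only: summable_Suc_iff summable_iff_shift)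
  have "(\<Sum>k\<in>{m..<N}. f k) = (\<Sum>k<N - m. f (k + m))"
  proof (cases "m \<le> N")
    case True
    then show ?thesis using sum.shift_bounds_nat_ivl[of f 0 m "N - m"] by (simp add: atLeast0LessThan)
  qed simp
  also have "\<dots> \<le> (\<Sum>k. f (k + m))" by (rule sum_le_suminf[OF sf]) (use nn in auto)
  finally show ?thesis .
qed

text \<open>Outside of two exceptional events \<open>U\<close> and \<open>V\<close>, the stability event and the block estimate combine to
the bound \<open>2 K = (29 / \<delta>) M\<^sup>2\<close> for the squared error.\<close>
theorem cubature_error_probability:
  fixes e :: "nat \<Rightarrow> int ^ 'd" and n :: nat
  assumes s: "s > 0" and e: "mix_enumeration w s e"
    and sm: "summable (\<lambda>j. (sing_num w s e (Suc j))\<^sup>2)"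
    and \<delta>: "0 < \<delta>" "\<delta> < 1 / 3" and m2: "num_freq n \<delta> \<ge> 2"
  defines "m \<equiv> num_freq n \<delta>"
  defines "M \<equiv> max (sing_num w s e m) (sqrt (ln (8 * real n) / real n * (\<Sum>k. (sing_num w s e (k + m))\<^sup>2)))"
  shows "measure (random_nodes n) {X \<in> space (random_nodes n).
      full_column_rank (L_mat e n m X) \<and> worst_case_error w s e n m X \<le> ereal (sqrt (29 / \<delta>) * M)} \<ge> 1 - 3 * \<delta>"
proof -
  interpret N: prob_space "random_nodes n :: (nat \<Rightarrow> real ^ 'd) measure" by (rule prob_space_random_nodes)
  define \<sigma> where "\<sigma> = (\<lambda>k. (sing_num w s e k)\<^sup>2)"
  define T where "T = (\<Sum>k. \<sigma> (k + m))"
  define L where "L = ln (8 * real n)"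
  define b where "b = nat \<lfloor>real n / L\<rfloor>"
  \<comment> \<open>the level for which the squared error bound \<open>2 * K\<close> is the claimed one\<close>
  define K where "K = 29 / (2 * \<delta>) * M\<^sup>2"
  define S where "S = (\<lambda>i. e ` {m + i * b..<m + Suc i * b})"
  define q where "q = (\<lambda>X. Matrix.vec_index (cub_weights e n m X))"
  note nb = num_freq_bounds[OF \<delta> m2]
  have m: "m \<ge> 2" using m2 by (simp add: m_def)
  have n2: "n \<ge> 2" using nb(5) by simp
  have L0: "L > 0" using n2 by (simp add: L_def)
  have nL: "2 \<le> real n / L" using nb(4) L0 by (simp add: L_def field_simps)
  have b: "real b \<le> real n / L" "real n / L - 1 \<le> real b" "b > 0"
    using nL unfolding b_def by linarith+
  have bL: "real b * L \<le> real n" using b(1) L0 by (simp add: field_simps)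
  have binv: "1 / real b \<le> 2 * (L / real n)"
  proof -
    have "u \<le> 2 * real b" if "u - 1 \<le> real b" "2 \<le> u" for u
      using that by linarith
    from this[OF b(2) nL] have "real n \<le> 2 * L * real b" using L0 by (simp add: field_simps)
    then show ?thesis using b(3) n2 by (simp add: field_simps)
  qed
  have \<sigma>0: "0 \<le> \<sigma> k" for k by (simp add: \<sigma>_def)
  have \<sigma>mono: "\<sigma> j \<le> \<sigma> i" if "m \<le> i" "i \<le> j" for i j
    unfolding \<sigma>_def using that m sing_num_antimono[OF e, of i j] sing_num_pos[of s w e j] s
    by (intro power_mono) auto
  have tail: "(\<Sum>k\<in>{m..<N}. \<sigma> k) \<le> T" for N
    unfolding T_def by (rule sum_le_suminf_tail) (use sm \<sigma>0 in \<open>simp_all add: \<sigma>_def\<close>)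
  then have T0: "T \<ge> 0" using tail[of m] by simp
  have M0: "M > 0" using sing_num_pos[of s w e m] s by (simp add: M_def less_max_iff_disj)
  have Mm: "\<sigma> m \<le> M\<^sup>2"
    unfolding \<sigma>_def using sing_num_pos[of s w e m] s by (intro power_mono) (auto simp: M_def)
  have MT: "L / real n * T \<le> M\<^sup>2"
  proof -
    have "sqrt (L / real n * T) \<le> M" unfolding M_def T_def \<sigma>_def L_def by simp
    then have "(sqrt (L / real n * T))\<^sup>2 \<le> M\<^sup>2" using L0 T0 by (intro power_mono) auto
    then show ?thesis using L0 T0 by simp
  qed
  have K0: "K > 0" using M0 \<delta> by (simp add: K_def)
  \<comment> \<open>one \<open>M\<^sup>2\<close> from \<open>\<sigma> m\<close>, two from the tail since rounding \<open>b\<close> loses at most a factor 2\<close>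
  have A: "(\<Sum>i<N. \<sigma> (m + i * b)) \<le> 3 * M\<^sup>2" for N
  proof -
    have "(\<Sum>i<N. \<sigma> (m + i * b)) \<le> \<sigma> m + T / real b"
      by (rule sum_block_starts_le[OF \<sigma>mono \<sigma>0 b(3) tail])
    also have "T / real b \<le> 2 * (L / real n) * T"
      using mult_right_mono[OF binv T0] by simp
    also have "\<sigma> m + 2 * (L / real n) * T \<le> 3 * M\<^sup>2" using Mm MT by simp
    finally show ?thesis by simp
  qed
  have inj: "inj_on e A" if "A \<subseteq> {1..}" for A
    using e that unfolding mix_enumeration_def bij_betw_def by (auto intro: inj_on_subset)
  have cardS: "card (S i) = b" for i
    unfolding S_def by (subst card_image[OF inj]) (use m in auto)
  have finS: "finite (S i)" for i by (simp add: S_def)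
  have wb: "real (card (S i)) * ln (8 * real n) \<le> real n" for i
    using bL by (simp add: cardS L_def)
  define V where "V = {X \<in> space (random_nodes n). \<exists>N. K \<le> (\<Sum>i<N. \<sigma> (m + i * b) * torus.gram_bound (S i) n X)}"
  have V: "measure (random_nodes n) V \<le> 9 * (3 * M\<^sup>2) / K" "V \<in> sets (random_nodes n)"
    unfolding V_def random_nodes_def
    using torus.weighted_gram_bound_tail[where S=S and a="\<lambda>i. \<sigma> (m + i * b)", OF finS n2 wb \<sigma>0 A K0]
    by simp_all
  have "9 * (3 * M\<^sup>2) / K = 54 / 29 * \<delta>" using M0 \<delta> by (simp add: K_def field_simps)
  then have V2: "measure (random_nodes n) V \<le> 2 * \<delta>" using V(1) \<delta> by simp
  obtain U where U: "U \<in> sets (random_nodes n)" "measure (random_nodes n) U \<le> \<delta>"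
    and good: "\<And>X. X \<in> space (random_nodes n) - U \<Longrightarrow> full_column_rank (L_mat e n m X) \<and>
        (\<Sum>j<n. (cmod (q X j))\<^sup>2) \<le> 2 / real n"
    using stable_nodes_event[OF \<delta> m2 e] unfolding m_def q_def by metis
  let ?E = "{X \<in> space (random_nodes n).
      full_column_rank (L_mat e n m X) \<and> worst_case_error w s e n m X \<le> ereal (sqrt (29 / \<delta>) * M)}"
  have "space (random_nodes n) - (U \<union> V) \<subseteq> ?E"
  proof
    fix X assume X: "X \<in> space (random_nodes n) - (U \<union> V)"
    then have full: "full_column_rank (L_mat e n m X)" and qn: "(\<Sum>j<n. (cmod (q X j))\<^sup>2) \<le> 2 / real n"
      using good by auto
    have Vs: "(\<Sum>i<N. \<sigma> (m + i * b) * torus.gram_bound (S i) n X) \<le> K" for N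
      using X by (auto simp: V_def intro: less_imp_le simp: not_le)
    have Xj: "X j \<in> space torus" if "j < n" for j
      using X that by (auto simp: random_nodes_def space_PiM)
    have "worst_case_error w s e n m X \<le> ereal (sqrt (29 / \<delta>) * M)"
    proof (rule worst_case_error_le_tail[OF s e m sm])
      show "X j \<in> space torus" if "j < n" for j by (rule Xj[OF that])
      show "full_column_rank (L_mat e n m X)" by (rule full)
      show "0 \<le> sqrt (29 / \<delta>) * M" using M0 \<delta> by simp
      fix N
      define g where "g = (\<lambda>k. (cmod (\<Sum>j<n. q X j * fourier_fun (e k) (X j)))\<^sup>2)"
      have g0: "0 \<le> g k" for k by (simp add: g_def)
      have "N \<le> m + N * b" using b(3) by (simp add: trans_le_add2)
      then have "(\<Sum>k\<in>{m..<N}. \<sigma> k * g k) \<le> (\<Sum>k\<in>{m..<m + N * b}. \<sigma> k * g k)"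
        by (intro sum_mono2) (auto intro: mult_nonneg_nonneg \<sigma>0 g0)
      also have "\<dots> = (\<Sum>i<N. \<Sum>k\<in>{m + i * b..<m + Suc i * b}. \<sigma> k * g k)" by (rule sum_blocks)
      also have "\<dots> \<le> (\<Sum>i<N. \<sigma> (m + i * b) * (2 * torus.gram_bound (S i) n X))"
      proof (rule sum_mono)
        fix i
        have "(\<Sum>k\<in>{m + i * b..<m + Suc i * b}. \<sigma> k * g k) \<le> (\<Sum>k\<in>{m + i * b..<m + Suc i * b}. \<sigma> (m + i * b) * g k)"
          by (intro sum_mono mult_right_mono \<sigma>mono g0) auto
        also have "\<dots> = \<sigma> (m + i * b) * (\<Sum>f\<in>S i. (cmod (\<Sum>j<n. q X j * fourier_fun f (X j)))\<^sup>2)"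
          unfolding S_def by (subst sum.reindex[OF inj]) (use m in \<open>auto simp: g_def sum_distrib_left\<close>)
        also have "\<dots> \<le> \<sigma> (m + i * b) * (real n * torus.gram_bound (S i) n X * (2 / real n))"
          by (intro mult_left_mono \<sigma>0 order_trans[OF torus.analysis_norm_le_gram_bound[OF finS n2]] qn
              mult_nonneg_nonneg torus.gram_bound_nonneg finS) auto
        finally show "(\<Sum>k\<in>{m + i * b..<m + Suc i * b}. \<sigma> k * g k) \<le> \<sigma> (m + i * b) * (2 * torus.gram_bound (S i) n X)"
          using n2 by (simp add: mult_ac)
      qed
      also have "\<dots> = 2 * (\<Sum>i<N. \<sigma> (m + i * b) * torus.gram_bound (S i) n X)"
        by (simp add: sum_distrib_left mult_ac)
      also have "\<dots> \<le> 2 * K" using Vs[of N] by simp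
      also have "\<dots> = (sqrt (29 / \<delta>) * M)\<^sup>2"
        using \<delta> by (simp add: K_def power_mult_distrib)
      finally show "(\<Sum>k\<in>{m..<N}. (sing_num w s e k)\<^sup>2 *
          (cmod (\<Sum>j<n. Matrix.vec_index (cub_weights e n m X) j * fourier_fun (e k) (X j)))\<^sup>2) \<le> (sqrt (29 / \<delta>) * M)\<^sup>2"
        by (simp add: \<sigma>_def g_def q_def)
    qed
    then show "X \<in> ?E" using X full by simp
  qed
  moreover have "?E \<in> sets (random_nodes n)"
    by (rule sets_worst_case_event) (use s e m sm M0 \<delta> in auto)
  ultimately have "measure (random_nodes n) (space (random_nodes n) - (U \<union> V)) \<le> measure (random_nodes n) ?E"
    by (rule N.finite_measure_mono)
  moreover have "measure (random_nodes n) (space (random_nodes n) - (U \<union> V)) = 1 - measure (random_nodes n) (U \<union> V)"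
    using U V by (intro N.prob_compl) auto
  moreover have "measure (random_nodes n) (U \<union> V) \<le> measure (random_nodes n) U + measure (random_nodes n) V"
    using U V by (intro measure_subadditive) auto
  ultimately show ?thesis using U(2) V2 by linarith
qed

text \<open>On the stability event alone, \<open>\<bar>\<Sum>\<^sub>j q\<^sub>j \<eta>\<^sub>k(x\<^sub>j)\<bar>\<^sup>2 \<le> n \<parallel>q\<parallel>\<^sup>2 \<le> 2\<close> for every \<open>k\<close>.\<close>
theorem cubature_error_probability_crude:
  fixes e :: "nat \<Rightarrow> int ^ 'd" and n :: nat
  assumes s: "s > 0" and e: "mix_enumeration w s e"
    and sm: "summable (\<lambda>j. (sing_num w s e (Suc j))\<^sup>2)"
    and \<delta>: "0 < \<delta>" "\<delta> < 1 / 3" and m2: "num_freq n \<delta> \<ge> 2"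
    and B: "B \<ge> 0" "2 * (\<Sum>j. (sing_num w s e (Suc j))\<^sup>2) \<le> B\<^sup>2"
  defines "m \<equiv> num_freq n \<delta>"
  shows "measure (random_nodes n) {X \<in> space (random_nodes n).
      full_column_rank (L_mat e n m X) \<and> worst_case_error w s e n m X \<le> ereal B} \<ge> 1 - \<delta>"
proof -
  interpret N: prob_space "random_nodes n :: (nat \<Rightarrow> real ^ 'd) measure" by (rule prob_space_random_nodes)
  define q where "q = (\<lambda>X. Matrix.vec_index (cub_weights e n m X))"
  have m: "m \<ge> 2" using m2 by (simp add: m_def)
  have n0: "n > 0" using num_freq_bounds(5)[OF \<delta> m2] by simp
  obtain U where U: "U \<in> sets (random_nodes n)" "measure (random_nodes n) U \<le> \<delta>"
    and good: "\<And>X. X \<in> space (random_nodes n) - U \<Longrightarrow> full_column_rank (L_mat e n m X) \<and>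
        (\<Sum>j<n. (cmod (q X j))\<^sup>2) \<le> 2 / real n"
    using stable_nodes_event[OF \<delta> m2 e] unfolding m_def q_def by metis
  let ?E = "{X \<in> space (random_nodes n).
      full_column_rank (L_mat e n m X) \<and> worst_case_error w s e n m X \<le> ereal B}"
  have "space (random_nodes n) - U \<subseteq> ?E"
  proof
    fix X assume X: "X \<in> space (random_nodes n) - U"
    then have full: "full_column_rank (L_mat e n m X)" and qn: "(\<Sum>j<n. (cmod (q X j))\<^sup>2) \<le> 2 / real n"
      using good by auto
    have Xj: "X j \<in> space torus" if "j < n" for j
      using X that by (auto simp: random_nodes_def space_PiM)
    have "worst_case_error w s e n m X \<le> ereal B"
    proof (rule worst_case_error_le_tail[OF s e m sm])
      show "X j \<in> space torus" if "j < n" for j by (rule Xj[OF that])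
      show "full_column_rank (L_mat e n m X)" by (rule full)
      show "0 \<le> B" by (rule B(1))
      fix N
      have "(cmod (\<Sum>j<n. q X j * fourier_fun (e k) (X j)))\<^sup>2 \<le> 2" for k
      proof -
        have "(cmod (\<Sum>j<n. q X j * fourier_fun (e k) (X j)))\<^sup>2
            \<le> (\<Sum>j<n. (cmod (q X j))\<^sup>2) * (\<Sum>j<n. (cmod (fourier_fun (e k) (X j)))\<^sup>2)"
          by (rule Cauchy_Schwarz_sum_complex)
        also have "\<dots> \<le> 2 / real n * real n"
          using mult_right_mono[OF qn, of "real n"] by (simp add: cmod_fourier_fun)
        finally show ?thesis using n0 by simp
      qed
      then have "(\<Sum>k\<in>{m..<N}. (sing_num w s e k)\<^sup>2 * (cmod (\<Sum>j<n. q X j * fourier_fun (e k) (X j)))\<^sup>2)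
          \<le> (\<Sum>k\<in>{m..<N}. (sing_num w s e k)\<^sup>2 * 2)"
        by (intro sum_mono mult_left_mono) auto
      also have "\<dots> = 2 * (\<Sum>k\<in>{m..<N}. (sing_num w s e k)\<^sup>2)" by (simp add: sum_distrib_left mult.commute)
      also have "(\<Sum>k\<in>{m..<N}. (sing_num w s e k)\<^sup>2) \<le> (\<Sum>k\<in>{1..<N}. (sing_num w s e k)\<^sup>2)"
        using m by (intro sum_mono2) auto
      also have "\<dots> \<le> (\<Sum>j. (sing_num w s e (j + 1))\<^sup>2)"
        by (rule sum_le_suminf_tail[OF sm]) simp
      finally show "(\<Sum>k\<in>{m..<N}. (sing_num w s e k)\<^sup>2 *
          (cmod (\<Sum>j<n. Matrix.vec_index (cub_weights e n m X) j * fourier_fun (e k) (X j)))\<^sup>2) \<le> B\<^sup>2"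
        using B(2) by (simp add: q_def)
    qed
    then show "X \<in> ?E" using X full by simp
  qed
  moreover have "?E \<in> sets (random_nodes n)"
    by (rule sets_worst_case_event) (use s e m sm B in auto)
  ultimately have "measure (random_nodes n) (space (random_nodes n) - U) \<le> measure (random_nodes n) ?E"
    by (rule N.finite_measure_mono)
  then show ?thesis using U N.prob_compl[OF U(1)] by linarith
qed

section \<open>Decay of the singular numbers\<close>

lemma harm_le_ln: "n \<ge> 1 \<Longrightarrow> harm n \<le> 1 + ln (real n)"
proof (induction n rule: nat_induct_at_least)
  case base
  show ?case by (simp add: harm_def)
next
  case (Suc n)
  have "ln (real n / real (Suc n)) \<le> real n / real (Suc n) - 1"
    using Suc by (intro ln_le_minus_one) simp
  then have "inverse (real (Suc n)) \<le> ln (real (Suc n)) - ln (real n)"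
    using Suc by (simp add: ln_div field_simps)
  then show ?case using Suc by (simp add: harm_Suc)
qed

lemma int_ball_eq: "{z::int. 1 + real_of_int \<bar>z\<bar> \<le> y} = {- (\<lfloor>y\<rfloor> - 1)..\<lfloor>y\<rfloor> - 1}"
proof -
  have "1 + real_of_int \<bar>z\<bar> \<le> y \<longleftrightarrow> 1 + \<bar>z\<bar> \<le> \<lfloor>y\<rfloor>" for z :: int
    by (simp add: le_floor_iff)
  also have "1 + \<bar>z\<bar> \<le> \<lfloor>y\<rfloor> \<longleftrightarrow> - (\<lfloor>y\<rfloor> - 1) \<le> z \<and> z \<le> \<lfloor>y\<rfloor> - 1" for z :: int
    by linarith
  finally show ?thesis by (simp only: atLeastAtMost_def atLeast_def atMost_def Int_def mem_Collect_eq)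
qed

lemma card_int_ball_le: "y \<ge> 0 \<Longrightarrow> real (card {z::int. 1 + real_of_int \<bar>z\<bar> \<le> y}) \<le> 2 * y"
  unfolding int_ball_eq by simp linarith

lemma sum_inverse_int_ball_le:
  assumes R: "R \<ge> 1"
  shows "(\<Sum>z\<in>{z::int. 1 + real_of_int \<bar>z\<bar> \<le> R}. 1 / (1 + real_of_int \<bar>z\<bar>)) \<le> 2 * (1 + ln R)"
proof -
  let ?f = "\<lambda>z::int. 1 / (1 + real_of_int \<bar>z\<bar>)"
  define M where "M = nat \<lfloor>R\<rfloor>"
  have M: "M \<ge> 1" "real M \<le> R" "int M = \<lfloor>R\<rfloor>" using R unfolding M_def by linarith+
  let ?P = "(\<lambda>i. int i - 1) ` {1..M}" and ?Q = "(\<lambda>i. 1 - int i) ` {1..M}"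
  have "{z::int. 1 + real_of_int \<bar>z\<bar> \<le> R} \<subseteq> ?P \<union> ?Q"
  proof
    fix z :: int assume "z \<in> {z. 1 + real_of_int \<bar>z\<bar> \<le> R}"
    then have z: "- (int M - 1) \<le> z" "z \<le> int M - 1" unfolding int_ball_eq by (simp_all add: M)
    show "z \<in> ?P \<union> ?Q"
    proof (cases "z \<ge> 0")
      case True
      then show ?thesis using z by (intro UnI1 image_eqI[of _ _ "nat (z + 1)"]) auto
    next
      case False
      then show ?thesis using z by (intro UnI2 image_eqI[of _ _ "nat (1 - z)"]) auto
    qed
  qed
  then have "sum ?f {z::int. 1 + real_of_int \<bar>z\<bar> \<le> R} \<le> sum ?f (?P \<union> ?Q)"
    by (intro sum_mono2) auto
  also have "\<dots> \<le> sum ?f ?P + sum ?f ?Q"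
    using sum.union_inter[of ?P ?Q ?f] sum_nonneg[of "?P \<inter> ?Q" ?f] by simp
  also have "sum ?f ?P = harm M"
    by (subst sum.reindex) (auto simp: inj_on_def harm_def divide_inverse intro!: sum.cong)
  also have "sum ?f ?Q = harm M"
    by (subst sum.reindex) (auto simp: inj_on_def harm_def divide_inverse intro!: sum.cong)
  also have "harm M + harm M \<le> 2 * (1 + ln (real M))" using harm_le_ln[OF M(1)] by simp
  also have "\<dots> \<le> 2 * (1 + ln R)" using M R by simp
  finally show ?thesis .
qed

text \<open>Fix all coordinates but one. The free coordinate has at most \<open>2 R / \<Prod>\<^sub>i (1 + \<bar>k\<^sub>i\<bar>)\<close> values, and the sum of
these bounds over the fixed coordinates factorizes into harmonic sums. Treating one coordinate
separately keeps the exponent of the logarithm at \<open>d - 1\<close>.\<close>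
lemma hyperbolic_cross_card_le:
  assumes R: "R \<ge> 1"
  defines "K \<equiv> {k :: int ^ 'd. (\<Prod>i\<in>UNIV. 1 + real_of_int \<bar>k $ i\<bar>) \<le> R}"
  shows "finite K" and "real (card K) \<le> 2 * R * (2 * (1 + ln R)) ^ (CARD('d) - 1)"
proof -
  obtain i0 :: 'd where True by blast
  define J where "J = UNIV - {i0}"
  define A where "A = {z::int. 1 + real_of_int \<bar>z\<bar> \<le> R}"
  define P where "P = (\<lambda>g :: 'd \<Rightarrow> int. \<Prod>i\<in>J. 1 + real_of_int \<bar>g i\<bar>)"
  define Z where "Z = (\<lambda>g. {z::int. 1 + real_of_int \<bar>z\<bar> \<le> R / P g})"
  have finA: "finite A" unfolding A_def int_ball_eq by simp
  have finZ: "finite (Z g)" for g unfolding Z_def int_ball_eq by simp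
  have finJ: "finite J" by (simp add: J_def)
  have P1: "P g \<ge> 1" for g unfolding P_def by (intro prod_ge_1) auto
  define \<phi> where "\<phi> = (\<lambda>k :: int ^ 'd. (restrict (($) k) J, k $ i0))"
  have inj: "inj_on \<phi> K"
  proof (rule inj_onI)
    fix k l assume "\<phi> k = \<phi> l"
    then have a: "restrict (($) k) J = restrict (($) l) J" and b: "k $ i0 = l $ i0" by (auto simp: \<phi>_def)
    have "k $ i = l $ i" for i
      using b fun_cong[OF a, of i] by (cases "i = i0") (auto simp: J_def)
    then show "k = l" by (simp add: Finite_Cartesian_Product.vec_eq_iff)
  qed
  have split: "(\<Prod>i\<in>UNIV. 1 + real_of_int \<bar>k $ i\<bar>) = (1 + real_of_int \<bar>k $ i0\<bar>) * P (($) k)" for k :: "int ^ 'd"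
    unfolding P_def J_def by (simp add: prod.remove[of UNIV i0])
  have sub: "\<phi> ` K \<subseteq> (SIGMA g:PiE J (\<lambda>_. A). Z g)"
  proof
    fix y assume "y \<in> \<phi> ` K"
    then obtain k where k: "(\<Prod>i\<in>UNIV. 1 + real_of_int \<bar>k $ i\<bar>) \<le> R" and y: "y = \<phi> k" by (auto simp: K_def)
    have "k $ i \<in> A" for i
    proof -
      have "(1 + real_of_int \<bar>k $ i\<bar>) * 1 \<le> (1 + real_of_int \<bar>k $ i\<bar>) * (\<Prod>j\<in>UNIV - {i}. 1 + real_of_int \<bar>k $ j\<bar>)"
        by (intro mult_left_mono prod_ge_1) auto
      also have "\<dots> = (\<Prod>i\<in>UNIV. 1 + real_of_int \<bar>k $ i\<bar>)" by (simp add: prod.remove[of UNIV i])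
      finally show ?thesis using k by (simp add: A_def)
    qed
    moreover have "P (restrict (($) k) J) = P (($) k)" by (simp add: P_def)
    moreover have "1 + real_of_int \<bar>k $ i0\<bar> \<le> R / P (($) k)"
      using k P1[of "($) k"] unfolding split by (simp add: field_simps)
    ultimately show "y \<in> (SIGMA g:PiE J (\<lambda>_. A). Z g)" by (auto simp: y \<phi>_def Z_def)
  qed
  have finS: "finite (SIGMA g:PiE J (\<lambda>_. A). Z g)"
    by (intro finite_SigmaI finite_PiE finJ finA finZ)
  show "finite K" using finite_subset[OF sub finS] finite_image_iff[OF inj] by simp
  have "real (card K) = real (card (\<phi> ` K))" by (simp add: card_image[OF inj])
  also have "\<dots> \<le> real (card (SIGMA g:PiE J (\<lambda>_. A). Z g))"
    using card_mono[OF finS sub] by simp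
  also have "\<dots> = (\<Sum>g\<in>PiE J (\<lambda>_. A). real (card (Z g)))"
    by (subst card_SigmaI) (auto intro!: finite_PiE finJ finA finZ)
  also have "\<dots> \<le> (\<Sum>g\<in>PiE J (\<lambda>_. A). 2 * (R / P g))"
  proof (rule sum_mono)
    fix g
    have "0 \<le> R / P g" using R P1[of g] by simp
    then show "real (card (Z g)) \<le> 2 * (R / P g)" unfolding Z_def by (rule card_int_ball_le)
  qed
  also have "\<dots> = 2 * R * (\<Sum>g\<in>PiE J (\<lambda>_. A). \<Prod>i\<in>J. 1 / (1 + real_of_int \<bar>g i\<bar>))"
    by (simp add: P_def prod_dividef sum_distrib_left)
  also have "(\<Sum>g\<in>PiE J (\<lambda>_. A). \<Prod>i\<in>J. 1 / (1 + real_of_int \<bar>g i\<bar>)) = (\<Prod>i\<in>J. \<Sum>z\<in>A. 1 / (1 + real_of_int \<bar>z\<bar>))"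
    by (rule prod_sum_PiE[symmetric]) (use finJ finA in auto)
  also have "\<dots> = (\<Sum>z\<in>A. 1 / (1 + real_of_int \<bar>z\<bar>)) ^ (CARD('d) - 1)"
    by (simp add: J_def)
  also have "2 * R * \<dots> \<le> 2 * R * (2 * (1 + ln R)) ^ (CARD('d) - 1)"
    using R sum_inverse_int_ball_le[OF R] unfolding A_def
    by (intro mult_left_mono power_mono sum_nonneg) auto
  finally show "real (card K) \<le> 2 * R * (2 * (1 + ln R)) ^ (CARD('d) - 1)" .
qed

text \<open>Both kinds of weight dominate \<open>(1 + \<bar>z\<bar>)\<^sup>s\<close>, since \<open>2 \<pi> \<bar>z\<bar> \<ge> 1 + \<bar>z\<bar>\<close> for integers \<open>z \<noteq> 0\<close>.\<close>
lemma weight_ge: 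
  assumes s: "s > 0"
  shows "(1 + real_of_int \<bar>z\<bar>) powr s \<le> weight w s z"
proof -
  have pi: "real_of_int \<bar>z\<bar> \<le> 2 * pi * real_of_int \<bar>z\<bar>" "z \<noteq> 0 \<Longrightarrow> 1 + real_of_int \<bar>z\<bar> \<le> 2 * pi * real_of_int \<bar>z\<bar>"
  proof -
    have "1 * real_of_int \<bar>z\<bar> \<le> 2 * pi * real_of_int \<bar>z\<bar>" using pi_ge_two by (intro mult_right_mono) auto
    then show "real_of_int \<bar>z\<bar> \<le> 2 * pi * real_of_int \<bar>z\<bar>" by simp
    have "2 * real_of_int \<bar>z\<bar> \<le> 2 * pi * real_of_int \<bar>z\<bar>" using pi_ge_two by (intro mult_right_mono) auto
    moreover assume "z \<noteq> 0"
    then have "1 \<le> \<bar>z\<bar>" by simp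
    then have "1 \<le> real_of_int \<bar>z\<bar>" by linarith
    ultimately show "1 + real_of_int \<bar>z\<bar> \<le> 2 * pi * real_of_int \<bar>z\<bar>" by linarith
  qed
  show ?thesis
  proof (cases w)
    case Sharp
    then show ?thesis using pi(1) s by (simp add: powr_mono2)
  next
    case Star
    show ?thesis
    proof (cases "z = 0")
      case False
      have "(1 + real_of_int \<bar>z\<bar>) powr s \<le> (2 * pi * real_of_int \<bar>z\<bar>) powr s"
        using pi(2)[OF False] s by (intro powr_mono2) auto
      also have "\<dots> = sqrt (((2 * pi * real_of_int \<bar>z\<bar>) powr s)\<^sup>2)" by simp
      also have "((2 * pi * real_of_int \<bar>z\<bar>) powr s)\<^sup>2 = (2 * pi * real_of_int \<bar>z\<bar>) powr (2 * s)"
        by (simp add: power2_eq_square flip: powr_add)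
      also have "sqrt \<dots> \<le> weight w s z" by (simp add: Star)
      finally show ?thesis .
    qed (simp add: Star)
  qed
qed

lemma mix_weight_ge:
  assumes s: "s > 0"
  shows "(\<Prod>i\<in>UNIV. 1 + real_of_int \<bar>k $ i\<bar>) powr s \<le> mix_weight w s k"
proof -
  have "(\<Prod>i\<in>UNIV. 1 + real_of_int \<bar>k $ i\<bar>) powr s = (\<Prod>i\<in>UNIV. (1 + real_of_int \<bar>k $ i\<bar>) powr s)"
    by (rule prod_powr_distrib)
  also have "\<dots> \<le> mix_weight w s k"
    unfolding mix_weight_def by (intro prod_mono conjI weight_ge[OF s]) simp
  finally show ?thesis .
qed

definition cross_decay :: "nat \<Rightarrow> nat \<Rightarrow> real" where
  "cross_decay d j = 2 ^ d * (1 + ln (real j)) ^ (d - 1) / real j"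

text \<open>With \<open>R = \<sigma>\<^sub>j\<^sup>-\<^sup>1\<^sup>/\<^sup>s\<close>, the first \<open>j\<close> frequencies all lie in the hyperbolic cross of size \<open>R\<close>, which
bounds \<open>j\<close> in terms of \<open>R\<close>. The bound is inverted with \<open>ln R \<le> ln j\<close>, unless \<open>R \<ge> j\<close> already.\<close>
lemma sing_num_le_cross_decay:
  fixes e :: "nat \<Rightarrow> int ^ 'd"
  assumes s: "s > 0" and e: "mix_enumeration w s e" and j: "j \<ge> 1"
  shows "sing_num w s e j \<le> cross_decay CARD('d) j powr s"
proof -
  define R where "R = mix_weight w s (e j) powr (1 / s)"
  have \<omega>: "mix_weight w s (e j) \<ge> 1" using s by (intro mix_weight_ge_1) simp
  have R1: "R \<ge> 1" unfolding R_def using \<omega> s by (intro ge_one_powr_ge_zero) auto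
  have Rs: "sing_num w s e j = (1 / R) powr s"
    using \<omega> s by (simp add: sing_num_def R_def powr_powr powr_divide inverse_eq_divide)
  let ?K = "{k :: int ^ 'd. (\<Prod>i\<in>UNIV. 1 + real_of_int \<bar>k $ i\<bar>) \<le> R}"
  have "e ` {1..j} \<subseteq> ?K"
  proof
    fix k assume "k \<in> e ` {1..j}"
    then obtain i where i: "1 \<le> i" "i \<le> j" "k = e i" by auto
    have "sing_num w s e j \<le> sing_num w s e i" using sing_num_antimono[OF e] i by blast
    then have le: "mix_weight w s k \<le> mix_weight w s (e j)"
      using \<omega> mix_weight_ge_1[of s w k] s i(3) by (simp add: sing_num_def)
    let ?p = "\<Prod>i\<in>UNIV. 1 + real_of_int \<bar>k $ i\<bar>"
    have p0: "?p \<ge> 1" by (intro prod_ge_1) auto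
    have "?p powr s \<le> mix_weight w s (e j)" using mix_weight_ge[OF s, of k w] le by linarith
    then have "(?p powr s) powr (1 / s) \<le> R" unfolding R_def using s by (intro powr_mono2) auto
    then have "?p \<le> R" using s p0 by (simp add: powr_powr)
    then show "k \<in> ?K" by simp
  qed
  then have "card (e ` {1..j}) \<le> card ?K"
    by (rule card_mono[OF hyperbolic_cross_card_le(1)[OF R1]])
  moreover have "inj_on e {1..j}"
    using e unfolding mix_enumeration_def bij_betw_def by (auto intro: inj_on_subset)
  ultimately have "j \<le> card ?K" by (simp add: card_image)
  then have cnt: "real j \<le> 2 * R * (2 * (1 + ln R)) ^ (CARD('d) - 1)"
    using hyperbolic_cross_card_le(2)[OF R1, where 'd='d] by linarith
  have d: "CARD('d) \<ge> 1" by (simp add: Suc_leI)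
  have lnj: "ln (real j) \<ge> 0" using j by simp
  have "1 / R \<le> cross_decay CARD('d) j"
  proof (cases "R \<ge> real j")
    case True
    have "1 / R \<le> 1 / real j" using True j by (intro divide_left_mono) auto
    also have "\<dots> \<le> cross_decay CARD('d) j"
    proof -
      have "1 * 1 \<le> (2::real) ^ CARD('d) * (1 + ln (real j)) ^ (CARD('d) - 1)"
        using lnj by (intro mult_mono one_le_power) auto
      then show ?thesis unfolding cross_decay_def using j by (intro divide_right_mono) auto
    qed
    finally show ?thesis .
  next
    case False
    then have "ln R \<le> ln (real j)" using R1 by simp
    then have "2 * R * (2 * (1 + ln R)) ^ (CARD('d) - 1) \<le> 2 * R * (2 * (1 + ln (real j))) ^ (CARD('d) - 1)"
      using R1 by (intro mult_left_mono power_mono) auto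
    then have "real j \<le> 2 * R * (2 * (1 + ln (real j))) ^ (CARD('d) - 1)" using cnt by linarith
    also have "\<dots> = R * (2 ^ CARD('d) * (1 + ln (real j)) ^ (CARD('d) - 1))"
    proof -
      have "(2::real) ^ CARD('d) = 2 * 2 ^ (CARD('d) - 1)"
        using power_Suc[of "2::real" "CARD('d) - 1"] d by simp
      then show ?thesis by (simp only: power_mult_distrib mult_ac)
    qed
    finally show ?thesis unfolding cross_decay_def using R1 j by (simp add: field_simps)
  qed
  then show ?thesis unfolding Rs using s R1 by (intro powr_mono2) auto
qed

text \<open>Logarithms are dominated by any power: \<open>ln t \<le> t\<^sup>\<epsilon> / \<epsilon>\<close> with \<open>\<epsilon> = \<gamma> / (a + 1)\<close>.\<close>
lemma one_plus_ln_powr_le: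
  fixes t a \<gamma> :: real
  assumes t: "t \<ge> 1" and a: "a \<ge> 0" and \<gamma>: "\<gamma> > 0"
  shows "(1 + ln t) powr a \<le> (1 + (a + 1) / \<gamma>) powr a * t powr \<gamma>"
proof -
  define \<epsilon> where "\<epsilon> = \<gamma> / (a + 1)"
  have a1: "a + 1 > 0" using a by simp
  have \<epsilon>: "\<epsilon> > 0" "\<epsilon> * a \<le> \<gamma>"
  proof -
    show "\<epsilon> > 0" unfolding \<epsilon>_def using a1 \<gamma> by (intro divide_pos_pos)
    have "\<epsilon> * a \<le> \<epsilon> * (a + 1)" using \<open>\<epsilon> > 0\<close> by simp
    also have "\<dots> = \<gamma>" using a1 by (simp add: \<epsilon>_def)
    finally show "\<epsilon> * a \<le> \<gamma>" .
  qed
  have "1 + ln t \<le> t powr \<epsilon> + t powr \<epsilon> / \<epsilon>"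
    using ln_powr_bound[OF t \<epsilon>(1)] ge_one_powr_ge_zero[OF t, of \<epsilon>] \<epsilon>(1) by simp
  also have "\<dots> = (1 + (a + 1) / \<gamma>) * t powr \<epsilon>"
    using a1 \<gamma> by (simp add: \<epsilon>_def distrib_right distrib_left mult.commute)
  finally have "(1 + ln t) powr a \<le> ((1 + (a + 1) / \<gamma>) * t powr \<epsilon>) powr a"
    using t a by (intro powr_mono2) (auto simp: ln_ge_zero)
  also have "\<dots> = (1 + (a + 1) / \<gamma>) powr a * t powr (\<epsilon> * a)"
    using a \<gamma> by (simp add: powr_mult powr_powr)
  also have "\<dots> \<le> (1 + (a + 1) / \<gamma>) powr a * t powr \<gamma>"
    using \<epsilon> t by (intro mult_left_mono powr_mono) auto
  finally show ?thesis .
qed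

text \<open>Each term is at most a difference of consecutive values of \<open>x\<^sup>-\<^sup>\<gamma> / \<gamma>\<close> by the mean value theorem, and the
differences telescope.\<close>
lemma sum_powr_tail_le:
  assumes m: "m \<ge> 2" and \<gamma>: "\<gamma> > 0"
  shows "(\<Sum>k\<in>{m..<N}. real k powr (- 1 - \<gamma>)) \<le> 2 powr \<gamma> / \<gamma> * real m powr (- \<gamma>)"
proof -
  have step: "real k powr (- 1 - \<gamma>) \<le> (real (k - 1) powr (- \<gamma>) - real k powr (- \<gamma>)) / \<gamma>" if "k \<ge> 2" for k
  proof -
    have "\<exists>z>real (k - 1). z < real k \<and> real k powr (- \<gamma>) - real (k - 1) powr (- \<gamma>)
        = (real k - real (k - 1)) * (- \<gamma> * z powr (- \<gamma> - 1))"
      using that by (intro MVT2) (auto intro!: derivative_eq_intros simp: of_nat_diff)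
    then obtain z where z: "z > real (k - 1)" "z < real k"
      and eq0: "real k powr (- \<gamma>) - real (k - 1) powr (- \<gamma>)
        = (real k - real (k - 1)) * (- \<gamma> * z powr (- \<gamma> - 1))"
      by blast
    have "real k - real (k - 1) = 1" using that by (simp add: of_nat_diff)
    then have eq: "real k powr (- \<gamma>) - real (k - 1) powr (- \<gamma>) = - \<gamma> * z powr (- \<gamma> - 1)"
      using eq0 by (simp only: mult_1)
    have "real k powr (- 1 - \<gamma>) \<le> z powr (- \<gamma> - 1)"
    proof -
      have e: "- \<gamma> - 1 = - 1 - \<gamma>" by simp
      show ?thesis unfolding e using z \<gamma> that by (intro powr_mono2') auto
    qed
    also have "\<dots> = (real (k - 1) powr (- \<gamma>) - real k powr (- \<gamma>)) / \<gamma>"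
      using eq \<gamma> by (simp add: field_simps)
    finally show ?thesis .
  qed
  have tel: "(\<Sum>k\<in>{m..<N}. real (k - 1) powr (- \<gamma>) - real k powr (- \<gamma>)) \<le> real (m - 1) powr (- \<gamma>)"
  proof (cases "m \<le> N")
    case True
    have "(\<Sum>k\<in>{m..<N}. real (k - 1) powr (- \<gamma>) - real k powr (- \<gamma>)) = real (m - 1) powr (- \<gamma>) - real (N - 1) powr (- \<gamma>)"
      using True
    proof (induction N rule: dec_induct)
      case (step N)
      then show ?case using m by simp
    qed simp
    then show ?thesis by simp
  qed simp
  have "(\<Sum>k\<in>{m..<N}. real k powr (- 1 - \<gamma>)) \<le> (\<Sum>k\<in>{m..<N}. (real (k - 1) powr (- \<gamma>) - real k powr (- \<gamma>)) / \<gamma>)"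
    using m by (intro sum_mono step) auto
  also have "\<dots> \<le> real (m - 1) powr (- \<gamma>) / \<gamma>"
    unfolding sum_divide_distrib[symmetric] using tel \<gamma> by (intro divide_right_mono) auto
  also have "\<dots> \<le> (real m / 2) powr (- \<gamma>) / \<gamma>"
    using m \<gamma> by (intro divide_right_mono powr_mono2') (auto simp: of_nat_diff)
  also have "(real m / 2) powr (- \<gamma>) = 2 powr \<gamma> * real m powr (- \<gamma>)"
  proof -
    have "(real m / 2) powr (- \<gamma>) = real m powr (- \<gamma>) / 2 powr (- \<gamma>)"
      by (rule powr_divide)
    also have "\<dots> = 2 powr \<gamma> * real m powr (- \<gamma>)"
      unfolding powr_minus[of 2 \<gamma>] by (simp only: divide_inverse inverse_inverse_eq mult.commute)
    finally show ?thesis .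
  qed
  finally show ?thesis by (simp only: times_divide_eq_left)
qed

definition tail_const :: "nat \<Rightarrow> real \<Rightarrow> real" where
  "tail_const d s = (let \<gamma> = s - 1 / 2; a = 2 * s * real (d - 1)
     in 2 powr (2 * s * real d) * (1 + (a + 1) / \<gamma>) powr a * (2 powr \<gamma> / \<gamma>))"

lemma tail_const_pos:
  assumes s: "s > 1 / 2"
  shows "tail_const d s > 0"
proof -
  have "0 \<le> 2 * s * real (d - 1)" using s by simp
  then have "0 < 2 * s * real (d - 1) + 1" by linarith
  then have "0 < (2 * s * real (d - 1) + 1) / (s - 1 / 2)" using s by (intro divide_pos_pos) auto
  then have "1 + (2 * s * real (d - 1) + 1) / (s - 1 / 2) \<noteq> 0" by linarith
  then have "0 < (1 + (2 * s * real (d - 1) + 1) / (s - 1 / 2)) powr (2 * s * real (d - 1))"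
    unfolding powr_gt_zero .
  then show ?thesis
    unfolding tail_const_def Let_def using s
    by (intro mult_pos_pos divide_pos_pos) simp_all
qed

text \<open>Since \<open>1 + ln k \<le> (1 + ln m) (1 + ln (k / m))\<close>, the logarithmic factor at \<open>k\<close> is the one at \<open>m\<close> up to a
small power of \<open>k / m\<close>. The power \<open>\<gamma> = s - 1/2\<close> leaves the summable exponent \<open>- 1 - \<gamma>\<close>.\<close>
lemma sing_num_tail_le:
  fixes e :: "nat \<Rightarrow> int ^ 'd"
  assumes s: "s > 1 / 2" and e: "mix_enumeration w s e" and m: "m \<ge> 2"
  shows "(\<Sum>k\<in>{m..<N}. (sing_num w s e k)\<^sup>2)
    \<le> tail_const CARD('d) s * (1 + ln (real m)) powr (2 * s * real (CARD('d) - 1)) * real m powr (1 - 2 * s)"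
proof -
  define d where "d = CARD('d)"
  define \<gamma> where "\<gamma> = s - 1 / 2"
  define a where "a = 2 * s * real (d - 1)"
  define C where "C = 2 powr (2 * s * real d) * (1 + (a + 1) / \<gamma>) powr a"
  have \<gamma>: "\<gamma> > 0" using s by (simp add: \<gamma>_def)
  have a: "a \<ge> 0" using s by (simp add: a_def)
  have lm: "ln (real m) \<ge> 0" using m by simp
  have C0: "C \<ge> 0" by (simp add: C_def)
  have "(sing_num w s e k)\<^sup>2 \<le> C * (1 + ln (real m)) powr a * real m powr (- \<gamma>) * real k powr (- 1 - \<gamma>)"
    if k: "k \<in> {m..<N}" for k
  proof -
    have km: "real m \<le> real k" "k \<ge> 1" "m \<ge> 1" using k m by auto
    have lk: "ln (real k) \<ge> 0" using km by simp
    have "(sing_num w s e k)\<^sup>2 \<le> (cross_decay d k powr s)\<^sup>2"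
      unfolding d_def using sing_num_le_cross_decay[OF _ e km(2)] sing_num_pos[of s w e k] s
      by (intro power_mono) auto
    also have "\<dots> = cross_decay d k powr (2 * s)"
      by (simp add: power2_eq_square flip: powr_add)
    also have "\<dots> = 2 powr (2 * s * real d) * (1 + ln (real k)) powr a * real k powr (- 2 * s)"
    proof -
      have "cross_decay d k = 2 powr real d * (1 + ln (real k)) powr real (d - 1) * real k powr (- 1)"
        using lk km by (simp add: cross_decay_def powr_realpow powr_minus divide_inverse add_pos_nonneg)
      then show ?thesis
        unfolding a_def by (simp only: powr_mult powr_powr) (simp add: mult_ac)
    qed
    also have "\<dots> \<le> 2 powr (2 * s * real d) * ((1 + ln (real m)) powr a * ((1 + (a + 1) / \<gamma>) powr a * (real k / real m) powr \<gamma>)) * real k powr (- 2 * s)"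
    proof (intro mult_left_mono mult_right_mono)
      have t1: "real k / real m \<ge> 1" using km by simp
      have lt: "ln (real k / real m) \<ge> 0" using t1 by simp
      have "1 + ln (real k) = 1 + ln (real m) + ln (real k / real m)"
        using km by (simp add: ln_div)
      also have "\<dots> \<le> (1 + ln (real m)) * (1 + ln (real k / real m))"
        using mult_nonneg_nonneg[OF lm lt] by (simp add: algebra_simps)
      finally have "(1 + ln (real k)) powr a \<le> ((1 + ln (real m)) * (1 + ln (real k / real m))) powr a"
        using lk a by (intro powr_mono2) auto
      also have "\<dots> = (1 + ln (real m)) powr a * (1 + ln (real k / real m)) powr a"
        by (rule powr_mult)
      also have "\<dots> \<le> (1 + ln (real m)) powr a * ((1 + (a + 1) / \<gamma>) powr a * (real k / real m) powr \<gamma>)"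
        by (intro mult_left_mono one_plus_ln_powr_le t1 a \<gamma>) simp
      finally show "(1 + ln (real k)) powr a \<le> (1 + ln (real m)) powr a * ((1 + (a + 1) / \<gamma>) powr a * (real k / real m) powr \<gamma>)" .
    qed auto
    also have "\<dots> = C * (1 + ln (real m)) powr a * real m powr (- \<gamma>) * (real k powr \<gamma> * real k powr (- 2 * s))"
    proof -
      have e: "(real k / real m) powr \<gamma> = real k powr \<gamma> * real m powr (- \<gamma>)"
        unfolding powr_divide powr_minus by (simp only: divide_inverse)
      show ?thesis unfolding C_def e by (simp only: mult_ac)
    qed
    also have "real k powr \<gamma> * real k powr (- 2 * s) = real k powr (- 1 - \<gamma>)"
    proof -
      have "\<gamma> + - 2 * s = - 1 - \<gamma>" by (simp add: \<gamma>_def)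
      then show ?thesis by (simp only: powr_add[symmetric])
    qed
    finally show ?thesis .
  qed
  then have "(\<Sum>k\<in>{m..<N}. (sing_num w s e k)\<^sup>2)
      \<le> (\<Sum>k\<in>{m..<N}. C * (1 + ln (real m)) powr a * real m powr (- \<gamma>) * real k powr (- 1 - \<gamma>))"
    by (rule sum_mono)
  also have "\<dots> = C * (1 + ln (real m)) powr a * real m powr (- \<gamma>) * (\<Sum>k\<in>{m..<N}. real k powr (- 1 - \<gamma>))"
    by (rule sum_distrib_left[symmetric])
  also have "\<dots> \<le> C * (1 + ln (real m)) powr a * real m powr (- \<gamma>) * (2 powr \<gamma> / \<gamma> * real m powr (- \<gamma>))"
    by (intro mult_left_mono sum_powr_tail_le m \<gamma> mult_nonneg_nonneg C0) auto
  also have "\<dots> = C * (2 powr \<gamma> / \<gamma>) * (1 + ln (real m)) powr a * (real m powr (- \<gamma>) * real m powr (- \<gamma>))"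
    by (simp add: mult_ac)
  also have "real m powr (- \<gamma>) * real m powr (- \<gamma>) = real m powr (1 - 2 * s)"
  proof -
    have "- \<gamma> + - \<gamma> = 1 - 2 * s" by (simp add: \<gamma>_def)
    then show ?thesis by (simp only: powr_add[symmetric])
  qed
  also have "C * (2 powr \<gamma> / \<gamma>) = tail_const d s"
    by (simp add: tail_const_def Let_def C_def a_def \<gamma>_def)
  finally show ?thesis by (simp add: d_def a_def)
qed

lemma sing_num_squares_summable:
  fixes e :: "nat \<Rightarrow> int ^ 'd"
  assumes s: "s > 1 / 2" and e: "mix_enumeration w s e"
  defines "T \<equiv> 1 + tail_const CARD('d) s * (1 + ln 2) powr (2 * s * real (CARD('d) - 1)) * 2 powr (1 - 2 * s)"
  shows "summable (\<lambda>j. (sing_num w s e (Suc j))\<^sup>2)" and "(\<Sum>j. (sing_num w s e (Suc j))\<^sup>2) \<le> T"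
proof -
  have partial: "(\<Sum>j<N. (sing_num w s e (Suc j))\<^sup>2) \<le> T" for N
  proof (cases N)
    case 0
    then show ?thesis using tail_const_pos[OF s, of "CARD('d)"] by (simp add: T_def)
  next
    case (Suc M)
    have "e (Suc 0) = 0" using mix_enumeration_first[OF _ e, of 0] s by simp
    then have s1: "sing_num w s e (Suc 0) = 1" by (simp add: sing_num_def mix_weight_zero)
    have "(\<Sum>j<N. (sing_num w s e (Suc j))\<^sup>2) = 1 + (\<Sum>j<M. (sing_num w s e (j + 2))\<^sup>2)"
      unfolding Suc sum.lessThan_Suc_shift by (simp add: s1)
    also have "(\<Sum>j<M. (sing_num w s e (j + 2))\<^sup>2) = (\<Sum>k\<in>{2..<M + 2}. (sing_num w s e k)\<^sup>2)"
      using sum.shift_bounds_nat_ivl[of "\<lambda>k. (sing_num w s e k)\<^sup>2" 0 2 M] by (simp only: atLeast0LessThan add_0)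
    finally show ?thesis using sing_num_tail_le[OF s e, of 2 "M + 2"] by (simp add: T_def)
  qed
  have "(\<Sum>j\<le>N. (sing_num w s e (Suc j))\<^sup>2) \<le> T" for N
    using partial[of "Suc N"] by (simp only: lessThan_Suc_atMost)
  then show sm: "summable (\<lambda>j. (sing_num w s e (Suc j))\<^sup>2)"
    by (intro bounded_imp_summable) auto
  show "(\<Sum>j. (sing_num w s e (Suc j))\<^sup>2) \<le> T"
    by (rule suminf_le_const[OF sm partial])
qed

section \<open>The rate of convergence\<close>

definition rate_const :: "nat \<Rightarrow> real \<Rightarrow> real" where
  "rate_const d s = (let G = 48 * (3 + 2 * s) in (4 ^ d * G) powr s +
     sqrt (4 * tail_const d s * 2 powr (2 * s * real (d - 1)) * G powr (2 * s - 1)))"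

text \<open>Insert \<open>1 / m \<le> G ln n / n\<close> and \<open>1 + ln m \<le> 2 ln n\<close> in the decay estimates. In both terms of the maximum
the powers of \<open>ln n\<close> add up to \<open>s d\<close>: one factor \<open>(ln n)\<^sup>s\<close> comes from \<open>m\<close>, the rest from the
hyperbolic cross.\<close>
lemma error_bound_le_rate:
  fixes e :: "nat \<Rightarrow> int ^ 'd"
  assumes s: "s > 1 / 2" and e: "mix_enumeration w s e"
    and m: "2 \<le> m" "m \<le> n" and n: "n \<ge> 3" and mn: "real n \<le> 48 * (3 + 2 * s) * ln (real n) * real m"
  shows "max (sing_num w s e m) (sqrt (ln (8 * real n) / real n * (\<Sum>k. (sing_num w s e (k + m))\<^sup>2)))
    \<le> rate_const CARD('d) s * real n powr (- s) * ln (real n) powr (s * real CARD('d))"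
proof -
  define d where "d = CARD('d)"
  define G where "G = 48 * (3 + 2 * s)"
  define l where "l = ln (real n)"
  define a where "a = 2 * s * real (d - 1)"
  define C2 where "C2 = (4 ^ d * G) powr s"
  define C3 where "C3 = 4 * tail_const d s * 2 powr a * G powr (2 * s - 1)"
  define r where "r = real n powr (- s) * l powr (s * real d)"
  have d: "d \<ge> 1" unfolding d_def by (simp add: Suc_leI)
  have G: "G > 0" using s by (simp add: G_def)
  have l: "l \<ge> 1"
  proof -
    have "exp 1 \<le> real n" using exp_le n by linarith
    then show ?thesis unfolding l_def using n by (subst ln_ge_iff) auto
  qed
  have n0: "real n > 0" and m0: "real m > 0" using n m by auto
  have "ln (real m) \<le> l" unfolding l_def using m m0 n0 by (subst ln_le_cancel_iff) auto
  then have lm: "0 \<le> ln (real m)" "1 + ln (real m) \<le> 2 * l" using m l by auto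
  have inv_m: "1 / real m \<le> G * l / real n"
    using mn m0 n0 by (simp add: G_def l_def field_simps)
  have r0: "r \<ge> 0" by (simp add: r_def)
  have C30: "C3 \<ge> 0" using tail_const_pos[OF s, of d] by (simp add: C3_def)
  have 1: "sing_num w s e m \<le> C2 * r"
  proof -
    have "cross_decay d m = 2 ^ d * (1 + ln (real m)) ^ (d - 1) * (1 / real m)"
      by (simp add: cross_decay_def)
    also have "\<dots> \<le> 2 ^ d * (2 * l) ^ (d - 1) * (G * l / real n)"
      using lm l G by (intro mult_mono power_mono inv_m mult_nonneg_nonneg) auto
    also have "\<dots> = 2 ^ d * 2 ^ (d - 1) * G * (l ^ (d - 1) * l) / real n"
      by (simp add: power_mult_distrib mult_ac)
    also have "l ^ (d - 1) * l = l ^ d" using d power_Suc2[of l "d - 1"] by simp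
    also have "2 ^ d * 2 ^ (d - 1) * G * l ^ d / real n \<le> 2 ^ d * 2 ^ d * G * l ^ d / real n"
      using G l by (intro divide_right_mono mult_right_mono mult_left_mono power_increasing) auto
    also have "\<dots> = (4 ^ d * G) * (l ^ d / real n)" by (simp add: power_mult_distrib[symmetric])
    finally have "cross_decay d m powr s \<le> ((4 ^ d * G) * (l ^ d / real n)) powr s"
      using s lm by (intro powr_mono2) (auto simp: cross_decay_def)
    also have "\<dots> = C2 * r"
    proof -
      have "l ^ d = l powr real d" using l by (simp add: powr_realpow)
      then have "(l ^ d / real n) powr s = r"
        unfolding r_def powr_divide by (simp add: powr_powr powr_minus divide_inverse mult_ac)
      then show ?thesis unfolding powr_mult C2_def by simp
    qed
    finally show ?thesis
      using sing_num_le_cross_decay[OF _ e, of m] s m by (simp add: d_def)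
  qed
  have 2: "sqrt (ln (8 * real n) / real n * (\<Sum>k. (sing_num w s e (k + m))\<^sup>2)) \<le> sqrt C3 * r"
  proof -
    define T where "T = (\<Sum>k. (sing_num w s e (k + m))\<^sup>2)"
    define U where "U = tail_const d s * (2 * l) powr a * (G * l / real n) powr (2 * s - 1)"
    have sumT: "summable (\<lambda>k. (sing_num w s e (k + m))\<^sup>2)"
      using sing_num_squares_summable(1)[OF s e]
      by (simp only: summable_Suc_iff[of "\<lambda>k. (sing_num w s e k)\<^sup>2"] summable_iff_shift[of "\<lambda>k. (sing_num w s e k)\<^sup>2"])
    have T0: "T \<ge> 0" unfolding T_def by (rule suminf_nonneg[OF sumT]) simp
    from sumT have "T \<le> tail_const d s * (1 + ln (real m)) powr a * real m powr (1 - 2 * s)"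
      unfolding T_def
    proof (rule suminf_le_const)
      fix N
      have "(\<Sum>k<N. (sing_num w s e (k + m))\<^sup>2) = (\<Sum>k\<in>{m..<N + m}. (sing_num w s e k)\<^sup>2)"
        using sum.shift_bounds_nat_ivl[of "\<lambda>k. (sing_num w s e k)\<^sup>2" 0 m N] by (simp only: atLeast0LessThan add_0)
      also have "\<dots> \<le> tail_const d s * (1 + ln (real m)) powr a * real m powr (1 - 2 * s)"
        unfolding d_def a_def by (rule sing_num_tail_le[OF s e m(1)])
      finally show "(\<Sum>k<N. (sing_num w s e (k + m))\<^sup>2) \<le> tail_const d s * (1 + ln (real m)) powr a * real m powr (1 - 2 * s)" .
    qed
    also have "\<dots> \<le> U"
      unfolding U_def
    proof (intro mult_mono)
      show "(1 + ln (real m)) powr a \<le> (2 * l) powr a"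
        using lm s by (intro powr_mono2) (auto simp: a_def)
      have "real m powr (1 - 2 * s) = (1 / real m) powr (2 * s - 1)"
        unfolding powr_divide using powr_minus[of "real m" "2 * s - 1"] by (simp add: divide_inverse)
      also have "\<dots> \<le> (G * l / real n) powr (2 * s - 1)"
        using s by (intro powr_mono2 inv_m) auto
      finally show "real m powr (1 - 2 * s) \<le> (G * l / real n) powr (2 * s - 1)" .
    qed (use tail_const_pos[OF s, of d] in auto)
    finally have TU: "T \<le> U" .
    have U0: "U \<ge> 0" using tail_const_pos[OF s, of d] by (simp add: U_def)
    have "ln (8 * real n) \<le> 4 * l"
    proof -
      have "ln (8 * real n) = ln 8 + l" using ln_mult[of 8 "real n"] n0 by (simp add: l_def)
      moreover have "ln (8::real) \<le> 3"
      proof -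
        have "ln (8::real) = 3 * ln 2" using ln_realpow[of 2 3] by simp
        then show ?thesis using ln_le_minus_one[of "2::real"] by simp
      qed
      ultimately show ?thesis using l by linarith
    qed
    then have "ln (8 * real n) / real n * T \<le> 4 * l / real n * U"
      using l n0 TU T0 by (intro mult_mono divide_right_mono) auto
    also have "\<dots> = C3 * (l * l powr a * l powr (2 * s - 1)) * (1 / (real n * real n powr (2 * s - 1)))"
      by (simp add: U_def C3_def powr_mult powr_divide mult_ac)
    also have "l * l powr a * l powr (2 * s - 1) = (l powr (s * real d))\<^sup>2"
    proof -
      have "l * l powr a * l powr (2 * s - 1) = l powr 1 * l powr a * l powr (2 * s - 1)" using l by simp
      also have "\<dots> = l powr (1 + a + (2 * s - 1))" by (simp only: powr_add)
      also have "1 + a + (2 * s - 1) = s * real d + s * real d"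
        using d by (simp add: a_def of_nat_diff algebra_simps)
      also have "l powr \<dots> = (l powr (s * real d))\<^sup>2" by (simp only: powr_add power2_eq_square)
      finally show ?thesis .
    qed
    also have "1 / (real n * real n powr (2 * s - 1)) = (real n powr (- s))\<^sup>2"
    proof -
      have "real n * real n powr (2 * s - 1) = real n powr (1 + (2 * s - 1))" using n0 by (simp only: powr_add powr_one)
      also have "1 + (2 * s - 1) = s + s" by simp
      finally have "1 / (real n * real n powr (2 * s - 1)) = 1 / (real n powr s * real n powr s)"
        by (simp only: powr_add)
      then show ?thesis by (simp add: powr_minus power2_eq_square divide_inverse)
    qed
    also have "C3 * (l powr (s * real d))\<^sup>2 * (real n powr (- s))\<^sup>2 = (sqrt C3 * r)\<^sup>2"
      using C30 by (simp add: r_def power_mult_distrib mult_ac)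
    finally have "sqrt (ln (8 * real n) / real n * T) \<le> sqrt ((sqrt C3 * r)\<^sup>2)" by (rule real_sqrt_le_mono)
    also have "\<dots> = sqrt C3 * r" using C30 r0 by simp
    finally show ?thesis by (simp add: T_def)
  qed
  have "C2 * r \<le> (C2 + sqrt C3) * r" "sqrt C3 * r \<le> (C2 + sqrt C3) * r"
    using r0 C30 by (auto intro!: mult_right_mono simp: C2_def)
  then have "max (sing_num w s e m) (sqrt (ln (8 * real n) / real n * (\<Sum>k. (sing_num w s e (k + m))\<^sup>2))) \<le> (C2 + sqrt C3) * r"
    using 1 2 by simp
  also have "C2 + sqrt C3 = rate_const d s"
    by (simp add: rate_const_def Let_def C2_def C3_def G_def a_def)
  finally show ?thesis by (simp add: r_def d_def l_def mult.assoc)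
qed

lemma nodes_le_num_freq:
  assumes \<delta>: "0 < \<delta>" "\<delta> < 1 / 3" and m: "num_freq n \<delta> \<ge> 2" and s: "s > 0" and big: "real n powr (- 2 * s) \<le> \<delta>"
  shows "real n \<le> 48 * (3 + 2 * s) * ln (real n) * real (num_freq n \<delta>)"
proof -
  note nb = num_freq_bounds[OF \<delta> m]
  have n: "n \<ge> 192" by (rule nb(5))
  have l0: "ln (real n) \<ge> 0" using n by simp
  have "ln (2 * real n) = ln 2 + ln (real n)" using ln_mult[of 2 "real n"] n by simp
  also have "\<dots> \<le> 2 * ln (real n)" using n by simp
  finally have "sqrt 2 * ln (2 * real n) \<le> 3 / 2 * (2 * ln (real n))"
    using n by (intro mult_mono real_le_lsqrt) (auto simp: power2_eq_square)
  moreover have "- 2 * s * ln (real n) \<le> ln \<delta>"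
  proof -
    have "ln (real n powr (- 2 * s)) \<le> ln \<delta>" using big \<delta> n by (subst ln_le_cancel_iff) auto
    then show ?thesis by (simp add: ln_powr)
  qed
  ultimately have "sqrt 2 * ln (2 * real n) - ln \<delta> \<le> (3 + 2 * s) * ln (real n)"
    by (simp add: algebra_simps)
  then have "48 * (sqrt 2 * ln (2 * real n) - ln \<delta>) * real (num_freq n \<delta>) \<le> 48 * ((3 + 2 * s) * ln (real n)) * real (num_freq n \<delta>)"
    by (intro mult_right_mono) auto
  then show ?thesis using nb(6) by (simp only: mult.assoc)
qed

theorem corollary8p6:
  fixes s :: real and w :: weight_kind
  assumes "s > 1 / 2"
  shows
    "(\<forall>(\<delta> :: real) (n :: nat) (e :: nat \<Rightarrow> int ^ 'd).
        0 < \<delta> \<and> \<delta> < 1 / 3 \<and> num_freq n \<delta> \<ge> 2 \<and> mix_enumeration w s e \<longrightarrow>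
        (let m = num_freq n \<delta> in
         measure (random_nodes n)
           {X \<in> space (random_nodes n).
              full_column_rank (L_mat e n m X) \<and>
              worst_case_error w s e n m X \<le>
                ereal (sqrt (29 / \<delta>) *
                  max (sing_num w s e m)
                      (sqrt (ln (8 * real n) / real n * (\<Sum>k. (sing_num w s e (k + m))\<^sup>2))))}
         \<ge> 1 - 3 * \<delta>)) \<and>
     (\<exists>C > 0. \<forall>(\<delta> :: real) (n :: nat) (e :: nat \<Rightarrow> int ^ 'd).
        0 < \<delta> \<and> \<delta> < 1 / 3 \<and> num_freq n \<delta> \<ge> 2 \<and> mix_enumeration w s e \<longrightarrow>
        (let m = num_freq n \<delta> in
         measure (random_nodes n)
           {X \<in> space (random_nodes n).
              full_column_rank (L_mat e n m X) \<and>
              worst_case_error w s e n m X \<le>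
                ereal (C / sqrt \<delta> * real n powr (- s) * ln (real n) powr (s * real CARD('d)))}
         \<ge> 1 - 3 * \<delta>))"
proof -
  have s0: "s > 0" using assms by simp
  let ?B1 = "\<lambda>\<delta> n (e :: nat \<Rightarrow> int ^ 'd). sqrt (29 / \<delta>) * max (sing_num w s e (num_freq n \<delta>))
      (sqrt (ln (8 * real n) / real n * (\<Sum>k. (sing_num w s e (k + num_freq n \<delta>))\<^sup>2)))"
  let ?E = "\<lambda>\<delta> n (e :: nat \<Rightarrow> int ^ 'd) B. {X \<in> space (random_nodes n).
      full_column_rank (L_mat e n (num_freq n \<delta>) X) \<and> worst_case_error w s e n (num_freq n \<delta>) X \<le> ereal B}"
  have first: "measure (random_nodes n) (?E \<delta> n e (?B1 \<delta> n e)) \<ge> 1 - 3 * \<delta>"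
    if "0 < \<delta>" "\<delta> < 1 / 3" "num_freq n \<delta> \<ge> 2" "mix_enumeration w s e" for \<delta> n and e :: "nat \<Rightarrow> int ^ 'd"
    by (rule cubature_error_probability[OF s0 that(4) sing_num_squares_summable(1)[OF assms that(4)] that(1-3)])
  define T where "T = 1 + tail_const CARD('d) s * (1 + ln 2) powr (2 * s * real (CARD('d) - 1)) * 2 powr (1 - 2 * s)"
  \<comment> \<open>the first entry serves \<open>\<delta> \<ge> n\<^sup>-\<^sup>2\<^sup>s\<close>, the second one smaller \<open>\<delta>\<close>\<close>
  define C where "C = max (sqrt 29 * rate_const CARD('d) s) (sqrt (2 * T))"
  have T: "T > 0" using tail_const_pos[OF assms, of "CARD('d)"] by (simp add: T_def add_pos_nonneg)
  then have C0: "C > 0" by (simp add: C_def less_max_iff_disj)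
  have "measure (random_nodes n) (?E \<delta> n e (C / sqrt \<delta> * real n powr (- s) * ln (real n) powr (s * real CARD('d)))) \<ge> 1 - 3 * \<delta>"
    if \<delta>: "0 < \<delta>" "\<delta> < 1 / 3" and m: "num_freq n \<delta> \<ge> 2" and e: "mix_enumeration w s e" for \<delta> n and e :: "nat \<Rightarrow> int ^ 'd"
  proof -
    let ?r = "real n powr (- s) * ln (real n) powr (s * real CARD('d))"
    let ?B = "C / sqrt \<delta> * real n powr (- s) * ln (real n) powr (s * real CARD('d))"
    interpret N: prob_space "random_nodes n :: (nat \<Rightarrow> real ^ 'd) measure" by (rule prob_space_random_nodes)
    note nb = num_freq_bounds[OF \<delta> m]
    have n: "n \<ge> 192" by (rule nb(5))
    have r0: "?r \<ge> 0" by simp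
    have B0: "?B \<ge> 0" using C0 \<delta> by simp
    note sm = sing_num_squares_summable[OF assms e]
    show ?thesis
    proof (cases "real n powr (- 2 * s) \<le> \<delta>")
      case True
      have "num_freq n \<delta> \<le> n"
      proof -
        have "2 * real (num_freq n \<delta> - 1) \<le> 48 * (sqrt 2 * ln (2 * real n) - ln \<delta>) * real (num_freq n \<delta> - 1)"
          using nb(2) by (intro mult_right_mono) auto
        also have "\<dots> \<le> real n" by (rule nb(1))
        finally have "2 * real (num_freq n \<delta> - 1) \<le> real n" .
        then show ?thesis using n m by linarith
      qed
      then have "?B1 \<delta> n e \<le> sqrt (29 / \<delta>) * (rate_const CARD('d) s * real n powr (- s) * ln (real n) powr (s * real CARD('d)))"
        using \<delta> n m nodes_le_num_freq[OF \<delta> m s0 True]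
        by (intro mult_left_mono error_bound_le_rate assms e) auto
      also have "\<dots> = (sqrt 29 * rate_const CARD('d) s) * (1 / sqrt \<delta> * ?r)"
        by (simp add: real_sqrt_divide)
      also have "\<dots> \<le> C * (1 / sqrt \<delta> * ?r)"
        using \<delta> by (intro mult_right_mono) (auto simp: C_def)
      also have "\<dots> = ?B" by simp
      finally have le: "?B1 \<delta> n e \<le> ?B" .
      have "?E \<delta> n e (?B1 \<delta> n e) \<subseteq> ?E \<delta> n e ?B"
        using le by (auto intro: order_trans)
      then have "measure (random_nodes n) (?E \<delta> n e (?B1 \<delta> n e)) \<le> measure (random_nodes n) (?E \<delta> n e ?B)"
        by (intro N.finite_measure_mono sets_worst_case_event less_imp_le[OF s0] e m sm(1) B0)
      then show ?thesis using first[OF \<delta> m e] by linarith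
    next
      case False
      have "sqrt \<delta> \<le> real n powr (- s)"
      proof -
        have "\<delta> \<le> (real n powr (- s))\<^sup>2" using False by (simp add: power2_eq_square flip: powr_add)
        then show ?thesis by (rule real_le_lsqrt[OF _ , rotated]) (use \<delta> in auto)
      qed
      then have "1 \<le> real n powr (- s) / sqrt \<delta>" using \<delta> by (simp add: field_simps)
      moreover have "1 \<le> ln (real n) powr (s * real CARD('d))"
      proof -
        have "exp 1 \<le> real n" using exp_le n by linarith
        then have "1 \<le> ln (real n)" using n by (subst ln_ge_iff) auto
        then show ?thesis using s0 by (intro ge_one_powr_ge_zero) auto
      qed
      ultimately have "1 * 1 \<le> (real n powr (- s) / sqrt \<delta>) * ln (real n) powr (s * real CARD('d))"
        by (intro mult_mono) auto
      then have "C * 1 \<le> C * ((real n powr (- s) / sqrt \<delta>) * ln (real n) powr (s * real CARD('d)))"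
        using C0 by (intro mult_left_mono) auto
      then have CB: "C \<le> ?B" by simp
      have "2 * (\<Sum>j. (sing_num w s e (Suc j))\<^sup>2) \<le> 2 * T" using sm(2) by (simp add: T_def)
      also have "\<dots> = (sqrt (2 * T))\<^sup>2" using T by simp
      also have "\<dots> \<le> ?B\<^sup>2"
        using T CB by (intro power_mono) (auto simp: C_def)
      finally have "measure (random_nodes n) (?E \<delta> n e ?B) \<ge> 1 - \<delta>"
        by (intro cubature_error_probability_crude s0 e sm(1) \<delta> m B0)
      then show ?thesis using \<delta> by linarith
    qed
  qed
  with first C0 show ?thesis unfolding Let_def by blast
qed

end
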